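(* Let $\lambda,\sigma>0$, $T>0$, and let $\xi\in L^2(\Omega)$ be a random variable. For $H\in(\frac12,1)$ let $$Y^H(t)=e^{-\lambda t}\left(\xi+\sigma\int_0^t e^{\lambda u}\,dZ^H(u)\right),\qquad t\in[0,T],$$ be the Rosenblatt Ornstein-Uhlenbeck process with initial condition $\xi$. Assume that the initial condition $\xi$ does not depend on $H$. Then, as $H\to1$, the process $(Y^H(t))_{t\in[0,T]}$ converges weakly, in the space of continuous functions $C[0,T]$, to the stochastic process $(Y(t))_{t\in[0,T]}$ given by $$Y(t)=e^{-\lambda t}\xi+\sigma\frac1{\sqrt2}\left(\int_0^t e^{-\lambda(t-u)}\,du\right)(Z^2-1)=e^{-\lambda t}\xi+\frac{\sigma}{\sqrt2\,\lambda}\left(1-e^{-\lambda t}\right)(Z^2-1),$$ with $Z\sim N(0,1)$.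
   Context: Let $(B(y))_{y\in\mathbb{R}}$ be a Wiener process on a probability space $(\Omega,\mathcal{F},P)$ and let $I_2$ denote the multiple (Wiener-Itô) stochastic integral of order two with respect to $B$, normalized so that $\mathbf{E}[I_2(h)^2]=2\|h\|_{L^2(\mathbb{R}^2)}^2$ for symmetric $h\in L^2(\mathbb{R}^2)$. Write $x_+=\max(x,0)$. For $H\in(\frac12,1)$ let $c(H,2)>0$ be given by $$c(H,2)^2=\frac{H(2H-1)}{2\,\beta\left(\frac H2,1-H\right)^2},\qquad \beta(p,q)=\int_0^1 z^{p-1}(1-z)^{q-1}dz .$$ The Rosenblatt process with self-similarity index $H$ is $Z^H(t)=I_2(L^H_t)$, $t\ge0$, where $L^H_t(y_1,y_2)=c(H,2)\int_0^t (u-y_1)_+^{\frac H2-1}(u-y_2)_+^{\frac H2-1}du$; its sample paths are Hölder continuous of any order $\delta\in(0,H)$. For $f:\mathbb{R}\to\mathbb{R}$ with $H(2H-1)\int_{\mathbb{R}}\int_{\mathbb{R}}f(u)f(v)|u-v|^{2H-2}\,du\,dv<\infty$ the Wiener-Rosenblatt integral is $$\int_{\mathbb{R}} f(u)\,dZ^H(u):=I_2(J_Hf),\qquad (J_Hf)(y_1,y_2)=c(H,2)\int_{\mathbb{R}} f(u)(u-y_1)_+^{\frac H2-1}(u-y_2)_+^{\frac H2-1}du ,$$ and $\int_0^t f(u)\,dZ^H(u)=\int_{\mathbb{R}}1_{[0,t]}(u)f(u)\,dZ^H(u)$. The process $Y^H$ is the unique solution of the Langevin equation $X_t=\xi-\lambda\int_0^tX_s\,ds+\sigma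 Z^H(t)$, $t\ge0$. *)

theory Defs
  imports "HOL-Probability.Probability"
begin

definition wiener_process :: "'a measure \<Rightarrow> (real \<Rightarrow> 'a \<Rightarrow> real) \<Rightarrow> bool" where
  "wiener_process M B \<longleftrightarrow>
     prob_space M \<and>
     (\<forall>y. B y \<in> borel_measurable M) \<and>
     (AE \<omega> in M. B 0 \<omega> = 0) \<and>
     (AE \<omega> in M. continuous_on UNIV (\<lambda>y. B y \<omega>)) \<and>
     (\<forall>x y. x < y \<longrightarrow>
        distributed M lborel (\<lambda>\<omega>. B y \<omega> - B x \<omega>) (normal_density 0 (sqrt (y - x)))) \<and>
     (\<forall>(t :: nat \<Rightarrow> real) n. strict_mono t \<longrightarrow>
        prob_space.indep_vars M (\<lambda>_. borel) (\<lambda>i \<omega>. B (t (Suc i)) \<omega> - B (t i) \<omega>) {..<n})"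

text \<open>
  The double Wiener-Ito integral. On step functions that vanish on the diagonal blocks of a grid
  \<open>t 0 < \<dots> < t n\<close> it is the corresponding double sum of Wiener increments; it is then
  extended by closure in \<open>L\<^sup>2\<close>. In this normalization the second moment of the integral of
  \<open>h\<close> is twice the squared \<open>L\<^sup>2\<close> norm of the symmetrization of \<open>h\<close>.
  The relation \<open>has_double_wiener_integral M B h X\<close> says that the random variable \<open>X\<close>
  is a version of the integral, which is only determined almost surely.
\<close>

definition offdiag_step ::
    "nat \<Rightarrow> (nat \<Rightarrow> real) \<Rightarrow> (nat \<Rightarrow> nat \<Rightarrow> real) \<Rightarrow> real \<times> real \<Rightarrow> real" where
  "offdiag_step n t a = (\<lambda>(y1, y2). \<Sum>i<n. \<Sum>j\<in>{..<n} - {i}.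
     a i j * indicator {t i<..t (Suc i)} y1 * indicator {t j<..t (Suc j)} y2)"

definition offdiag_step_integral ::
    "(real \<Rightarrow> 'a \<Rightarrow> real) \<Rightarrow> nat \<Rightarrow> (nat \<Rightarrow> real) \<Rightarrow> (nat \<Rightarrow> nat \<Rightarrow> real) \<Rightarrow> 'a \<Rightarrow> real" where
  "offdiag_step_integral B n t a = (\<lambda>\<omega>. \<Sum>i<n. \<Sum>j\<in>{..<n} - {i}.
     a i j * (B (t (Suc i)) \<omega> - B (t i) \<omega>) * (B (t (Suc j)) \<omega> - B (t j) \<omega>))"

definition has_double_wiener_integral ::
    "'a measure \<Rightarrow> (real \<Rightarrow> 'a \<Rightarrow> real) \<Rightarrow> (real \<times> real \<Rightarrow> real) \<Rightarrow> ('a \<Rightarrow> real) \<Rightarrow> bool" where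
  "has_double_wiener_integral M B h X \<longleftrightarrow>
     h \<in> borel_measurable lborel \<and> X \<in> borel_measurable M \<and>
     (\<exists>n t a. (\<forall>k::nat. strict_mono (t k)) \<and>
        (\<lambda>k. \<integral>\<^sup>+ p. ennreal ((offdiag_step (n k) (t k) (a k) p - h p)\<^sup>2) \<partial>lborel)
          \<longlonglongrightarrow> 0 \<and>
        (\<lambda>k. \<integral>\<^sup>+ \<omega>. ennreal ((offdiag_step_integral B (n k) (t k) (a k) \<omega> - X \<omega>)\<^sup>2) \<partial>M)
          \<longlonglongrightarrow> 0)"

definition rosenblatt_const :: "real \<Rightarrow> real" where
  "rosenblatt_const H = sqrt (H * (2 * H - 1) / (2 * (Beta (H / 2) (1 - H))\<^sup>2))"

text \<open>
  For \<open>x \<le> 0\<close> the power \<open>max x 0 powr (H / 2 - 1)\<close> is \<open>0\<close>, since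
  \<open>0 powr s = 0\<close> for every \<open>s\<close>; this is the intended meaning of a negative power
  of the positive part.
\<close>

definition J_kernel :: "real \<Rightarrow> (real \<Rightarrow> real) \<Rightarrow> real \<times> real \<Rightarrow> real" where
  "J_kernel H f = (\<lambda>(y1, y2). rosenblatt_const H *
     (LINT u|lborel. f u * max (u - y1) 0 powr (H / 2 - 1) * max (u - y2) 0 powr (H / 2 - 1)))"

definition rosenblatt_integrand :: "real \<Rightarrow> (real \<Rightarrow> real) \<Rightarrow> bool" where
  "rosenblatt_integrand H f \<longleftrightarrow>
     f \<in> borel_measurable lborel \<and>
     integrable (lborel \<Otimes>\<^sub>M lborel)
       (\<lambda>(u, v). H * (2 * H - 1) * (f u * f v * \<bar>u - v\<bar> powr (2 * H - 2)))"

definition has_wiener_rosenblatt_integral ::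
    "'a measure \<Rightarrow> (real \<Rightarrow> 'a \<Rightarrow> real) \<Rightarrow> real \<Rightarrow> (real \<Rightarrow> real) \<Rightarrow> ('a \<Rightarrow> real) \<Rightarrow> bool" where
  "has_wiener_rosenblatt_integral M B H f X \<longleftrightarrow>
     rosenblatt_integrand H f \<and> has_double_wiener_integral M B (J_kernel H f) X"

text \<open>
  The stochastic integral fixes each \<open>Y t\<close> only up to a null set depending on \<open>t\<close>;
  as a random element of the space of continuous functions, the process is its
  continuous modification.
\<close>

definition rosenblatt_OU ::
    "'a measure \<Rightarrow> (real \<Rightarrow> 'a \<Rightarrow> real) \<Rightarrow> real \<Rightarrow> real \<Rightarrow> ('a \<Rightarrow> real) \<Rightarrow> real \<Rightarrow> real
      \<Rightarrow> (real \<Rightarrow> 'a \<Rightarrow> real) \<Rightarrow> bool" where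
  "rosenblatt_OU M B lam sig xi T H Y \<longleftrightarrow>
     (\<forall>t\<in>{0..T}. Y t \<in> borel_measurable M) \<and>
     (\<forall>\<omega>\<in>space M. continuous_on {0..T} (\<lambda>t. Y t \<omega>)) \<and>
     (\<forall>t\<in>{0..T}. \<exists>S.
        has_wiener_rosenblatt_integral M B H (\<lambda>u. indicator {0..t} u * exp (lam * u)) S \<and>
        (AE \<omega> in M. Y t \<omega> = exp (- lam * t) * (xi \<omega> + sig * S \<omega>)))"

definition rosenblatt_OU_limit ::
    "real \<Rightarrow> real \<Rightarrow> ('b \<Rightarrow> real) \<Rightarrow> ('b \<Rightarrow> real) \<Rightarrow> real \<Rightarrow> 'b \<Rightarrow> real" where
  "rosenblatt_OU_limit lam sig xi Z t \<omega> =
     exp (- lam * t) * xi \<omega>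
       + sig * (1 / sqrt 2) * (LINT u:{0..t}|lborel. exp (- lam * (t - u))) * ((Z \<omega>)\<^sup>2 - 1)"

text \<open>
  The space \<open>C[0,T]\<close> with the supremum metric; its points are the continuous functions on
  \<open>{0..T}\<close>, extended by \<open>undefined\<close> outside.
\<close>

definition C_space :: "real \<Rightarrow> (real \<Rightarrow> real) topology" where
  "C_space T = mtopology_of (cfunspace (top_of_set {0..T}) euclidean_metric)"

definition path_on :: "real \<Rightarrow> (real \<Rightarrow> 'a \<Rightarrow> real) \<Rightarrow> 'a \<Rightarrow> real \<Rightarrow> real" where
  "path_on T Y \<omega> = (\<lambda>t\<in>{0..T}. Y t \<omega>)"

definition borel_of_topology :: "'c topology \<Rightarrow> 'c measure" where
  "borel_of_topology X = sigma (topspace X) {U. openin X U}"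

definition converges_weakly ::
    "'c topology \<Rightarrow> 'a measure \<Rightarrow> ('i \<Rightarrow> 'a \<Rightarrow> 'c) \<Rightarrow> 'b measure \<Rightarrow> ('b \<Rightarrow> 'c) \<Rightarrow> 'i filter \<Rightarrow> bool" where
  "converges_weakly X M V N W F \<longleftrightarrow>
     (\<forall>\<^sub>F i in F. V i \<in> measurable M (borel_of_topology X)) \<and>
     W \<in> measurable N (borel_of_topology X) \<and>
     (\<forall>\<phi> :: 'c \<Rightarrow> real. continuous_map X euclideanreal \<phi> \<and> bounded (\<phi> ` topspace X) \<longrightarrow>
        ((\<lambda>i. LINT \<omega>|M. \<phi> (V i \<omega>)) \<longlongrightarrow> (LINT \<omega>|N. \<phi> (W \<omega>))) F)"

end

theory Submission
  imports Defs "HOL-Real_Asymp.Real_Asymp"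
begin

text \<open>As \<open>H \<rightarrow> 1\<close>, the mass of the kernel \<open>J\<^sub>H f\<close> escapes to \<open>-\<infinity>\<close>, where \<open>u\<close> is negligible
  against \<open>y\<close>; hence \<open>J\<^sub>H f\<close> approaches \<open>(\<integral> f / \<surd>2) g\<^sub>H \<otimes> g\<^sub>H\<close> in \<open>L\<^sup>2\<close> for a unit step function
  \<open>g\<^sub>H\<close> supported far to the left, and the double integral approaches \<open>\<integral> f / \<surd>2 * (X\<^sub>H\<^sup>2 - 1)\<close>, where
  \<open>X\<^sub>H\<close> is the Wiener integral of \<open>g\<^sub>H\<close>, exactly standard normal. A bound of order
  \<open>\<bar>t - s\<bar> powr (3/2)\<close>, uniform in \<open>H\<close>, for the mean square increments makes this approximation
  uniform in \<open>t\<close> with high probability. Since the supports of the \<open>g\<^sub>H\<close> escape to \<open>-\<infinity>\<close>, \<open>X\<^sub>H\<close> is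
  eventually independent of each earlier \<open>X\<^sub>H\<close>, so that it is asymptotically independent of every
  random variable, in particular of \<open>\<xi>\<close>, even if \<open>\<xi>\<close> depends on the Wiener process.\<close>

section \<open>Double Wiener integrals\<close>

text \<open>The natural scale is logarithmic: \<open>z powr (H - 2)\<close> spreads its mass almost
  evenly in log z, up to log z of order 1 / (1 - H). Any fixed range of unit cells therefore carries
  a vanishing share, so the cells near the origin can be discarded and every coefficient of the step
  function is small. The latter is what makes the diagonal of the double sum concentrate at the
  constant 1.

  The kernel approximation is an expanded square whose three terms cancel in the limit. It needs two
  one-sided estimates, each with the exact leading constant: the norm of the kernel from above, its
  inner product with the step function from below.

  The exponent 3/2 arises by dominating \<open>\<bar>u - v\<bar> powr (2 * H - 2)\<close> by a
  convex combination of 1 and \<open>\<bar>u - v\<bar> powr (-1/2)\<close>. It is free of H and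
  exceeds 1, as chaining demands.

  Tightness in the path space is bypassed: the approximating path is a continuous function of the
  pair of \<xi> and the Gaussian, whose marginal laws are fixed, so that images of squares serve as
  the compact sets.\<close>

abbreviation sqnorm :: "'a measure \<Rightarrow> ('a \<Rightarrow> real) \<Rightarrow> ennreal" where
  "sqnorm M f \<equiv> \<integral>\<^sup>+x. ennreal ((f x)^2) \<partial>M"

lemma abs_mult_le_sum_squares: "\<bar>x * y\<bar> \<le> x^2 + (y::real)^2"
proof -
  have "0 \<le> (\<bar>x\<bar> - \<bar>y\<bar>)^2" by simp
  then have "2 * (\<bar>x\<bar> * \<bar>y\<bar>) \<le> x^2 + y^2" by (simp add: power2_diff)
  moreover have "0 \<le> x^2 + y^2" by simp
  ultimately show ?thesis unfolding abs_mult by linarith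
qed

lemma integrable_mult_square:
  fixes X Y :: "'a \<Rightarrow> real"
  assumes [measurable]: "X \<in> borel_measurable M" "Y \<in> borel_measurable M"
    and "integrable M (\<lambda>w. (X w)^2)" "integrable M (\<lambda>w. (Y w)^2)"
  shows "integrable M (\<lambda>w. X w * Y w)"
  by (rule Bochner_Integration.integrable_bound[OF Bochner_Integration.integrable_add[OF assms(3,4)]])
     (auto intro!: AE_I2 order.trans[OF abs_mult_le_sum_squares])

lemma (in finite_measure) integrable_of_square:
  fixes X :: "'a \<Rightarrow> real"
  assumes [measurable]: "X \<in> borel_measurable M" and "integrable M (\<lambda>w. (X w)^2)"
  shows "integrable M X"
  using integrable_mult_square[of X M "\<lambda>_. 1"] assms by simp

section \<open>Second moments of linear and quadratic forms in independent variables\<close>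

lemma (in prob_space) indep_past_next:
  fixes d :: "nat \<Rightarrow> 'a \<Rightarrow> real"
  assumes ind: "indep_vars (\<lambda>_. borel) d {..<m}" and n: "n < m"
    and [measurable]: "F \<in> borel_measurable (PiM {..<n} (\<lambda>_. borel))"
    and [measurable]: "g \<in> borel_measurable borel"
  shows "indep_var borel (\<lambda>w. F (\<lambda>i\<in>{..<n}. d i w) :: real) borel (\<lambda>w. g (d n w) :: real)"
proof -
  have "indep_var (PiM {..<n} (\<lambda>_. borel)) (\<lambda>w. \<lambda>i\<in>{..<n}. d i w)
      (PiM {n} (\<lambda>_. borel)) (\<lambda>w. \<lambda>i\<in>{n}. d i w)"
    by (rule indep_var_restrict[OF ind]) (use n in auto)
  from indep_var_compose[OF this, of F borel "\<lambda>x. g (x n)" borel]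
  show ?thesis by (simp add: comp_def)
qed

text \<open>Covers two families: the Wiener increments along a grid, and the centered squares of
  increments over unit cells, whose variance is 2.\<close>

locale centered_indep = prob_space +
  fixes d :: "nat \<Rightarrow> 'a \<Rightarrow> real" and m :: nat and v :: "nat \<Rightarrow> real"
  assumes indep: "indep_vars (\<lambda>_. borel) d {..<m}"
    and sq_int: "\<And>k. k < m \<Longrightarrow> integrable M (\<lambda>w. (d k w)^2)"
    and mean: "\<And>k. k < m \<Longrightarrow> expectation (d k) = 0"
    and var: "\<And>k. k < m \<Longrightarrow> expectation (\<lambda>w. (d k w)^2) = v k"
begin

lemma meas: "k < m \<Longrightarrow> d k \<in> borel_measurable M"
  using indep by (auto simp: indep_vars_def)

text \<open>Adding to \<open>U\<close> a fresh centered factor times \<open>V\<close>, with both functions of the past,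
  leaves no cross term.\<close>

lemma second_moment_step:
  assumes n: "n < m"
    and F [measurable]: "F \<in> borel_measurable (PiM {..<n} (\<lambda>_. borel))"
    and G [measurable]: "G \<in> borel_measurable (PiM {..<n} (\<lambda>_. borel))"
    and U: "\<And>w. U w = F (\<lambda>i\<in>{..<n}. d i w)" and V: "\<And>w. V w = G (\<lambda>i\<in>{..<n}. d i w)"
    and iU: "integrable M (\<lambda>w. (U w)^2)" and iV: "integrable M (\<lambda>w. (V w)^2)"
  shows "integrable M (\<lambda>w. (U w + V w * d n w)^2) \<and>
    expectation (\<lambda>w. (U w + V w * d n w)^2) =
      expectation (\<lambda>w. (U w)^2) + expectation (\<lambda>w. (V w)^2) * v n"
proof -
  have [measurable]: "(\<lambda>w. \<lambda>i\<in>{..<n}. d i w) \<in> measurable M (PiM {..<n} (\<lambda>_. borel))"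
    using n by (intro measurable_restrict) (auto intro!: meas)
  have mU [measurable]: "U \<in> borel_measurable M" and mV [measurable]: "V \<in> borel_measurable M"
    unfolding U[abs_def] V[abs_def] by (rule measurable_compose[OF _ F] measurable_compose[OF _ G], measurable)+
  have iUV: "integrable M (\<lambda>w. U w * V w)"
    by (rule integrable_mult_square) (use iU iV in auto)
  have id: "integrable M (d n)"
    using integrable_of_square[OF meas sq_int] n by simp
  have ind1: "indep_var borel (\<lambda>w. U w * V w) borel (d n)"
    unfolding U V by (rule indep_past_next[OF indep n, of "\<lambda>x. F x * G x" "\<lambda>x. x"]) measurable
  have ind2: "indep_var borel (\<lambda>w. (V w)^2) borel (\<lambda>w. (d n w)^2)"
    unfolding V by (rule indep_past_next[OF indep n, of "\<lambda>x. (G x)^2" "\<lambda>x. x^2"]) measurable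
  have i1: "integrable M (\<lambda>w. (U w * V w) * d n w)"
    by (rule indep_var_integrable[OF ind1 iUV id])
  have i2: "integrable M (\<lambda>w. (V w)^2 * (d n w)^2)"
    by (rule indep_var_integrable[OF ind2 iV sq_int[OF n]])
  have e1: "expectation (\<lambda>w. (U w * V w) * d n w) = 0"
    using indep_var_lebesgue_integral[OF ind1 iUV id] mean[OF n] by simp
  have e2: "expectation (\<lambda>w. (V w)^2 * (d n w)^2) = expectation (\<lambda>w. (V w)^2) * v n"
    using indep_var_lebesgue_integral[OF ind2 iV sq_int[OF n]] var[OF n] by simp
  have eq: "(\<lambda>w. (U w + V w * d n w)^2) =
      (\<lambda>w. (U w)^2 + 2 * ((U w * V w) * d n w) + (V w)^2 * (d n w)^2)"
    by (auto simp: power2_eq_square algebra_simps)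
  show ?thesis
    unfolding eq using iU i1 i2 by (simp add: e1 e2)
qed

lemma linear_second_moment:
  "n \<le> m \<Longrightarrow> integrable M (\<lambda>w. (\<Sum>k<n. a k * d k w)^2) \<and>
    expectation (\<lambda>w. (\<Sum>k<n. a k * d k w)^2) = (\<Sum>k<n. (a k)^2 * v k)"
proof (induction n)
  case (Suc n)
  then have IH: "integrable M (\<lambda>w. (\<Sum>k<n. a k * d k w)^2)"
    "expectation (\<lambda>w. (\<Sum>k<n. a k * d k w)^2) = (\<Sum>k<n. (a k)^2 * v k)" by auto
  have "integrable M (\<lambda>w. ((\<Sum>k<n. a k * d k w) + a n * d n w)^2) \<and>
    expectation (\<lambda>w. ((\<Sum>k<n. a k * d k w) + a n * d n w)^2) =
      expectation (\<lambda>w. (\<Sum>k<n. a k * d k w)^2) + expectation (\<lambda>w. (a n)^2) * v n"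
    by (rule second_moment_step[of n "\<lambda>x. \<Sum>k<n. a k * x k" "\<lambda>_. a n"])
       (use Suc.prems IH in \<open>auto intro!: sum.cong\<close>)
  then show ?case using IH by (simp add: prob_space)
qed simp

text \<open>Ordered by the larger index, each new factor \<open>d l\<close> is fresh and multiplies
  a linear form in the earlier ones, so the induction uses second moments only, never fourth moments
  of the increments.\<close>

lemma triangular_second_moment:
  "n \<le> m \<Longrightarrow> integrable M (\<lambda>w. (\<Sum>l<n. (\<Sum>k<l. c k l * d k w) * d l w)^2) \<and>
    expectation (\<lambda>w. (\<Sum>l<n. (\<Sum>k<l. c k l * d k w) * d l w)^2) =
      (\<Sum>l<n. \<Sum>k<l. (c k l)^2 * v k * v l)"
proof (induction n)
  case (Suc n)
  let ?U = "\<lambda>w. \<Sum>l<n. (\<Sum>k<l. c k l * d k w) * d l w"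
  let ?V = "\<lambda>w. \<Sum>k<n. c k n * d k w"
  have IH: "integrable M (\<lambda>w. (?U w)^2)"
    "expectation (\<lambda>w. (?U w)^2) = (\<Sum>l<n. \<Sum>k<l. (c k l)^2 * v k * v l)" using Suc by auto
  have L: "integrable M (\<lambda>w. (?V w)^2)" "expectation (\<lambda>w. (?V w)^2) = (\<Sum>k<n. (c k n)^2 * v k)"
    using linear_second_moment[of n "\<lambda>k. c k n"] Suc.prems by auto
  have "integrable M (\<lambda>w. (?U w + ?V w * d n w)^2) \<and>
    expectation (\<lambda>w. (?U w + ?V w * d n w)^2) =
      expectation (\<lambda>w. (?U w)^2) + expectation (\<lambda>w. (?V w)^2) * v n"
  proof (rule second_moment_step[of n "\<lambda>x. \<Sum>l<n. (\<Sum>k<l. c k l * x k) * x l" "\<lambda>x. \<Sum>k<n. c k n * x k"])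
    show "(\<lambda>x. \<Sum>l<n. (\<Sum>k<l. c k l * x k) * x l) \<in> borel_measurable (PiM {..<n} (\<lambda>_. borel))"
      by (intro borel_measurable_sum borel_measurable_times measurable_component_singleton) auto
  qed (use Suc.prems IH L in \<open>auto intro!: sum.cong\<close>)
  then show ?case using IH L by (simp add: sum_distrib_right)
qed simp

text \<open>Folding the pairs (k, l) and (l, k) together gives a triangular form with coefficients
  \<open>c k l + c l k\<close>. Bounding their squares by twice the sum of squares reflects that
  symmetrization does not increase the norm, so c need not be symmetric.\<close>

lemma offdiag_second_moment:
  assumes v: "\<And>k. k < m \<Longrightarrow> 0 \<le> v k" and c0: "\<And>k. k < m \<Longrightarrow> c k k = 0"
  shows "integrable M (\<lambda>w. (\<Sum>k<m. \<Sum>l<m. c k l * d k w * d l w)^2)"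
    and "expectation (\<lambda>w. (\<Sum>k<m. \<Sum>l<m. c k l * d k w * d l w)^2)
      \<le> 2 * (\<Sum>k<m. \<Sum>l<m. (c k l)^2 * v k * v l)"
proof -
  have split: "(\<Sum>k<n. \<Sum>l<n. h k l) = (\<Sum>l<n. \<Sum>k<l. h k l + h l k) + (\<Sum>k<n. h k k)" for n and h :: "nat \<Rightarrow> nat \<Rightarrow> real"
    by (induction n) (simp_all add: sum.distrib)
  have eq: "(\<Sum>k<m. \<Sum>l<m. c k l * d k w * d l w) = (\<Sum>l<m. (\<Sum>k<l. (c k l + c l k) * d k w) * d l w)" for w
    unfolding split by (auto simp: c0 sum_distrib_right sum_distrib_left algebra_simps intro!: sum.cong)
  note t = triangular_second_moment[of m "\<lambda>k l. c k l + c l k"]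
  show "integrable M (\<lambda>w. (\<Sum>k<m. \<Sum>l<m. c k l * d k w * d l w)^2)"
    unfolding eq using t by simp
  have "(\<Sum>l<m. \<Sum>k<l. (c k l + c l k)^2 * v k * v l)
     \<le> (\<Sum>l<m. \<Sum>k<l. 2 * ((c k l)^2 * v k * v l + (c l k)^2 * v l * v k))"
  proof (intro sum_mono)
    fix l k assume "l \<in> {..<m}" "k \<in> {..<l}"
    then have "0 \<le> v k * v l" using v by simp
    moreover have "(c k l + c l k)^2 \<le> 2 * ((c k l)^2 + (c l k)^2)"
      using sum_squares_bound[of "c k l" "c l k"] by (simp add: power2_sum)
    ultimately have "(c k l + c l k)^2 * (v k * v l) \<le> 2 * ((c k l)^2 + (c l k)^2) * (v k * v l)"
      by (rule mult_right_mono[rotated])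
    then show "(c k l + c l k)^2 * v k * v l \<le> 2 * ((c k l)^2 * v k * v l + (c l k)^2 * v l * v k)"
      by (simp add: algebra_simps)
  qed
  also have "\<dots> = 2 * (\<Sum>k<m. \<Sum>l<m. (c k l)^2 * v k * v l)"
    unfolding split by (simp add: c0 sum_distrib_left)
  finally show "expectation (\<lambda>w. (\<Sum>k<m. \<Sum>l<m. c k l * d k w * d l w)^2)
      \<le> 2 * (\<Sum>k<m. \<Sum>l<m. (c k l)^2 * v k * v l)"
    unfolding eq using t by simp
qed

end

lemma wiener_centered_indep:
  assumes W: "wiener_process M B" and s: "strict_mono (s :: nat \<Rightarrow> real)"
  shows "centered_indep M (\<lambda>k w. B (s (Suc k)) w - B (s k) w) m (\<lambda>k. s (Suc k) - s k)"
proof -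
  interpret prob_space M using W by (simp add: wiener_process_def)
  have lt: "s k < s (Suc k)" for k using s by (simp add: strict_mono_Suc_iff)
  have D: "distributed M lborel (\<lambda>w. B (s (Suc k)) w - B (s k) w) (normal_density 0 (sqrt (s (Suc k) - s k)))" for k
    using W lt[of k] by (simp add: wiener_process_def)
  have pos: "0 < sqrt (s (Suc k) - s k)" for k using lt[of k] by simp
  have [measurable]: "B y \<in> borel_measurable M" for y using W by (simp add: wiener_process_def)
  show ?thesis
  proof
    show "indep_vars (\<lambda>_. borel) (\<lambda>k w. B (s (Suc k)) w - B (s k) w) {..<m}"
      using W s by (simp add: wiener_process_def)
    fix k
    show m0: "expectation (\<lambda>w. B (s (Suc k)) w - B (s k) w) = 0"
      by (rule normal_distributed_expectation[OF pos D])
    have "variance (\<lambda>w. B (s (Suc k)) w - B (s k) w) = (sqrt (s (Suc k) - s k))^2"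
      by (rule normal_distributed_variance[OF pos D])
    then show "expectation (\<lambda>w. (B (s (Suc k)) w - B (s k) w)^2) = s (Suc k) - s k"
      unfolding m0 using lt[of k] by simp
    show "integrable M (\<lambda>w. (B (s (Suc k)) w - B (s k) w)^2)"
      using distributed_integrable[OF D, of "\<lambda>x. x^2" k] integrable_normal_moment[OF pos, of 0 k 2] by simp
  qed
qed

section \<open>Common refinement of grids\<close>

lemma finite_strict_mono_grid:
  assumes "finite P" "P \<noteq> {}"
  obtains s :: "nat \<Rightarrow> real" and m where "strict_mono s" "P = s ` {..m}"
proof -
  define xs where "xs = sorted_list_of_set P"
  have xs: "sorted_wrt (<) xs" "set xs = P" "xs \<noteq> []"
    using assms by (auto simp: xs_def)
  \<comment> \<open>\<open>wiener_process\<close> speaks of independence along infinite strictly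
    increasing sequences, so the finite list is continued beyond its last point.\<close>
  define s where "s i = (if i < length xs then xs ! i else last xs + 1 + real i)" for i
  have "strict_mono s"
    unfolding strict_mono_Suc_iff
  proof
    fix i
    consider "Suc i < length xs" | "Suc i = length xs" | "length xs \<le> i" by linarith
    then show "s i < s (Suc i)"
    proof cases
      case 1
      then show ?thesis using sorted_wrt_nth_less[OF xs(1), of i "Suc i"] by (simp add: s_def)
    next
      case 2
      then have "xs ! i = last xs" using xs(3) by (simp add: last_conv_nth flip: 2)
      then show ?thesis using 2 by (simp add: s_def)
    qed (simp add: s_def)
  qed
  moreover have "P = s ` {..length xs - 1}"
  proof -
    have "P = (\<lambda>i. xs ! i) ` {..<length xs}"
      using xs(2) by (auto simp: set_conv_nth)
    also have "{..<length xs} = {..length xs - 1}" using xs(3) by (cases xs) auto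
    also have "(\<lambda>i. xs ! i) ` {..length xs - 1} = s ` {..length xs - 1}"
      using xs(3) by (intro image_cong) (auto simp: s_def Suc_le_eq le_diff_conv2 neq_Nil_conv)
    finally show ?thesis .
  qed
  ultimately show thesis by (rule that)
qed

text \<open>Since a and b are grid points, a half-open cell lies in the interval exactly when its
  right endpoint does; this is why the indicator is evaluated at \<open>s (Suc k)\<close>.\<close>

lemma grid_telescope:
  fixes s :: "nat \<Rightarrow> real" and \<phi> :: "real \<Rightarrow> real"
  assumes s: "strict_mono s" and "a \<in> s ` {..m}" "b \<in> s ` {..m}" "a < b"
  shows "\<phi> b - \<phi> a = (\<Sum>k<m. indicator {a<..b} (s (Suc k)) * (\<phi> (s (Suc k)) - \<phi> (s k)))"
proof -
  obtain p q where pq: "a = s p" "b = s q" "q \<le> m" using assms by auto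
  then have "p < q" using assms by (simp add: strict_mono_less)
  have "(\<Sum>k<m. indicator {a<..b} (s (Suc k)) * (\<phi> (s (Suc k)) - \<phi> (s k))) =
      (\<Sum>k\<in>{p..<q}. \<phi> (s (Suc k)) - \<phi> (s k))"
    using pq(3) by (intro sum.mono_neutral_cong_right)
      (auto simp: pq(1,2) strict_mono_less[OF s] strict_mono_less_eq[OF s] indicator_def)
  also have "\<dots> = \<phi> b - \<phi> a"
    using sum_Suc_diff'[of p q "\<lambda>k. \<phi> (s k)"] \<open>p < q\<close> by (simp add: pq)
  finally show ?thesis by simp
qed

text \<open>Two arbitrary functions \<phi> and \<psi> let one identity serve both sides of the
  isometry. Taken as a Wiener path they refine the stochastic double sum; taken as indicators of
  half-lines, whose increments are indicators of cells, they refine the step function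
  itself.\<close>

lemma offdiag_step_refine:
  fixes s t :: "nat \<Rightarrow> real" and \<phi> \<psi> :: "real \<Rightarrow> real"
  assumes s: "strict_mono s" and t: "strict_mono t" and ts: "t ` {..n} \<subseteq> s ` {..m}"
  shows "(\<Sum>i<n. \<Sum>j\<in>{..<n} - {i}. a i j * (\<phi> (t (Suc i)) - \<phi> (t i)) * (\<psi> (t (Suc j)) - \<psi> (t j))) =
    (\<Sum>k<m. \<Sum>l<m. offdiag_step n t a (s (Suc k), s (Suc l)) *
      (\<phi> (s (Suc k)) - \<phi> (s k)) * (\<psi> (s (Suc l)) - \<psi> (s l)))"
proof -
  let ?I = "\<lambda>i k. indicator {t i<..t (Suc i)} (s (Suc k)) :: real"
  let ?f = "\<lambda>k. \<phi> (s (Suc k)) - \<phi> (s k)" and ?g = "\<lambda>l. \<psi> (s (Suc l)) - \<psi> (s l)"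
  let ?J = "SIGMA i:{..<n}. {..<n} - {i}" and ?K = "{..<m} \<times> {..<m}"
  have tel: "h (t (Suc i)) - h (t i) = (\<Sum>k<m. ?I i k * (h (s (Suc k)) - h (s k)))" if "i < n" for i and h :: "real \<Rightarrow> real"
    by (rule grid_telescope[OF s]) (use that ts t in \<open>auto simp: strict_mono_Suc_iff\<close>)
  have "(\<Sum>i<n. \<Sum>j\<in>{..<n} - {i}. a i j * (\<phi> (t (Suc i)) - \<phi> (t i)) * (\<psi> (t (Suc j)) - \<psi> (t j))) =
    (\<Sum>(i, j)\<in>?J. a i j * ((\<Sum>k<m. ?I i k * ?f k) * (\<Sum>l<m. ?I j l * ?g l)))"
    by (subst sum.Sigma[symmetric]) (auto intro!: sum.cong simp: tel mult.assoc)
  also have "\<dots> = (\<Sum>(i, j)\<in>?J. \<Sum>(k, l)\<in>?K. a i j * ?I i k * ?I j l * ?f k * ?g l)"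
    by (simp only: sum_product) (simp only: sum.cartesian_product sum_distrib_left case_prod_unfold mult_ac)
  also have "\<dots> = (\<Sum>(k, l)\<in>?K. \<Sum>(i, j)\<in>?J. a i j * ?I i k * ?I j l * ?f k * ?g l)"
    by (simp add: case_prod_unfold) (rule sum.swap)
  also have "\<dots> = (\<Sum>(k, l)\<in>?K. offdiag_step n t a (s (Suc k), s (Suc l)) * ?f k * ?g l)"
  proof -
    have fin: "\<forall>i\<in>{..<n}. finite ({..<n} - {i})" by simp
    show ?thesis
      by (simp only: offdiag_step_def split sum.Sigma[OF finite_lessThan fin] sum_distrib_right case_prod_unfold fst_conv snd_conv)
  qed
  also have "\<dots> = (\<Sum>k<m. \<Sum>l<m. offdiag_step n t a (s (Suc k), s (Suc l)) * ?f k * ?g l)"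
    by (simp add: sum.cartesian_product)
  finally show ?thesis .
qed

text \<open>After refinement, the coefficient of a diagonal block is a value of the step function on
  the diagonal; its vanishing shows that refining creates no squares of increments.\<close>

lemma offdiag_step_diag:
  assumes t: "strict_mono t"
  shows "offdiag_step n t a (x, x) = 0"
proof -
  have disj: "indicator {t i<..t (Suc i)} x * indicator {t j<..t (Suc j)} x = (0::real)" if "i \<noteq> j" for i j
  proof (rule ccontr)
    assume "indicator {t i<..t (Suc i)} x * indicator {t j<..t (Suc j)} x \<noteq> (0::real)"
    then have "t i < t (Suc j)" "t j < t (Suc i)" by (auto simp: indicator_def split: if_splits)
    then show False using that by (simp add: strict_mono_less[OF t])
  qed
  show ?thesis
    unfolding offdiag_step_def split mult.assoc
    by (intro sum.neutral ballI) (metis DiffD2 disj mult_zero_right singletonI)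
qed

lemma sum_indicator_square:
  fixes f :: "'i \<Rightarrow> real"
  assumes "finite K" "disjoint_family_on A K"
  shows "(\<Sum>k\<in>K. f k * indicator (A k) y)^2 = (\<Sum>k\<in>K. (f k)^2 * indicator (A k) y)"
proof (cases "\<exists>k\<in>K. y \<in> A k")
  case True
  then obtain k where k: "k \<in> K" "y \<in> A k" by blast
  have "y \<notin> A l" if "l \<in> K - {k}" for l
    using assms(2) k that by (auto simp: disjoint_family_on_def)
  then have "(\<Sum>l\<in>K. g l * indicator (A l) y) = g k" for g :: "'i \<Rightarrow> real"
    using k by (subst sum.remove[OF assms(1) k(1)]) auto
  then show ?thesis by simp
qed auto

lemma nn_integral_cell_square:
  fixes s :: "nat \<Rightarrow> real" and c :: "nat \<Rightarrow> nat \<Rightarrow> real"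
  assumes s: "strict_mono s"
    and h: "\<And>x y. h (x, y) = (\<Sum>k<m. \<Sum>l<m. c k l * indicator {s k<..s (Suc k)} x * indicator {s l<..s (Suc l)} y)"
  shows "(sqnorm lborel (\<lambda>p. h p)) =
    ennreal (\<Sum>k<m. \<Sum>l<m. (c k l)^2 * (s (Suc k) - s k) * (s (Suc l) - s l))"
proof -
  let ?C = "\<lambda>k. {s k<..s (Suc k)}"
  let ?A = "\<lambda>(k, l). ?C k \<times> ?C l" and ?K = "{..<m} \<times> {..<m}"
  have le: "s k \<le> s (Suc k)" for k using s by (simp add: strict_mono_less_eq)
  have "?C i \<inter> ?C j = {}" if "i \<noteq> j" for i j
  proof -
    have "x \<notin> ?C j" if x: "x \<in> ?C i" for x
    proof
      assume "x \<in> ?C j"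
      then have "s i < s (Suc j)" "s j < s (Suc i)" using x by auto
      then show False using \<open>i \<noteq> j\<close> by (simp add: strict_mono_less[OF s])
    qed
    then show ?thesis by blast
  qed
  then have disj: "disjoint_family_on ?A ?K"
    unfolding disjoint_family_on_def by (fastforce)
  have h2: "h p = (\<Sum>q\<in>?K. (case q of (k, l) \<Rightarrow> c k l) * indicator (?A q) p)" for p
    by (cases p) (simp only: h sum.cartesian_product case_prod_unfold indicator_times fst_conv snd_conv mult.assoc)
  have "(sqnorm lborel (\<lambda>p. h p)) =
      (\<integral>\<^sup>+p. (\<Sum>q\<in>?K. ennreal ((case q of (k, l) \<Rightarrow> c k l)^2) * indicator (?A q) p) \<partial>lborel)"
    unfolding h2 sum_indicator_square[OF finite_cartesian_product[OF finite_lessThan finite_lessThan] disj]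
    by (auto intro!: nn_integral_cong simp flip: sum_ennreal ennreal_mult split: split_indicator)
  also have "\<dots> = (\<Sum>q\<in>?K. ennreal ((case q of (k, l) \<Rightarrow> c k l)^2) * emeasure lborel (?A q))"
    by (subst nn_integral_sum) (auto intro!: sum.cong nn_integral_cmult_indicator borel_Times simp flip: borel_prod)
  also have "\<dots> = (\<Sum>q\<in>?K. ennreal (case q of (k, l) \<Rightarrow> (c k l)^2 * (s (Suc k) - s k) * (s (Suc l) - s l)))"
  proof (intro sum.cong refl)
    fix q :: "nat \<times> nat"
    obtain k l where q: "q = (k, l)" by (cases q)
    have "emeasure lborel (?C k \<times> ?C l) = ennreal (s (Suc k) - s k) * ennreal (s (Suc l) - s l)"
      unfolding lborel_prod[symmetric] using le by (subst lborel.emeasure_pair_measure_Times) auto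
    then show "ennreal ((case q of (k, l) \<Rightarrow> c k l)^2) * emeasure lborel (?A q) =
        ennreal (case q of (k, l) \<Rightarrow> (c k l)^2 * (s (Suc k) - s k) * (s (Suc l) - s l))"
      unfolding q using le[of k] le[of l] by (simp add: mult.assoc flip: ennreal_mult)
  qed
  also have "\<dots> = ennreal (\<Sum>k<m. \<Sum>l<m. (c k l)^2 * (s (Suc k) - s k) * (s (Suc l) - s l))"
    using le by (subst sum_ennreal) (auto simp: sum.cartesian_product)
  finally show ?thesis .
qed

text \<open>Over a common refinement the difference of the two double sums is one off-diagonal
  quadratic form, whose coefficients are the values of the difference of the two kernels. Equality
  is replaced by \<le> because the coefficients are not assumed symmetric.\<close>

lemma offdiag_step_isometry:
  assumes W: "wiener_process M B" and t: "strict_mono t" and t': "strict_mono t'"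
  shows "(sqnorm M (\<lambda>w. offdiag_step_integral B n t a w - offdiag_step_integral B n' t' a' w))
    \<le> 2 * (sqnorm lborel (\<lambda>p. offdiag_step n t a p - offdiag_step n' t' a' p))"
proof -
  have "finite (t ` {..n} \<union> t' ` {..n'})" "t ` {..n} \<union> t' ` {..n'} \<noteq> {}" by auto
  then obtain s :: "nat \<Rightarrow> real" and m where s: "strict_mono s" and P: "t ` {..n} \<union> t' ` {..n'} = s ` {..m}"
    by (rule finite_strict_mono_grid)
  define h where "h p = offdiag_step n t a p - offdiag_step n' t' a' p" for p
  define c where "c k l = h (s (Suc k), s (Suc l))" for k l
  define \<delta> where "\<delta> k w = B (s (Suc k)) w - B (s k) w" for k w
  note r1 = offdiag_step_refine[OF s t, of n m] and r2 = offdiag_step_refine[OF s t', of n' m]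
  have sub: "t ` {..n} \<subseteq> s ` {..m}" "t' ` {..n'} \<subseteq> s ` {..m}" using P by auto
  have integral_eq: "offdiag_step_integral B n t a w - offdiag_step_integral B n' t' a' w =
      (\<Sum>k<m. \<Sum>l<m. c k l * \<delta> k w * \<delta> l w)" for w
    unfolding offdiag_step_integral_def r1[OF sub(1), of a "\<lambda>x. B x w" "\<lambda>x. B x w"]
      r2[OF sub(2), of a' "\<lambda>x. B x w" "\<lambda>x. B x w"] c_def h_def \<delta>_def
    by (simp add: left_diff_distrib sum_subtractf)
  \<comment> \<open>The increment of \<open>indicator {y..}\<close> over a cell is the indicator of
    that half-open cell at y; this brings the kernels under the refinement identity.\<close>
  have ind: "indicator {u<..v} y = indicator {y..} v - (indicator {y..} u :: real)" if "u \<le> v" for u v y :: real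
    using that by (auto simp: indicator_def)
  have ind_t: "indicator {t i<..t (Suc i)} y = indicator {y..} (t (Suc i)) - (indicator {y..} (t i) :: real)" for i y
    using t by (intro ind) (simp add: strict_mono_less_eq)
  have ind_t': "indicator {t' i<..t' (Suc i)} y = indicator {y..} (t' (Suc i)) - (indicator {y..} (t' i) :: real)" for i y
    using t' by (intro ind) (simp add: strict_mono_less_eq)
  have ind_s: "indicator {y..} (s (Suc i)) - (indicator {y..} (s i) :: real) = indicator {s i<..s (Suc i)} y" for i y
    using s by (intro ind[symmetric]) (simp add: strict_mono_less_eq)
  have h_eq: "h (x, y) = (\<Sum>k<m. \<Sum>l<m. c k l * indicator {s k<..s (Suc k)} x * indicator {s l<..s (Suc l)} y)" for x y
  proof -
    have "offdiag_step n t a (x, y) = (\<Sum>k<m. \<Sum>l<m. offdiag_step n t a (s (Suc k), s (Suc l)) *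
        indicator {s k<..s (Suc k)} x * indicator {s l<..s (Suc l)} y)"
      using r1[OF sub(1), of a "indicator {x..}" "indicator {y..}"] unfolding ind_s
      by (subst offdiag_step_def) (simp add: ind_t)
    moreover have "offdiag_step n' t' a' (x, y) = (\<Sum>k<m. \<Sum>l<m. offdiag_step n' t' a' (s (Suc k), s (Suc l)) *
        indicator {s k<..s (Suc k)} x * indicator {s l<..s (Suc l)} y)"
      using r2[OF sub(2), of a' "indicator {x..}" "indicator {y..}"] unfolding ind_s
      by (subst offdiag_step_def) (simp add: ind_t')
    ultimately show ?thesis
      unfolding h_def c_def by (simp add: left_diff_distrib sum_subtractf)
  qed
  interpret centered_indep M \<delta> m "\<lambda>k. s (Suc k) - s k"
    unfolding \<delta>_def by (rule wiener_centered_indep[OF W s])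
  have v: "0 \<le> s (Suc k) - s k" for k using s by (simp add: strict_mono_less_eq)
  have c0: "c k k = 0" for k
    by (simp add: c_def h_def offdiag_step_diag[OF t] offdiag_step_diag[OF t'])
  note m2 = offdiag_second_moment[of c, OF v c0]
  have "(sqnorm M (\<lambda>w. offdiag_step_integral B n t a w - offdiag_step_integral B n' t' a' w)) =
      ennreal (expectation (\<lambda>w. (\<Sum>k<m. \<Sum>l<m. c k l * \<delta> k w * \<delta> l w)^2))"
    unfolding integral_eq using m2(1) by (intro nn_integral_eq_integral) auto
  also have "\<dots> \<le> ennreal (2 * (\<Sum>k<m. \<Sum>l<m. (c k l)^2 * (s (Suc k) - s k) * (s (Suc l) - s l)))"
    using m2(2) by (rule ennreal_leI)
  also have "\<dots> = 2 * ennreal (\<Sum>k<m. \<Sum>l<m. (c k l)^2 * (s (Suc k) - s k) * (s (Suc l) - s l))"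
    using v by (subst ennreal_mult) (auto intro!: sum_nonneg)
  also have "\<dots> = 2 * (sqnorm lborel (\<lambda>p. h p))"
    by (subst nn_integral_cell_square[OF s h_eq]) simp
  finally show ?thesis unfolding h_def .
qed

section \<open>Passage to the closure in mean square\<close>

lemma ennreal_square_sum3:
  fixes x y z :: real
  shows "ennreal ((x + y + z)^2) \<le> 3 * (ennreal (x^2) + ennreal (y^2) + ennreal (z^2))"
proof -
  have "(x + y + z)^2 \<le> 3 * (x^2 + y^2 + z^2)"
    using sum_squares_bound[of x y] sum_squares_bound[of x z] sum_squares_bound[of y z]
    by (simp add: power2_eq_square algebra_simps)
  then have "ennreal ((x + y + z)^2) \<le> ennreal (3 * (x^2 + y^2 + z^2))" by (rule ennreal_leI)
  also have "\<dots> = 3 * (ennreal (x^2) + ennreal (y^2) + ennreal (z^2))"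
    by (simp add: ennreal_mult)
  finally show ?thesis .
qed

lemma nn_integral_square_sum3:
  fixes f g h :: "'a \<Rightarrow> real"
  assumes [measurable]: "f \<in> borel_measurable M" "g \<in> borel_measurable M" "h \<in> borel_measurable M"
  shows "(sqnorm M (\<lambda>x. f x + g x + h x)) \<le>
    3 * ((sqnorm M (\<lambda>x. f x)) + (sqnorm M (\<lambda>x. g x)) + (sqnorm M (\<lambda>x. h x)))"
proof -
  have "(sqnorm M (\<lambda>x. f x + g x + h x)) \<le>
      (\<integral>\<^sup>+x. 3 * (ennreal ((f x)^2) + ennreal ((g x)^2) + ennreal ((h x)^2)) \<partial>M)"
    by (intro nn_integral_mono ennreal_square_sum3)
  also have "\<dots> = 3 * ((sqnorm M (\<lambda>x. f x)) + (sqnorm M (\<lambda>x. g x)) + (sqnorm M (\<lambda>x. h x)))"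
    by (simp add: nn_integral_cmult nn_integral_add)
  finally show ?thesis .
qed

lemma borel_measurable_offdiag_step [measurable]: "offdiag_step n t a \<in> borel_measurable borel"
  unfolding offdiag_step_def borel_prod[symmetric] by measurable

lemma borel_measurable_offdiag_step_integral:
  assumes "wiener_process M B"
  shows "offdiag_step_integral B n t a \<in> borel_measurable M"
proof -
  have [measurable]: "B y \<in> borel_measurable M" for y using assms by (simp add: wiener_process_def)
  show ?thesis unfolding offdiag_step_integral_def by measurable
qed

lemma has_double_wiener_integral_offdiag_step:
  assumes "wiener_process M B" "strict_mono t"
  shows "has_double_wiener_integral M B (offdiag_step n t a) (offdiag_step_integral B n t a)"
  unfolding has_double_wiener_integral_def
proof (intro conjI)
  show "\<exists>n' t' a'. (\<forall>k::nat. strict_mono (t' k)) \<and>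
      (\<lambda>k. \<integral>\<^sup>+ p. ennreal ((offdiag_step (n' k) (t' k) (a' k) p - offdiag_step n t a p)^2) \<partial>lborel) \<longlonglongrightarrow> 0 \<and>
      (\<lambda>k. \<integral>\<^sup>+ w. ennreal ((offdiag_step_integral B (n' k) (t' k) (a' k) w - offdiag_step_integral B n t a w)^2) \<partial>M) \<longlonglongrightarrow> 0"
    using assms by (intro exI[of _ "\<lambda>_. n"] exI[of _ "\<lambda>_. t"] exI[of _ "\<lambda>_. a"]) simp
qed (use borel_measurable_offdiag_step_integral[OF assms(1)] in simp_all)

text \<open>The constant is not sharp (the isometry gives 2): the approximation errors are absorbed by
  the crude inequality \<open>(x + y + z)\<^sup>2 \<le> 3 (x\<^sup>2 + y\<^sup>2 + z\<^sup>2)\<close>, used twice.\<close>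

lemma double_wiener_integral_diff_bound:
  assumes W: "wiener_process M B"
    and X: "has_double_wiener_integral M B f X" and X': "has_double_wiener_integral M B g X'"
  shows "(sqnorm M (\<lambda>w. X w - X' w)) \<le> 18 * (sqnorm lborel (\<lambda>p. f p - g p))"
proof -
  from X obtain n t a where t: "\<And>k::nat. strict_mono (t k)"
    and f: "(\<lambda>k. \<integral>\<^sup>+ p. ennreal ((offdiag_step (n k) (t k) (a k) p - f p)^2) \<partial>lborel) \<longlonglongrightarrow> 0"
    and fX: "(\<lambda>k. \<integral>\<^sup>+ w. ennreal ((offdiag_step_integral B (n k) (t k) (a k) w - X w)^2) \<partial>M) \<longlonglongrightarrow> 0"
    and mf [measurable]: "f \<in> borel_measurable borel" and mX [measurable]: "X \<in> borel_measurable M"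
    unfolding has_double_wiener_integral_def by auto
  from X' obtain n' t' a' where t': "\<And>k::nat. strict_mono (t' k)"
    and g: "(\<lambda>k. \<integral>\<^sup>+ p. ennreal ((offdiag_step (n' k) (t' k) (a' k) p - g p)^2) \<partial>lborel) \<longlonglongrightarrow> 0"
    and gX: "(\<lambda>k. \<integral>\<^sup>+ w. ennreal ((offdiag_step_integral B (n' k) (t' k) (a' k) w - X' w)^2) \<partial>M) \<longlonglongrightarrow> 0"
    and mg [measurable]: "g \<in> borel_measurable borel" and mX' [measurable]: "X' \<in> borel_measurable M"
    unfolding has_double_wiener_integral_def by auto
  let ?h = "\<lambda>k. offdiag_step (n k) (t k) (a k)" and ?h' = "\<lambda>k. offdiag_step (n' k) (t' k) (a' k)"
  let ?I = "\<lambda>k. offdiag_step_integral B (n k) (t k) (a k)" and ?I' = "\<lambda>k. offdiag_step_integral B (n' k) (t' k) (a' k)"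
  note [measurable] = borel_measurable_offdiag_step_integral[OF W]
  have bound: "(sqnorm M (\<lambda>w. X w - X' w)) \<le>
     3 * ((sqnorm M (\<lambda>w. X w - ?I k w)) +
       2 * (3 * ((sqnorm lborel (\<lambda>p. ?h k p - f p)) + (sqnorm lborel (\<lambda>p. f p - g p))
          + (sqnorm lborel (\<lambda>p. g p - ?h' k p))))
       + (sqnorm M (\<lambda>w. ?I' k w - X' w)))" (is "_ \<le> ?b k") for k
  proof -
    have "(sqnorm M (\<lambda>w. X w - X' w)) =
        (sqnorm M (\<lambda>w. (X w - ?I k w) + (?I k w - ?I' k w) + (?I' k w - X' w)))"
      by simp
    also have "\<dots> \<le> 3 * ((sqnorm M (\<lambda>w. X w - ?I k w)) +
        (sqnorm M (\<lambda>w. ?I k w - ?I' k w)) + (sqnorm M (\<lambda>w. ?I' k w - X' w)))"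
      by (rule nn_integral_square_sum3) measurable
    finally have 1: "(sqnorm M (\<lambda>w. X w - X' w)) \<le> \<dots>" .
    have "(sqnorm lborel (\<lambda>p. ?h k p - ?h' k p)) =
        (sqnorm lborel (\<lambda>p. (?h k p - f p) + (f p - g p) + (g p - ?h' k p)))"
      by simp
    also have "\<dots> \<le> 3 * ((sqnorm lborel (\<lambda>p. ?h k p - f p)) +
        (sqnorm lborel (\<lambda>p. f p - g p)) + (sqnorm lborel (\<lambda>p. g p - ?h' k p)))"
      by (rule nn_integral_square_sum3) measurable
    finally have 2: "(sqnorm lborel (\<lambda>p. ?h k p - ?h' k p)) \<le> \<dots>" .
    have 3: "(sqnorm M (\<lambda>w. ?I k w - ?I' k w)) \<le> 2 * (sqnorm lborel (\<lambda>p. ?h k p - ?h' k p))"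
      by (rule offdiag_step_isometry[OF W t t'])
    show ?thesis
      by (rule order.trans[OF 1], intro mult_left_mono add_mono order_refl order.trans[OF 3 mult_left_mono[OF 2]])
        simp_all
  qed
  have gI: "(\<lambda>k. \<integral>\<^sup>+ p. ennreal ((g p - ?h' k p)^2) \<partial>lborel) \<longlonglongrightarrow> 0"
    using g by (simp only: power2_commute)
  have fI: "(\<lambda>k. \<integral>\<^sup>+ w. ennreal ((X w - ?I k w)^2) \<partial>M) \<longlonglongrightarrow> 0"
    using fX by (simp only: power2_commute)
  have "(\<lambda>k. 3 * ((sqnorm M (\<lambda>w. X w - ?I k w)) +
       2 * (3 * ((sqnorm lborel (\<lambda>p. ?h k p - f p)) + (sqnorm lborel (\<lambda>p. f p - g p))
          + (sqnorm lborel (\<lambda>p. g p - ?h' k p))))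
       + (sqnorm M (\<lambda>w. ?I' k w - X' w))))
    \<longlonglongrightarrow> 3 * (0 + 2 * (3 * (0 + (sqnorm lborel (\<lambda>p. f p - g p)) + 0)) + 0)"
    by (intro tendsto_intros ennreal_tendsto_cmult f gI fI gX) auto
  then have "(sqnorm M (\<lambda>w. X w - X' w)) \<le> 3 * (0 + 2 * (3 * (0 + (sqnorm lborel (\<lambda>p. f p - g p)) + 0)) + 0)"
    by (rule LIMSEQ_le_const) (use bound in blast)
  also have "\<dots> = 18 * (sqnorm lborel (\<lambda>p. f p - g p))"
    by (simp flip: mult.assoc)
  finally show ?thesis .
qed

section \<open>The Rosenblatt kernel\<close>

lemma nn_integral_powr_from_0:
  fixes a c :: real
  assumes "-1 < a" "0 \<le> c"
  shows "(\<integral>\<^sup>+x. ennreal (x powr a) * indicator {0..c} x \<partial>lborel) = ennreal (c powr (a + 1) / (a + 1))"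
  by (rule nn_integral_has_integral_lebesgue'[OF _ has_integral_powr_from_0[OF assms]]) simp

lemma nn_integral_powr_to_infinity:
  fixes a c :: real
  assumes "a < -1" "0 < c"
  shows "(\<integral>\<^sup>+x. ennreal (x powr a) * indicator {c..} x \<partial>lborel) = ennreal (c powr (a + 1) / (- a - 1))"
proof -
  have "(\<integral>\<^sup>+x. ennreal (x powr a) * indicator {c..} x \<partial>lborel) = ennreal (0 - c powr (a + 1) / (a + 1))"
  proof (rule nn_integral_FTC_atLeast)
    fix x assume "c \<le> x"
    then have "0 < x" using assms by simp
    then show "((\<lambda>x. x powr (a + 1) / (a + 1)) has_real_derivative x powr a) (at x)"
      using DERIV_cdivide[OF has_real_derivative_powr[of x "a + 1"], of "a + 1"] assms by simp
  next
    have "((\<lambda>x. x powr (a + 1)) \<longlongrightarrow> 0) at_top"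
      by (rule tendsto_neg_powr) (use assms in \<open>auto simp: filterlim_ident\<close>)
    from tendsto_divide[OF this tendsto_const[of "a + 1"]] show "((\<lambda>x. x powr (a + 1) / (a + 1)) \<longlongrightarrow> 0) at_top"
      using assms by simp
  qed auto
  also have "0 - c powr (a + 1) / (a + 1) = c powr (a + 1) / (- a - 1)"
    using assms by (simp add: field_simps)
  finally show ?thesis .
qed

definition pos_powr :: "real \<Rightarrow> real \<Rightarrow> real \<Rightarrow> real" where
  "pos_powr H u y = max (u - y) 0 powr (H / 2 - 1)"

lemma pos_powr_nonneg [simp]: "0 \<le> pos_powr H u y"
  by (simp add: pos_powr_def)

lemma borel_measurable_pos_powr [measurable (raw)]:
  assumes [measurable]: "f \<in> borel_measurable M" "g \<in> borel_measurable M"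
  shows "(\<lambda>x. pos_powr H (f x) (g x)) \<in> borel_measurable M"
  unfolding pos_powr_def by measurable

text \<open>The summands stem from the parts of the overlap integral within and beyond distance
  \<open>\<bar>u - v\<bar>\<close>. The sum dominates the exact factor
  \<open>Beta (H / 2) (1 - H)\<close> and has the same leading term 1 / (1 - H), produced by the far
  part.\<close>

definition overlap_const :: "real \<Rightarrow> real" where
  "overlap_const H = 2 / H + 1 / (1 - H)"

text \<open>Up to the constant this is the identity behind the covariance of the Rosenblatt process;
  the upper bound is asymptotically sharp as \<open>H \<rightarrow> 1\<close>.\<close>

lemma nn_integral_pos_powr_overlap_less:
  assumes H: "1/2 < H" "H < 1" and uv: "u < v"
  shows "(\<integral>\<^sup>+y. ennreal (pos_powr H u y * pos_powr H v y) \<partial>lborel)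
    \<le> ennreal (overlap_const H * (v - u) powr (H - 1))"
proof -
  define d where "d = v - u"
  have d: "0 < d" using uv by (simp add: d_def)
  have "(\<integral>\<^sup>+y. ennreal (pos_powr H u y * pos_powr H v y) \<partial>lborel) =
      ennreal \<bar>-1\<bar> * (\<integral>\<^sup>+x. ennreal (pos_powr H u (u + (-1) * x) * pos_powr H v (u + (-1) * x)) \<partial>lborel)"
    by (rule nn_integral_real_affine) auto
  also have "\<dots> = (\<integral>\<^sup>+x. ennreal (max x 0 powr (H / 2 - 1) * max (x + d) 0 powr (H / 2 - 1)) \<partial>lborel)"
    by (simp add: pos_powr_def d_def algebra_simps)
  \<comment> \<open>The exponents are negative: up to d the factor shifted by d is at most its value
    at d, and beyond d it is at most the unshifted factor.\<close>
  also have "\<dots> \<le> (\<integral>\<^sup>+x. ennreal (d powr (H / 2 - 1)) * (ennreal (x powr (H / 2 - 1)) * indicator {0..d} x)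
      + ennreal (x powr (H - 2)) * indicator {d..} x \<partial>lborel)"
  proof (rule nn_integral_mono)
    fix x :: real
    consider "x \<le> 0" | "0 < x" "x \<le> d" | "d < x" by linarith
    then show "ennreal (max x 0 powr (H / 2 - 1) * max (x + d) 0 powr (H / 2 - 1))
      \<le> ennreal (d powr (H / 2 - 1)) * (ennreal (x powr (H / 2 - 1)) * indicator {0..d} x)
      + ennreal (x powr (H - 2)) * indicator {d..} x"
    proof cases
      case 1 then show ?thesis by simp
    next
      case 2
      have "x powr (H / 2 - 1) * (x + d) powr (H / 2 - 1) \<le> x powr (H / 2 - 1) * d powr (H / 2 - 1)"
        using 2 d H by (intro mult_left_mono powr_mono2') auto
      also have "\<dots> = d powr (H / 2 - 1) * x powr (H / 2 - 1)" by (rule mult.commute)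
      finally have "x powr (H / 2 - 1) * (x + d) powr (H / 2 - 1) \<le> d powr (H / 2 - 1) * x powr (H / 2 - 1)" .
      then have "ennreal (x powr (H / 2 - 1) * (x + d) powr (H / 2 - 1)) \<le> ennreal (d powr (H / 2 - 1)) * ennreal (x powr (H / 2 - 1))"
        by (simp add: ennreal_leI flip: ennreal_mult)
      then show ?thesis using 2 d by (simp add: max_def add_increasing2)
    next
      case 3
      have "(x + d) powr (H / 2 - 1) \<le> x powr (H / 2 - 1)"
        using 3 d H by (intro powr_mono2') auto
      then have "x powr (H / 2 - 1) * (x + d) powr (H / 2 - 1) \<le> x powr (H / 2 - 1) * x powr (H / 2 - 1)"
        by (rule mult_left_mono) simp
      also have "\<dots> = x powr (H - 2)"
        by (simp flip: powr_add)
      finally show ?thesis using 3 d by (simp add: max_def ennreal_leI)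
    qed
  qed
  also have "\<dots> = ennreal (d powr (H / 2 - 1)) * ennreal (d powr (H / 2 - 1 + 1) / (H / 2 - 1 + 1))
      + ennreal (d powr (H - 2 + 1) / (- (H - 2) - 1))"
    using H d by (simp add: nn_integral_add nn_integral_cmult nn_integral_powr_from_0[of "H/2 - 1" d]
        nn_integral_powr_to_infinity[of "H - 2" d, simplified])
  also have "\<dots> = ennreal (overlap_const H * d powr (H - 1))"
  proof -
    have "d powr (H / 2 - 1) * d powr (H / 2) = d powr (H - 1)"
      by (simp flip: powr_add)
    then show ?thesis
      using H by (simp add: overlap_const_def field_simps flip: ennreal_mult ennreal_plus)
  qed
  finally show ?thesis by (simp add: d_def)
qed

lemma nn_integral_pos_powr_overlap:
  assumes H: "1/2 < H" "H < 1" and uv: "u \<noteq> v"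
  shows "(\<integral>\<^sup>+y. ennreal (pos_powr H u y * pos_powr H v y) \<partial>lborel)
    \<le> ennreal (overlap_const H * \<bar>u - v\<bar> powr (H - 1))"
proof (cases "u < v")
  case True
  then show ?thesis using nn_integral_pos_powr_overlap_less[OF H True] by (simp add: abs_minus_commute)
next
  case False
  then have "v < u" using uv by simp
  then show ?thesis using nn_integral_pos_powr_overlap_less[OF H \<open>v < u\<close>] by (simp add: mult.commute)
qed

section \<open>Energy of the kernel\<close>

lemma nn_integral_inverse_sqrt_dist:
  assumes "0 \<le> L"
  shows "(\<integral>\<^sup>+v. ennreal (\<bar>u - v\<bar> powr (-1/2)) * indicator {v. \<bar>u - v\<bar> \<le> L} v \<partial>lborel) \<le> ennreal (4 * sqrt L)"
proof -
  let ?I = "\<integral>\<^sup>+x. ennreal (x powr (-1/2)) * indicator {0..L} x \<partial>lborel"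
  have I: "?I = ennreal (2 * sqrt L)"
    using nn_integral_powr_from_0[of "-1/2" L] assms by (simp add: powr_half_sqrt)
  have shift1: "(\<integral>\<^sup>+v. ennreal ((v - u) powr (-1/2)) * indicator {0..L} (v - u) \<partial>lborel) = ?I"
    using nn_integral_real_affine[of "\<lambda>v. ennreal ((v - u) powr (-1/2)) * indicator {0..L} (v - u)" 1 u] by simp
  have shift2: "(\<integral>\<^sup>+v. ennreal ((u - v) powr (-1/2)) * indicator {0..L} (u - v) \<partial>lborel) = ?I"
    using nn_integral_real_affine[of "\<lambda>v. ennreal ((u - v) powr (-1/2)) * indicator {0..L} (u - v)" "-1" u] by simp
  have "(\<integral>\<^sup>+v. ennreal (\<bar>u - v\<bar> powr (-1/2)) * indicator {v. \<bar>u - v\<bar> \<le> L} v \<partial>lborel)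
    \<le> (\<integral>\<^sup>+v. ennreal ((v - u) powr (-1/2)) * indicator {0..L} (v - u)
          + ennreal ((u - v) powr (-1/2)) * indicator {0..L} (u - v) \<partial>lborel)"
    by (intro nn_integral_mono) (auto simp: indicator_def abs_if)
  also have "\<dots> = ?I + ?I"
    by (subst nn_integral_add, measurable) (simp only: shift1 shift2)
  also have "\<dots> = ennreal (4 * sqrt L)"
    unfolding I using assms by (simp flip: ennreal_plus)
  finally show ?thesis .
qed

text \<open>Weighted arithmetic-geometric inequality between 1 and \<open>x powr (-1/2)\<close>.
  With b = 1 - H it replaces an exponent depending on H by a fixed one, at the price of a factor
  vanishing with b, while the coefficient of the constant term still tends to 1. Nonnegativity of
  \<open>1 - 4 * b\<close> is the origin of the restriction H \<ge> 3/4.\<close>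

lemma powr_interpolation:
  fixes x b :: real
  assumes "0 < x" "0 \<le> b" "b \<le> 1/4"
  shows "x powr (- 2 * b) \<le> (1 - 4 * b) + 4 * b * x powr (-1/2)"
proof -
  have "1 powr (1 - 4 * b) * (x powr (-1/2)) powr (4 * b) \<le> (1 - 4 * b) * 1 + 4 * b * x powr (-1/2)"
    by (rule Youngs_inequality_0) (use assms in auto)
  then show ?thesis by (simp add: powr_powr)
qed

text \<open>The kernel is a mixture of the rank-one tensors of \<open>\<kappa> u\<close> with
  itself, so its squared norm is the double mixture of squared inner products. Tonelli applies since
  everything takes values in \<open>ennreal\<close>, and no finiteness has to be known
  beforehand.\<close>

lemma nn_integral_kernel_square:
  fixes G :: "real \<Rightarrow> ennreal" and \<kappa> :: "real \<Rightarrow> real \<Rightarrow> ennreal"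
  assumes [measurable]: "G \<in> borel_measurable borel"
    and [measurable]: "(\<lambda>p. \<kappa> (fst p) (snd p)) \<in> borel_measurable (borel \<Otimes>\<^sub>M borel)"
  shows "(\<integral>\<^sup>+x. \<integral>\<^sup>+y. (\<integral>\<^sup>+u. G u * \<kappa> u x * \<kappa> u y \<partial>lborel)^2 \<partial>lborel \<partial>lborel) =
    (\<integral>\<^sup>+u. \<integral>\<^sup>+v. G u * G v * (\<integral>\<^sup>+x. \<kappa> u x * \<kappa> v x \<partial>lborel)^2 \<partial>lborel \<partial>lborel)"
proof -
  have m [measurable (raw)]: "(\<lambda>z. \<kappa> (f z) (g z)) \<in> borel_measurable N"
    if [measurable]: "f \<in> borel_measurable N" "g \<in> borel_measurable N" for f g and N :: "'c measure"
    using measurable_compose[OF _ assms(2), of "\<lambda>z. (f z, g z)" N] by simp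
  let ?f = "\<lambda>u v x y. (G u * G v) * ((\<kappa> u x * \<kappa> v x) * (\<kappa> u y * \<kappa> v y))"
  have "(\<integral>\<^sup>+x. \<integral>\<^sup>+y. (\<integral>\<^sup>+u. G u * \<kappa> u x * \<kappa> u y \<partial>lborel)^2 \<partial>lborel \<partial>lborel) =
      (\<integral>\<^sup>+x. \<integral>\<^sup>+y. \<integral>\<^sup>+u. \<integral>\<^sup>+v. ?f u v x y \<partial>lborel \<partial>lborel \<partial>lborel \<partial>lborel)"
  proof (intro nn_integral_cong)
    fix x y
    have "(\<integral>\<^sup>+u. G u * \<kappa> u x * \<kappa> u y \<partial>lborel)^2 =
      (\<integral>\<^sup>+u. \<integral>\<^sup>+v. (G u * \<kappa> u x * \<kappa> u y) * (G v * \<kappa> v x * \<kappa> v y) \<partial>lborel \<partial>lborel)"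
      unfolding power2_eq_square by (subst nn_integral_multc[symmetric], measurable) (simp add: nn_integral_cmult)
    also have "\<dots> = (\<integral>\<^sup>+u. \<integral>\<^sup>+v. ?f u v x y \<partial>lborel \<partial>lborel)"
      by (simp add: mult_ac)
    finally show "(\<integral>\<^sup>+u. G u * \<kappa> u x * \<kappa> u y \<partial>lborel)^2 = \<dots>" .
  qed
  also have "\<dots> = (\<integral>\<^sup>+x. \<integral>\<^sup>+u. \<integral>\<^sup>+y. \<integral>\<^sup>+v. ?f u v x y \<partial>lborel \<partial>lborel \<partial>lborel \<partial>lborel)"
    by (intro nn_integral_cong lborel_pair.Fubini') measurable
  also have "\<dots> = (\<integral>\<^sup>+x. \<integral>\<^sup>+u. \<integral>\<^sup>+v. \<integral>\<^sup>+y. ?f u v x y \<partial>lborel \<partial>lborel \<partial>lborel \<partial>lborel)"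
    by (intro nn_integral_cong lborel_pair.Fubini') measurable
  also have "\<dots> = (\<integral>\<^sup>+u. \<integral>\<^sup>+x. \<integral>\<^sup>+v. \<integral>\<^sup>+y. ?f u v x y \<partial>lborel \<partial>lborel \<partial>lborel \<partial>lborel)"
    by (intro nn_integral_cong lborel_pair.Fubini') measurable
  also have "\<dots> = (\<integral>\<^sup>+u. \<integral>\<^sup>+v. \<integral>\<^sup>+x. \<integral>\<^sup>+y. ?f u v x y \<partial>lborel \<partial>lborel \<partial>lborel \<partial>lborel)"
    by (intro nn_integral_cong lborel_pair.Fubini') measurable
  also have "\<dots> = (\<integral>\<^sup>+u. \<integral>\<^sup>+v. G u * G v * (\<integral>\<^sup>+x. \<kappa> u x * \<kappa> v x \<partial>lborel)^2 \<partial>lborel \<partial>lborel)"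
    by (simp add: nn_integral_cmult nn_integral_multc power2_eq_square)
  finally show ?thesis .
qed

text \<open>For g \<ge> 0 this is the squared norm of \<open>J_kernel H g\<close> without the factor
  \<open>rosenblatt_const H\<close>, in a form that makes sense even when infinite.\<close>

abbreviation kernel_energy :: "real \<Rightarrow> (real \<Rightarrow> real) \<Rightarrow> ennreal" where
  "kernel_energy H g \<equiv> \<integral>\<^sup>+x. \<integral>\<^sup>+y.
    (\<integral>\<^sup>+u. ennreal (g u) * ennreal (pos_powr H u x) * ennreal (pos_powr H u y) \<partial>lborel)^2 \<partial>lborel \<partial>lborel"

text \<open>One bound serves two regimes. As H tends to 1 the second term loses weight and the first
  keeps the exact constant; for short intervals both are of order at most
  \<open>(t - s) powr (3/2)\<close>, uniformly in H after normalization. The 16 is 4 from the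
  interpolation times 4 from integrating the inverse square root.\<close>

lemma nn_integral_kernel_square_bound:
  fixes g :: "real \<Rightarrow> real"
  assumes H: "3/4 \<le> H" "H < 1" and st: "s \<le> t"
    and [measurable]: "g \<in> borel_measurable borel"
    and g: "\<And>u. 0 \<le> g u" "\<And>u. g u \<le> C" "\<And>u. u \<notin> {s..t} \<Longrightarrow> g u = 0"
  shows "kernel_energy H (\<lambda>u. g u)
    \<le> ennreal ((overlap_const H)^2 *
        ((1 - 4 * (1 - H)) * (LINT u|lborel. g u)^2 + 16 * (1 - H) * C^2 * ((t - s) * sqrt (t - s))))"
proof -
  define b where "b = 1 - H"
  have b: "0 < b" "b \<le> 1/4" using H by (auto simp: b_def)
  define K where "K = overlap_const H"
  have K: "0 \<le> K" using H by (simp add: K_def overlap_const_def)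
  have C: "0 \<le> C" using g(1)[of 0] g(2)[of 0] by linarith
  define L where "L = t - s"
  have L: "0 \<le> L" using st by (simp add: L_def)
  let ?I = "LINT u|lborel. g u"
  have int_ind: "integrable lborel (\<lambda>u. C * indicator {s..t} u)"
    using st by (intro integrable_mult_right integrable_real_indicator) auto
  have int_g: "integrable lborel g"
  proof (rule Bochner_Integration.integrable_bound[OF int_ind])
    show "AE u in lborel. norm (g u) \<le> norm (C * indicator {s..t} u)"
      using g C by (intro AE_I2) (auto simp: indicator_def abs_of_nonneg)
  qed simp
  then have I: "(\<integral>\<^sup>+u. ennreal (g u) \<partial>lborel) = ennreal ?I"
    using g(1) by (intro nn_integral_eq_integral) auto
  have I0: "0 \<le> ?I" using g(1) by simp
  have inner: "(\<integral>\<^sup>+v. ennreal (g u) * ennreal (g v) * (\<integral>\<^sup>+x. ennreal (pos_powr H u x) * ennreal (pos_powr H v x) \<partial>lborel)^2 \<partial>lborel)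
     \<le> ennreal (g u) * ennreal (K^2 * ((1 - 4 * b) * ?I + 16 * b * C * sqrt L))" (is "?lhs \<le> _") for u
  proof -
    \<comment> \<open>On the diagonal the overlap is infinite whereas \<open>0 powr (H - 1)\<close>
      is 0, so the pointwise estimate holds only for v distinct from u.\<close>
    have "AE v in lborel. v \<noteq> u" by (rule AE_lborel_singleton)
    then have "?lhs \<le> (\<integral>\<^sup>+v. ennreal (g u) * (ennreal (K^2 * (1 - 4 * b)) * ennreal (g v) +
        ennreal (K^2 * (4 * b) * C) * (ennreal (\<bar>u - v\<bar> powr (-1/2)) * indicator {v. \<bar>u - v\<bar> \<le> L} v)) \<partial>lborel)"
    proof (intro nn_integral_mono_AE, eventually_elim)
      case (elim v)
      let ?q = "\<integral>\<^sup>+x. ennreal (pos_powr H u x) * ennreal (pos_powr H v x) \<partial>lborel"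
      show ?case
      proof (cases "u \<in> {s..t} \<and> v \<in> {s..t}")
        case False
        then show ?thesis using g(3) by auto
      next
        case True
        then have uvL: "\<bar>u - v\<bar> \<le> L" by (auto simp: L_def)
        have "?q \<le> ennreal (K * \<bar>u - v\<bar> powr (H - 1))"
          using nn_integral_pos_powr_overlap[of H u v] H elim by (simp add: K_def ennreal_mult)
        then have "?q^2 \<le> (ennreal (K * \<bar>u - v\<bar> powr (H - 1)))^2"
          by (rule power_mono) simp
        also have "\<dots> = ennreal (K^2 * \<bar>u - v\<bar> powr (- 2 * b))"
        proof -
          have "(\<bar>u - v\<bar> powr (H - 1))^2 = \<bar>u - v\<bar> powr (- 2 * b)"
            by (simp add: power2_eq_square b_def flip: powr_add)
          then show ?thesis using K by (simp add: ennreal_power power_mult_distrib)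
        qed
        also have "\<dots> \<le> ennreal (K^2 * ((1 - 4 * b) + 4 * b * \<bar>u - v\<bar> powr (-1/2)))"
          using powr_interpolation[of "\<bar>u - v\<bar>" b] elim b by (intro ennreal_leI mult_left_mono) auto
        finally have q: "?q^2 \<le> \<dots>" .
        have "ennreal (g u) * ennreal (g v) * ?q^2 \<le>
            ennreal (g u) * (ennreal (g v) * ennreal (K^2 * ((1 - 4 * b) + 4 * b * \<bar>u - v\<bar> powr (-1/2))))"
          by (subst mult.assoc) (intro mult_left_mono q, simp_all)
        also have "ennreal (g v) * ennreal (K^2 * ((1 - 4 * b) + 4 * b * \<bar>u - v\<bar> powr (-1/2))) =
            ennreal (K^2 * (1 - 4 * b) * g v + K^2 * (4 * b) * g v * \<bar>u - v\<bar> powr (-1/2))"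
          using g(1)[of v] by (simp add: algebra_simps flip: ennreal_mult')
        also have "\<dots> \<le> ennreal (K^2 * (1 - 4 * b) * g v + K^2 * (4 * b) * C * \<bar>u - v\<bar> powr (-1/2))"
          using g(2)[of v] b K by (intro ennreal_leI add_left_mono mult_right_mono mult_left_mono) auto
        also have "\<dots> = ennreal (K^2 * (1 - 4 * b)) * ennreal (g v) +
            ennreal (K^2 * (4 * b) * C) * ennreal (\<bar>u - v\<bar> powr (-1/2))"
          using g(1)[of v] b C by (subst ennreal_plus) (auto simp: ennreal_mult'')
        finally show ?thesis using uvL by (simp add: mult_left_mono)
      qed
    qed
    also have "\<dots> = ennreal (g u) * (ennreal (K^2 * (1 - 4 * b)) * ennreal ?I + ennreal (K^2 * (4 * b) * C) *
        (\<integral>\<^sup>+v. ennreal (\<bar>u - v\<bar> powr (-1/2)) * indicator {v. \<bar>u - v\<bar> \<le> L} v \<partial>lborel))"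
      by (simp add: nn_integral_cmult nn_integral_add I)
    also have "\<dots> \<le> ennreal (g u) * (ennreal (K^2 * (1 - 4 * b)) * ennreal ?I + ennreal (K^2 * (4 * b) * C) * ennreal (4 * sqrt L))"
      by (intro mult_left_mono add_left_mono nn_integral_inverse_sqrt_dist L) simp_all
    also have "\<dots> = ennreal (g u) * ennreal (K^2 * ((1 - 4 * b) * ?I + 16 * b * C * sqrt L))"
    proof -
      have gen: "ennreal w * ennreal x + ennreal y * ennreal z = ennreal (w * x + y * z)"
        if "0 \<le> w" "0 \<le> x" "0 \<le> y" "0 \<le> z" for w x y z
        using that by (simp add: ennreal_mult ennreal_plus)
      have "ennreal (K^2 * (1 - 4 * b)) * ennreal ?I + ennreal (K^2 * (4 * b) * C) * ennreal (4 * sqrt L) =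
          ennreal (K^2 * (1 - 4 * b) * ?I + K^2 * (4 * b) * C * (4 * sqrt L))"
        by (rule gen) (use b C I0 L in simp_all)
      also have "K^2 * (1 - 4 * b) * ?I + K^2 * (4 * b) * C * (4 * sqrt L) = K^2 * ((1 - 4 * b) * ?I + 16 * b * C * sqrt L)"
        by (simp add: algebra_simps)
      finally show ?thesis by simp
    qed
    finally show ?thesis .
  qed
  have "kernel_energy H (\<lambda>u. g u)
      = (\<integral>\<^sup>+u. \<integral>\<^sup>+v. ennreal (g u) * ennreal (g v) * (\<integral>\<^sup>+x. ennreal (pos_powr H u x) * ennreal (pos_powr H v x) \<partial>lborel)^2 \<partial>lborel \<partial>lborel)"
    by (rule nn_integral_kernel_square) measurable
  also have "\<dots> \<le> (\<integral>\<^sup>+u. ennreal (g u) * ennreal (K^2 * ((1 - 4 * b) * ?I + 16 * b * C * sqrt L)) \<partial>lborel)"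
    by (intro nn_integral_mono inner)
  also have "\<dots> = ennreal (?I * (K^2 * ((1 - 4 * b) * ?I + 16 * b * C * sqrt L)))"
    using I0 by (simp add: nn_integral_multc I ennreal_mult')
  also have "\<dots> \<le> ennreal (K^2 * ((1 - 4 * b) * ?I^2 + 16 * b * C^2 * (L * sqrt L)))"
  proof (rule ennreal_leI)
    have "?I \<le> (LINT u|lborel. C * indicator {s..t} u)"
      using g C by (intro integral_mono int_g int_ind) (auto simp: indicator_def)
    also have "\<dots> = C * L" using st by (simp add: L_def)
    finally have "K^2 * (16 * b * C * sqrt L) * ?I \<le> K^2 * (16 * b * C * sqrt L) * (C * L)"
      using b C L by (intro mult_left_mono) auto
    then show "?I * (K^2 * ((1 - 4 * b) * ?I + 16 * b * C * sqrt L)) \<le> K^2 * ((1 - 4 * b) * ?I^2 + 16 * b * C^2 * (L * sqrt L))"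
      by (simp add: algebra_simps power2_eq_square)
  qed
  finally show ?thesis by (simp add: K_def b_def L_def)
qed

text \<open>\<open>J_kernel\<close> is a Bochner integral with default value 0, so linearity could
  fail where the integral diverges, as on parts of the diagonal. Finite energy of g1 confines this
  to a null set, and 0 \<le> g2 \<le> g1 transfers integrability to g2. The case g2 = 0 yields the
  norm bound for a single kernel.\<close>

lemma J_kernel_diff_bound:
  fixes g1 g2 :: "real \<Rightarrow> real"
  assumes H: "3/4 \<le> H" "H < 1" and st: "s \<le> t"
    and [measurable]: "g1 \<in> borel_measurable borel" "g2 \<in> borel_measurable borel"
    and g: "\<And>u. 0 \<le> g2 u" "\<And>u. g2 u \<le> g1 u" "\<And>u. g1 u \<le> C" "\<And>u. u \<notin> {s..t} \<Longrightarrow> g1 u = 0"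
  shows "(sqnorm lborel (\<lambda>p. J_kernel H g1 p - J_kernel H g2 p)) \<le>
    ennreal ((rosenblatt_const H)^2) *
    kernel_energy H (\<lambda>u. g1 u - g2 u)"
proof -
  let ?P = "\<lambda>g p. \<integral>\<^sup>+u. ennreal (g u) * ennreal (pos_powr H u (fst p)) * ennreal (pos_powr H u (snd p)) \<partial>lborel"
  have fst_snd: "(\<integral>\<^sup>+p. (?P g p)^2 \<partial>lborel) = (\<integral>\<^sup>+x. \<integral>\<^sup>+y. (?P g (x, y))^2 \<partial>lborel \<partial>lborel)"
    if [measurable]: "g \<in> borel_measurable borel" for g :: "real \<Rightarrow> real"
    unfolding lborel_prod[symmetric] by (subst lborel.nn_integral_fst[symmetric]) simp_all
  have g10: "0 \<le> g1 u" for u using g(1)[of u] g(2)[of u] by linarith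
  have "(\<integral>\<^sup>+p. (?P g1 p)^2 \<partial>lborel) < \<infinity>"
    unfolding fst_snd[OF \<open>g1 \<in> borel_measurable borel\<close>]
    using nn_integral_kernel_square_bound[OF H st, of g1 C] g g10
    by (auto intro: le_less_trans[OF _ ennreal_less_top])
  moreover have mP: "?P g1 \<in> borel_measurable lborel"
    unfolding lborel_prod[symmetric] by measurable
  ultimately have "AE p in lborel. (?P g1 p)^2 \<noteq> \<infinity>"
    by (intro nn_integral_PInf_AE) auto
  then have "AE p in lborel. ennreal ((J_kernel H g1 p - J_kernel H g2 p)^2) \<le>
      ennreal ((rosenblatt_const H)^2) * (?P (\<lambda>u. g1 u - g2 u) p)^2"
  proof eventually_elim
    case (elim p)
    obtain x y where p: "p = (x, y)" by (cases p)
    let ?k = "\<lambda>u. pos_powr H u x * pos_powr H u y"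
    have "?P g1 p < \<infinity>"
    proof (rule ccontr)
      assume "\<not> ?P g1 p < \<infinity>"
      then have "?P g1 p = \<infinity>" by (simp only: not_less infinity_ennreal_def top_unique)
      with elim show False by (simp only: power2_eq_square infinity_ennreal_def ennreal_top_mult) simp
    qed
    then have i1: "integrable lborel (\<lambda>u. g1 u * ?k u)"
      using g10 by (intro integrableI_nonneg) (auto simp: p ennreal_mult mult.assoc)
    then have i2: "integrable lborel (\<lambda>u. g2 u * ?k u)"
      using g by (rule_tac Bochner_Integration.integrable_bound[OF i1])
        (auto intro!: AE_I2 mult_right_mono simp: abs_mult abs_of_nonneg g10)
    have J: "J_kernel H g' p = rosenblatt_const H * (LINT u|lborel. g' u * ?k u)" for g'
      by (simp add: J_kernel_def p pos_powr_def mult.assoc)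
    have diff: "J_kernel H g1 p - J_kernel H g2 p = rosenblatt_const H * (LINT u|lborel. (g1 u - g2 u) * ?k u)"
      using i1 i2 by (simp add: J left_diff_distrib right_diff_distrib)
    have "ennreal (LINT u|lborel. (g1 u - g2 u) * ?k u) = (\<integral>\<^sup>+u. ennreal ((g1 u - g2 u) * ?k u) \<partial>lborel)"
      using i1 i2 g by (intro nn_integral_eq_integral[symmetric]) (auto simp: left_diff_distrib intro!: AE_I2 mult_right_mono)
    also have "\<dots> = ?P (\<lambda>u. g1 u - g2 u) p"
      using g by (simp add: p ennreal_mult mult.assoc)
    finally have P: "?P (\<lambda>u. g1 u - g2 u) p = ennreal (LINT u|lborel. (g1 u - g2 u) * ?k u)" ..
    have "0 \<le> (LINT u|lborel. (g1 u - g2 u) * ?k u)"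
      using g by (intro integral_nonneg_AE AE_I2) auto
    then show ?case
      unfolding diff P power_mult_distrib by (simp add: ennreal_mult' ennreal_power)
  qed
  then have "(sqnorm lborel (\<lambda>p. J_kernel H g1 p - J_kernel H g2 p)) \<le>
      (\<integral>\<^sup>+p. ennreal ((rosenblatt_const H)^2) * (?P (\<lambda>u. g1 u - g2 u) p)^2 \<partial>lborel)"
    by (rule nn_integral_mono_AE)
  also have "\<dots> = ennreal ((rosenblatt_const H)^2) * (\<integral>\<^sup>+p. (?P (\<lambda>u. g1 u - g2 u) p)^2 \<partial>lborel)"
    unfolding lborel_prod[symmetric] by (intro nn_integral_cmult) measurable
  finally show ?thesis by (simp add: fst_snd)
qed

section \<open>Behaviour of the constants as H tends to 1\<close>

lemma rosenblatt_const_asymp: "((\<lambda>H. rosenblatt_const H / (1 - H)) \<longlongrightarrow> 1 / sqrt 2) (at_left 1)"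
proof -
  let ?r = "\<lambda>H::real. sqrt (H * (2 * H - 1) / 2) * (Gamma (1 - H / 2) / (Gamma (H / 2) * Gamma (2 - H)))"
  have "(?r \<longlongrightarrow> sqrt (1 * (2 * 1 - 1) / 2) * (Gamma (1 - 1 / 2) / (Gamma (1 / 2) * Gamma (2 - 1)))) (at_left 1)"
    by (intro tendsto_intros) (auto simp: Gamma_one_half_real elim!: nonpos_Ints_cases)
  then have lim: "(?r \<longlongrightarrow> 1 / sqrt 2) (at_left 1)"
    by (simp add: Gamma_one_half_real real_sqrt_divide)
  have "\<forall>\<^sub>F H in at_left 1. H \<in> {1/2<..<1::real}"
    by (rule eventually_at_left_real) simp
  then have "\<forall>\<^sub>F H in at_left 1. ?r H = rosenblatt_const H / (1 - H)"
  proof eventually_elim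
    case (elim H)
    then have H: "1/2 < H" "H < 1" by auto
    \<comment> \<open>\<open>Gamma (1 - H)\<close> has a pole at H = 1; the functional equation
      isolates it as the factor 1 / (1 - H), leaving a quotient continuous at 1.\<close>
    have "Gamma (2 - H) = (1 - H) * Gamma (1 - H)"
      using Gamma_plus1[of "1 - H"] nonpos_Ints_nonpos[of "1 - H"] H by auto
    moreover have pos: "0 < Gamma (1 - H)" "0 < Gamma (H / 2)" "0 < Gamma (1 - H / 2)"
      using H by (auto intro!: Gamma_real_pos)
    moreover have "H / 2 + (1 - H) = 1 - H / 2" by simp
    ultimately have B: "Beta (H / 2) (1 - H) = Gamma (H / 2) * Gamma (2 - H) / (1 - H) / Gamma (1 - H / 2)"
      using H by (simp add: Beta_def)
    then have "0 < Beta (H / 2) (1 - H)"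
      using pos \<open>Gamma (2 - H) = _\<close> H by simp
    then have c: "rosenblatt_const H = sqrt (H * (2 * H - 1) / 2) / Beta (H / 2) (1 - H)"
      by (simp add: rosenblatt_const_def real_sqrt_divide real_sqrt_mult)
    have "S * (a / (g * d)) = S / (g * d / e / a) / e" if "e \<noteq> 0" for S a g d e :: real
      using that by simp
    from this[of "1 - H"] show ?case
      unfolding c B using H by simp
  qed
  from Lim_transform_eventually[OF lim this] show ?thesis .
qed

lemma rosenblatt_const_nonneg: "1/2 \<le> H \<Longrightarrow> 0 \<le> rosenblatt_const H"
  by (simp add: rosenblatt_const_def)

text \<open>The zero of the normalization cancels the pole of the overlap. The limit is the
  asymptotic norm of the kernel per unit of \<open>\<integral> f\<close>, the source of 1 / sqrt 2
  in the limit process.\<close>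

lemma rosenblatt_overlap_asymp: "((\<lambda>H. rosenblatt_const H * overlap_const H) \<longlongrightarrow> 1 / sqrt 2) (at_left 1)"
proof -
  have "((\<lambda>H::real. (1 - H) * overlap_const H) \<longlongrightarrow> (1 - 1) * (2 / 1) + 1) (at_left 1)"
  proof (rule Lim_transform_eventually)
    show "((\<lambda>H::real. (1 - H) * (2 / H) + 1) \<longlongrightarrow> (1 - 1) * (2 / 1) + 1) (at_left 1)"
      by (intro tendsto_intros) auto
    have "\<forall>\<^sub>F H in at_left 1. H \<in> {1/2<..<1::real}"
      by (rule eventually_at_left_real) simp
    then show "\<forall>\<^sub>F H::real in at_left 1. (1 - H) * (2 / H) + 1 = (1 - H) * overlap_const H"
      by eventually_elim (simp add: overlap_const_def distrib_left)
  qed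
  from tendsto_mult[OF rosenblatt_const_asymp this]
  have "((\<lambda>H. rosenblatt_const H / (1 - H) * ((1 - H) * overlap_const H)) \<longlongrightarrow> 1 / sqrt 2) (at_left 1)" by simp
  moreover have "\<forall>\<^sub>F H in at_left 1. H \<in> {1/2<..<1::real}"
    by (rule eventually_at_left_real) simp
  then have "\<forall>\<^sub>F H in at_left 1. rosenblatt_const H / (1 - H) * ((1 - H) * overlap_const H) = rosenblatt_const H * overlap_const H"
    by eventually_elim simp
  ultimately show ?thesis by (rule Lim_transform_eventually)
qed

lemma rosenblatt_const_tendsto_0: "(rosenblatt_const \<longlongrightarrow> 0) (at_left 1)"
proof -
  have "((\<lambda>H. rosenblatt_const H / (1 - H) * (1 - H)) \<longlongrightarrow> 1 / sqrt 2 * (1 - 1)) (at_left 1)"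
    by (intro tendsto_mult rosenblatt_const_asymp tendsto_intros)
  moreover have "\<forall>\<^sub>F H in at_left 1. H \<in> {1/2<..<1::real}"
    by (rule eventually_at_left_real) simp
  then have "\<forall>\<^sub>F H in at_left 1. rosenblatt_const H / (1 - H) * (1 - H) = rosenblatt_const H"
    by eventually_elim simp
  ultimately show ?thesis by (simp add: Lim_transform_eventually)
qed

section \<open>Rank-one approximation of the kernel\<close>

text \<open>Grids are indexed by naturals from left to right, hence the start at -N. The cell ]-j -
  1, -j] at distance j from the origin has index N - 1 - j; this reversal recurs in all reindexings
  below.\<close>

definition unit_grid :: "nat \<Rightarrow> nat \<Rightarrow> real" where
  "unit_grid N i = real i - real N"

lemma strict_mono_unit_grid: "strict_mono (unit_grid N)"
  by (simp add: strict_mono_Suc_iff unit_grid_def)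

lemma unit_grid_step [simp]: "unit_grid N (Suc i) - unit_grid N i = 1"
  by (simp add: unit_grid_def)

abbreviation unit_cell :: "nat \<Rightarrow> nat \<Rightarrow> real set" where
  "unit_cell N i \<equiv> {unit_grid N i<..unit_grid N (Suc i)}"

text \<open>The Wiener integral of the step function with value \<gamma> j on ]-j - 1, -j]. Counting
  from the origin makes it independent of the left end of any grid, so that sums belonging to
  different H can be compared on one grid.\<close>

definition gauss_sum :: "(real \<Rightarrow> 'a \<Rightarrow> real) \<Rightarrow> (nat \<Rightarrow> real) \<Rightarrow> nat \<Rightarrow> nat \<Rightarrow> 'a \<Rightarrow> real" where
  "gauss_sum B \<gamma> r n w = (\<Sum>j\<in>{r..<n}. \<gamma> j * (B (- real j) w - B (- real j - 1) w))"

lemma gauss_sum_grid: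
  assumes "n \<le> N"
  shows "gauss_sum B \<gamma> r n w =
    (\<Sum>i\<in>{N - n..<N - r}. \<gamma> (N - 1 - i) * (B (unit_grid N (Suc i)) w - B (unit_grid N i) w))"
  unfolding gauss_sum_def
proof (rule sum.reindex_bij_witness[of _ "\<lambda>i. N - 1 - i" "\<lambda>j. N - 1 - j"])
  fix j assume j: "j \<in> {r..<n}"
  with assms have "j < N" by simp
  then have "real (N - 1 - j) = real N - 1 - real j" by (simp add: of_nat_diff)
  moreover have "N - 1 - (N - 1 - j) = j" using \<open>j < N\<close> by simp
  ultimately show "\<gamma> (N - 1 - (N - 1 - j)) * (B (unit_grid N (Suc (N - 1 - j))) w - B (unit_grid N (N - 1 - j)) w) =
      \<gamma> j * (B (- real j) w - B (- real j - 1) w)"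
    by (simp add: unit_grid_def minus_diff_commute)
qed (use assms in auto)

lemma wiener_increments_unit_grid:
  assumes W: "wiener_process M B"
  shows "distributed M lborel (\<lambda>w. B (unit_grid N (Suc i)) w - B (unit_grid N i) w) std_normal_density"
    and "prob_space.indep_vars M (\<lambda>_. borel) (\<lambda>i w. B (unit_grid N (Suc i)) w - B (unit_grid N i) w) {..<m}"
proof -
  have "unit_grid N i < unit_grid N (Suc i)" by (simp add: unit_grid_def)
  then have "distributed M lborel (\<lambda>w. B (unit_grid N (Suc i)) w - B (unit_grid N i) w)
      (normal_density 0 (sqrt (unit_grid N (Suc i) - unit_grid N i)))"
    using W unfolding wiener_process_def by blast
  then show "distributed M lborel (\<lambda>w. B (unit_grid N (Suc i)) w - B (unit_grid N i) w) std_normal_density"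
    by simp
  show "prob_space.indep_vars M (\<lambda>_. borel) (\<lambda>i w. B (unit_grid N (Suc i)) w - B (unit_grid N i) w) {..<m}"
    using W strict_mono_unit_grid unfolding wiener_process_def by blast
qed

lemma gauss_sum_distributed:
  assumes W: "wiener_process M B" and rn: "r < n"
    and \<gamma>: "\<And>j. 0 < \<gamma> j" "(\<Sum>j\<in>{r..<n}. (\<gamma> j)^2) = 1"
  shows "distributed M lborel (gauss_sum B \<gamma> r n) std_normal_density"
proof -
  interpret prob_space M using W by (simp add: wiener_process_def)
  define d where "d i w = B (unit_grid n (Suc i)) w - B (unit_grid n i) w" for i w
  have ind: "indep_vars (\<lambda>_. borel) (\<lambda>i w. \<gamma> (n - 1 - i) * d i w) {0..<n - r}"
    by (rule indep_vars_compose2[OF indep_vars_subset[OF wiener_increments_unit_grid(2)[OF W, of n "n - r"]], folded d_def]) auto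
  have D: "distributed M lborel (\<lambda>w. \<gamma> (n - 1 - i) * d i w) (normal_density 0 (\<gamma> (n - 1 - i)))" for i
  proof -
    have "distributed M lborel (d i) (normal_density 0 1)"
      using wiener_increments_unit_grid(1)[OF W] by (simp add: d_def[abs_def])
    from normal_density_affine[OF this, of "\<gamma> (n - 1 - i)" 0] show ?thesis
      using \<gamma>(1)[of "n - 1 - i"] by simp
  qed
  have "distributed M lborel (\<lambda>w. \<Sum>i\<in>{0..<n - r}. \<gamma> (n - 1 - i) * d i w)
      (normal_density (\<Sum>i\<in>{0..<n - r}. 0) (sqrt (\<Sum>i\<in>{0..<n - r}. (\<gamma> (n - 1 - i))^2)))"
    by (rule sum_indep_normal[OF _ _ ind \<gamma>(1) D]) (use rn in auto)
  moreover have "(\<Sum>i\<in>{0..<n - r}. (\<gamma> (n - 1 - i))^2) = (\<Sum>j\<in>{r..<n}. (\<gamma> j)^2)"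
    by (rule sum.reindex_bij_witness[of _ "\<lambda>i. n - 1 - i" "\<lambda>j. n - 1 - j"]) auto
  moreover have "gauss_sum B \<gamma> r n = (\<lambda>w. \<Sum>i\<in>{0..<n - r}. \<gamma> (n - 1 - i) * d i w)"
    by (simp add: fun_eq_iff gauss_sum_grid[of n n] d_def)
  ultimately show ?thesis using \<gamma>(2) by simp
qed

text \<open>On the longer of the two grids the sums use disjoint blocks of increments.\<close>

lemma gauss_sum_indep:
  assumes W: "wiener_process M B" and "n \<le> r'" "r' \<le> n'"
  shows "prob_space.indep_var M borel (gauss_sum B \<gamma> r n) borel (gauss_sum B \<gamma>' r' n')"
proof -
  interpret prob_space M using W by (simp add: wiener_process_def)
  define d where "d i w = B (unit_grid n' (Suc i)) w - B (unit_grid n' i) w" for i w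
  let ?A = "{n' - n..<n' - r}" and ?A' = "{n' - n'..<n' - r'}"
  have "indep_vars (\<lambda>_. borel) d {..<n'}"
    unfolding d_def by (rule wiener_increments_unit_grid(2)[OF W])
  then have "indep_var (PiM ?A (\<lambda>_. borel)) (\<lambda>w. \<lambda>i\<in>?A. d i w) (PiM ?A' (\<lambda>_. borel)) (\<lambda>w. \<lambda>i\<in>?A'. d i w)"
    by (rule indep_var_restrict) (use assms in auto)
  from indep_var_compose[OF this, of "\<lambda>x. \<Sum>i\<in>?A. \<gamma> (n' - 1 - i) * x i" borel "\<lambda>x. \<Sum>i\<in>?A'. \<gamma>' (n' - 1 - i) * x i" borel]
  have "indep_var borel (\<lambda>w. \<Sum>i\<in>?A. \<gamma> (n' - 1 - i) * d i w) borel (\<lambda>w. \<Sum>i\<in>?A'. \<gamma>' (n' - 1 - i) * d i w)"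
    by (simp add: comp_def)
  moreover have "gauss_sum B \<gamma> r n = (\<lambda>w. \<Sum>i\<in>?A. \<gamma> (n' - 1 - i) * d i w)"
    using assms by (simp add: fun_eq_iff gauss_sum_grid[of n n'] d_def)
  moreover have "gauss_sum B \<gamma>' r' n' = (\<lambda>w. \<Sum>i\<in>?A'. \<gamma>' (n' - 1 - i) * d i w)"
    using assms by (simp add: fun_eq_iff gauss_sum_grid[of n' n'] d_def)
  ultimately show ?thesis by simp
qed

lemma std_normal_square_deviation:
  fixes M :: "'a measure"
  assumes "prob_space M" and D: "distributed M lborel X std_normal_density"
  shows "integrable M (\<lambda>w. ((X w)^2 - 1)^2)" "(LINT w|M. ((X w)^2 - 1)^2) = 2"
    "integrable M (\<lambda>w. (X w)^2)" "(LINT w|M. (X w)^2 - 1) = 0"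
proof -
  interpret prob_space M by fact
  have i2: "integrable M (\<lambda>w. (X w)^2)" and i4: "integrable M (\<lambda>w. (X w)^4)"
    using distributed_integrable[OF D, of "\<lambda>x. x^2"] distributed_integrable[OF D, of "\<lambda>x. x^4"]
      integrable_std_normal_moment[of 2] integrable_std_normal_moment[of 4] by simp_all
  have e2: "(LINT w|M. (X w)^2) = 1" and e4: "(LINT w|M. (X w)^4) = 3"
    using distributed_integral[OF D, of "\<lambda>x. x^2"] distributed_integral[OF D, of "\<lambda>x. x^4"]
      integral_std_normal_moment_even[of 1] integral_std_normal_moment_even[of 2]
    by (simp_all add: fact_numeral)
  have eq: "((X w)^2 - 1)^2 = (X w)^4 - 2 * (X w)^2 + 1" for w
    by (simp add: power2_diff flip: power_mult)
  show "integrable M (\<lambda>w. ((X w)^2 - 1)^2)" "(LINT w|M. ((X w)^2 - 1)^2) = 2"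
    "integrable M (\<lambda>w. (X w)^2)" "(LINT w|M. (X w)^2 - 1) = 0"
    unfolding eq using i2 i4 by (simp_all add: e2 e4 prob_space)
qed

text \<open>The off-diagonal double sum differs from \<open>X\<^sup>2 - 1\<close> only by the fluctuation of the
  quadratic variation on the diagonal.\<close>

lemma gauss_sum_offdiag_deviation:
  assumes W: "wiener_process M B" and rn: "r < n"
    and \<gamma>: "(\<Sum>j\<in>{r..<n}. (\<gamma> j)^2) = 1" and small: "\<And>j. (\<gamma> j)^2 \<le> e"
  shows "(sqnorm M (\<lambda>w. offdiag_step_integral B (n - r) (unit_grid n) (\<lambda>i j. c * (\<gamma> (n - 1 - i) * \<gamma> (n - 1 - j))) w
      - c * ((gauss_sum B \<gamma> r n w)^2 - 1))) \<le> ennreal (2 * c^2 * e)"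
proof -
  interpret prob_space M using W by (simp add: wiener_process_def)
  define p where "p = n - r"
  define g where "g i = \<gamma> (n - 1 - i)" for i
  define d where "d i w = B (unit_grid n (Suc i)) w - B (unit_grid n i) w" for i w
  have D: "distributed M lborel (d i) std_normal_density" for i
    using wiener_increments_unit_grid(1)[OF W] by (simp add: d_def[abs_def])
  have g2: "(\<Sum>i<p. (g i)^2) = 1"
    unfolding \<gamma>[symmetric] p_def g_def
    by (rule sum.reindex_bij_witness[of _ "\<lambda>i. n - 1 - i" "\<lambda>j. n - 1 - j"]) auto
  have X: "gauss_sum B \<gamma> r n w = (\<Sum>i<p. g i * d i w)" for w
    by (simp add: gauss_sum_grid[of n n] d_def g_def p_def atLeast0LessThan)
  \<comment> \<open>The constant 1 is written as the sum of \<open>(g i)^2\<close>, which pairs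
    every square on the diagonal with its own mean.\<close>
  have Q: "offdiag_step_integral B p (unit_grid n) (\<lambda>i j. c * (g i * g j)) w - c * ((gauss_sum B \<gamma> r n w)^2 - 1)
      = (\<Sum>i<p. (- c * (g i)^2) * ((d i w)^2 - 1))" for w
  proof -
    have row: "(\<Sum>j<p. F i j) = (\<Sum>j\<in>{..<p} - {i}. F i j) + F i i" if "i < p" for i and F :: "nat \<Rightarrow> nat \<Rightarrow> real"
      using that by (subst sum.remove[of _ i]) auto
    have "(gauss_sum B \<gamma> r n w)^2 = (\<Sum>i<p. \<Sum>j<p. (g i * d i w) * (g j * d j w))"
      by (simp add: X power2_eq_square sum_product)
    also have "\<dots> = (\<Sum>i<p. (\<Sum>j\<in>{..<p} - {i}. (g i * d i w) * (g j * d j w)) + (g i * d i w) * (g i * d i w))"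
      by (intro sum.cong refl row) simp
    finally have X2: "(gauss_sum B \<gamma> r n w)^2 = \<dots>" .
    have "offdiag_step_integral B p (unit_grid n) (\<lambda>i j. c * (g i * g j)) w =
        c * (\<Sum>i<p. (\<Sum>j\<in>{..<p} - {i}. (g i * d i w) * (g j * d j w)))"
      unfolding offdiag_step_integral_def d_def sum_distrib_left by (simp add: mult_ac)
    then have "offdiag_step_integral B p (unit_grid n) (\<lambda>i j. c * (g i * g j)) w - c * ((gauss_sum B \<gamma> r n w)^2 - 1)
       = c * (\<Sum>i<p. (g i)^2) - c * (\<Sum>i<p. (g i * d i w) * (g i * d i w))"
      unfolding X2 sum.distrib by (simp add: algebra_simps g2)
    also have "\<dots> = (\<Sum>i<p. (- c * (g i)^2) * ((d i w)^2 - 1))"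
      unfolding sum_distrib_left sum_subtractf[symmetric]
      by (intro sum.cong refl) (simp add: power2_eq_square algebra_simps)
    finally show ?thesis .
  qed
  interpret centered_indep M "\<lambda>i w. (d i w)^2 - 1" p "\<lambda>_. 2"
  proof
    have "indep_vars (\<lambda>_. borel) d {..<p}"
      unfolding d_def by (rule wiener_increments_unit_grid(2)[OF W])
    from indep_vars_compose2[OF this, of "\<lambda>_ x. x^2 - 1" "\<lambda>_. borel"]
    show "indep_vars (\<lambda>_. borel) (\<lambda>i w. (d i w)^2 - 1) {..<p}" by simp
  qed (use std_normal_square_deviation[OF prob_space_axioms D] in simp_all)
  note lin = linear_second_moment[OF order_refl, of "\<lambda>i. - c * (g i)^2"]
  have "(sqnorm M (\<lambda>w. offdiag_step_integral B p (unit_grid n) (\<lambda>i j. c * (g i * g j)) w - c * ((gauss_sum B \<gamma> r n w)^2 - 1)))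
      = ennreal (\<Sum>i<p. (- c * (g i)^2)^2 * 2)"
    unfolding Q using lin by (subst nn_integral_eq_integral) auto
  \<comment> \<open>Fourth powers of the coefficients are at most e times their squares, and the
    squares sum to 1.\<close>
  also have "\<dots> \<le> ennreal (\<Sum>i<p. 2 * c^2 * e * (g i)^2)"
  proof (intro ennreal_leI sum_mono)
    fix i
    have "(g i)^2 * (g i)^2 \<le> e * (g i)^2" by (rule mult_right_mono) (simp_all add: g_def small)
    then have "2 * c^2 * ((g i)^2 * (g i)^2) \<le> 2 * c^2 * (e * (g i)^2)" by (intro mult_left_mono) auto
    then show "(- c * (g i)^2)^2 * 2 \<le> 2 * c^2 * e * (g i)^2"
      by (simp add: power2_eq_square algebra_simps)
  qed
  also have "(\<Sum>i<p. 2 * c^2 * e * (g i)^2) = 2 * c^2 * e"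
    by (simp add: g2 flip: sum_distrib_left)
  finally show ?thesis by (simp add: p_def g_def)
qed

section \<open>Mean-square distance to a rank-one step kernel\<close>

lemma integral_offdiag_step:
  "integrable lborel (offdiag_step p (unit_grid N) a)"
  "(LINT q|lborel. offdiag_step p (unit_grid N) a q) = (\<Sum>i<p. \<Sum>j\<in>{..<p} - {i}. a i j)"
proof -
  let ?C = "\<lambda>i. unit_cell N i"
  have em: "emeasure lborel (?C i \<times> ?C j) = 1" for i j
    unfolding lborel_prod[symmetric]
    by (subst lborel.emeasure_pair_measure_Times) (auto simp: unit_grid_def)
  have sets: "?C i \<times> ?C j \<in> sets lborel" for i j
    by (auto intro!: borel_Times)
  have eq: "offdiag_step p (unit_grid N) a = (\<lambda>q. \<Sum>i<p. \<Sum>j\<in>{..<p} - {i}. a i j * indicator (?C i \<times> ?C j) q)"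
    by (auto simp: offdiag_step_def indicator_times mult.assoc)
  have "has_bochner_integral lborel (\<lambda>q. a i j * indicator (?C i \<times> ?C j) q) (a i j)" for i j
    using has_bochner_integral_mult_right[OF has_bochner_integral_real_indicator[OF sets[of i j]], of "a i j"] em[of i j]
    by (simp only: measure_def) simp
  then have "has_bochner_integral lborel (offdiag_step p (unit_grid N) a) (\<Sum>i<p. \<Sum>j\<in>{..<p} - {i}. a i j)"
    unfolding eq by (intro has_bochner_integral_sum)
  then show "integrable lborel (offdiag_step p (unit_grid N) a)"
    "(LINT q|lborel. offdiag_step p (unit_grid N) a q) = (\<Sum>i<p. \<Sum>j\<in>{..<p} - {i}. a i j)"
    by (auto simp: has_bochner_integral_iff)
qed

lemma nn_integral_offdiag_step_square_le:
  "(sqnorm lborel (\<lambda>q. offdiag_step p (unit_grid N) (\<lambda>i j. g i * g j) q)) \<le> ennreal ((\<Sum>i<p. (g i)^2)^2)"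
proof -
  define c where "c k l = (if k = l then 0 else g k * g l)" for k l
  have "offdiag_step p (unit_grid N) (\<lambda>i j. g i * g j) (x, y) =
    (\<Sum>k<p. \<Sum>l<p. c k l * indicator (unit_cell N k) x * indicator (unit_cell N l) y)" for x y
    unfolding offdiag_step_def split c_def
    by (intro sum.cong refl sum.mono_neutral_cong_left) auto
  from nn_integral_cell_square[OF strict_mono_unit_grid this]
  have "(sqnorm lborel (\<lambda>q. offdiag_step p (unit_grid N) (\<lambda>i j. g i * g j) q)) =
      ennreal (\<Sum>k<p. \<Sum>l<p. (c k l)^2)" by simp
  also have "\<dots> \<le> ennreal (\<Sum>k<p. \<Sum>l<p. (g k)^2 * (g l)^2)"
    by (intro ennreal_leI sum_mono) (auto simp: c_def power_mult_distrib)
  also have "(\<Sum>k<p. \<Sum>l<p. (g k)^2 * (g l)^2) = (\<Sum>i<p. (g i)^2)^2"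
    by (simp add: power2_eq_square sum_product)
  finally show ?thesis .
qed

text \<open>Expanding the square, only a lower bound for the inner product of the kernel with the step
  function is needed.\<close>

lemma rank_one_approximation:
  fixes K :: "real \<times> real \<Rightarrow> real" and w :: "nat \<Rightarrow> real"
  assumes mK [measurable]: "K \<in> borel_measurable borel"
    and K2: "(sqnorm lborel (\<lambda>q. K q)) \<le> ennreal k" and k: "0 \<le> k"
    and w: "\<And>i. i < p \<Longrightarrow> 0 < w i" "\<And>i. i < p \<Longrightarrow> w i \<le> 1" and p: "0 < p"
    and lower: "\<And>i j x y. i < p \<Longrightarrow> j < p \<Longrightarrow> x \<in> unit_cell N i \<Longrightarrow>
      y \<in> unit_cell N j \<Longrightarrow> m * (w i * w j) \<le> K (x, y)"
    and m: "0 \<le> m" and a: "0 \<le> a"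
  defines "S \<equiv> \<Sum>i<p. (w i)^2"
  shows "(sqnorm lborel (\<lambda>q. offdiag_step p (unit_grid N) (\<lambda>i j. a * (w i / sqrt S * (w j / sqrt S))) q - K q))
    \<le> ennreal (k - 2 * a * (m * (S - 1)) + a^2)"
proof -
  define g where "g i = w i / sqrt S" for i
  define h where "h = offdiag_step p (unit_grid N) (\<lambda>i j. g i * g j)"
  have S: "0 < S" unfolding S_def using p by (intro sum_pos zero_less_power w(1)) auto
  have g0: "0 \<le> g i" if "i < p" for i using w(1)[OF that] S by (simp add: g_def)
  have g2: "(\<Sum>i<p. (g i)^2) = 1"
    using S by (simp add: g_def power_divide S_def flip: sum_divide_distrib)
  have mh [measurable]: "h \<in> borel_measurable borel" unfolding h_def by simp
  have ah: "offdiag_step p (unit_grid N) (\<lambda>i j. a * (w i / sqrt S * (w j / sqrt S))) q = a * h q" for q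
    by (cases q) (simp add: h_def g_def offdiag_step_def sum_distrib_left mult.assoc)
  have h2: "(sqnorm lborel (\<lambda>q. h q)) \<le> ennreal 1"
    using nn_integral_offdiag_step_square_le[of p N g] by (simp add: g2 h_def)
  have ih2: "integrable lborel (\<lambda>q. (h q)^2)"
    by (rule integrableI_nonneg) (use h2 in \<open>auto intro: le_less_trans\<close>)
  have iK2: "integrable lborel (\<lambda>q. (K q)^2)"
    by (rule integrableI_nonneg) (use K2 in \<open>auto intro: le_less_trans\<close>)
  have iKh: "integrable lborel (\<lambda>q. K q * h q)"
    by (rule integrable_mult_square) (use iK2 ih2 in auto)
  have eh: "(LINT q|lborel. (h q)^2) \<le> 1"
    using h2 by (subst (asm) nn_integral_eq_integral[OF ih2]) auto
  have eK: "(LINT q|lborel. (K q)^2) \<le> k"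
    using K2 k by (subst (asm) nn_integral_eq_integral[OF iK2]) auto
  \<comment> \<open>A step minorant of \<open>K * h\<close>: on each block the lower bound for K
    times the nonnegative value of h. Its integral is a finite sum.\<close>
  let ?l = "offdiag_step p (unit_grid N) (\<lambda>i j. g i * g j * (m * (w i * w j)))"
  have "?l q \<le> K q * h q" for q
  proof -
    obtain x y where q: "q = (x, y)" by (cases q)
    have "?l q = (\<Sum>i<p. \<Sum>j\<in>{..<p} - {i}. (m * (w i * w j)) * (g i * g j *
        (indicator (unit_cell N i) x * indicator (unit_cell N j) y)))"
      by (simp add: q offdiag_step_def mult_ac)
    also have "\<dots> \<le> (\<Sum>i<p. \<Sum>j\<in>{..<p} - {i}. K (x, y) * (g i * g j *
        (indicator (unit_cell N i) x * indicator (unit_cell N j) y)))"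
    proof (intro sum_mono)
      fix i j assume "i \<in> {..<p}" "j \<in> {..<p} - {i}"
      then have ij: "i < p" "j < p" by auto
      show "(m * (w i * w j)) * (g i * g j * (indicator (unit_cell N i) x * indicator (unit_cell N j) y))
        \<le> K (x, y) * (g i * g j * (indicator (unit_cell N i) x * indicator (unit_cell N j) y))"
        using lower[OF ij, of x y] g0[OF ij(1)] g0[OF ij(2)]
        by (auto intro!: mult_right_mono split: split_indicator)
    qed
    also have "\<dots> = K q * h q"
      by (simp add: q h_def offdiag_step_def sum_distrib_left mult_ac)
    finally show ?thesis .
  qed
  then have "(LINT q|lborel. ?l q) \<le> (LINT q|lborel. K q * h q)"
    by (intro integral_mono integral_offdiag_step iKh)
  moreover have "m * (S - 1) \<le> (LINT q|lborel. ?l q)"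
  proof -
    have "(\<Sum>i<p. \<Sum>j\<in>{..<p} - {i}. (w i)^2 * (w j)^2) = (\<Sum>i<p. (w i)^2 * S - (w i)^2 * (w i)^2)"
      by (intro sum.cong refl) (simp add: S_def sum_diff1 sum_distrib_left right_diff_distrib flip: sum_distrib_left)
    \<comment> \<open>Because \<open>w i \<le> 1\<close>, the missing diagonal
      \<open>(w i)^4\<close> costs at most \<open>(w i)^2\<close>, in total S; this turns S * S into
      S * (S - 1).\<close>
    also have "\<dots> \<ge> (\<Sum>i<p. (w i)^2 * S - (w i)^2)"
      using w by (intro sum_mono diff_left_mono mult_left_le) (auto simp: power_le_one less_imp_le)
    also have "(\<Sum>i<p. (w i)^2 * S - (w i)^2) = S * (S - 1)"
      unfolding sum_subtractf sum_distrib_right[symmetric] S_def[symmetric] by (simp add: algebra_simps)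
    finally have "m / S * (S * (S - 1)) \<le> m / S * (\<Sum>i<p. \<Sum>j\<in>{..<p} - {i}. (w i)^2 * (w j)^2)"
      using m S by (intro mult_left_mono) auto
    also have "\<dots> = (\<Sum>i<p. \<Sum>j\<in>{..<p} - {i}. g i * g j * (m * (w i * w j)))"
      unfolding sum_distrib_left using S
      by (intro sum.cong refl) (simp add: g_def power2_eq_square field_simps)
    finally show ?thesis using S by (simp add: integral_offdiag_step)
  qed
  ultimately have eKh: "m * (S - 1) \<le> (LINT q|lborel. K q * h q)" by linarith
  have sq: "(a * h q - K q)^2 = a^2 * (h q)^2 - 2 * a * (K q * h q) + (K q)^2" for q
    by (simp add: power2_eq_square algebra_simps)
  have "(sqnorm lborel (\<lambda>q. a * h q - K q)) = ennreal (LINT q|lborel. (a * h q - K q)^2)"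
  proof (rule nn_integral_eq_integral)
    show "integrable lborel (\<lambda>q. (a * h q - K q)^2)" unfolding sq using iK2 ih2 iKh by simp
  qed simp
  also have "(LINT q|lborel. (a * h q - K q)^2) =
      a^2 * (LINT q|lborel. (h q)^2) - 2 * a * (LINT q|lborel. K q * h q) + (LINT q|lborel. (K q)^2)"
    unfolding sq using iK2 ih2 iKh by simp
  also have "ennreal \<dots> \<le> ennreal (k - 2 * a * (m * (S - 1)) + a^2)"
    using mult_left_mono[OF eh, of "a^2"] mult_left_mono[OF eKh, of "2 * a"] eK a
    by (intro ennreal_leI) simp
  finally show ?thesis unfolding ah .
qed

text \<open>T + j + 1 is the largest distance from a point of [0, T] to the cell ]-j - 1, -j], so
  with a negative exponent the weight bounds the kernel factor from below on the whole cell. It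
  involves T but not t, so that one Gaussian serves all times at once.\<close>

definition kernel_weight :: "real \<Rightarrow> real \<Rightarrow> nat \<Rightarrow> real" where
  "kernel_weight T H j = (T + real j + 1) powr (H / 2 - 1)"

text \<open>The cells carrying the approximating Gaussian range from \<open>1 / (1 - H)\<close> to beyond
  \<open>exp (1 / (1 - H)\<^sup>2)\<close>: the kernel mass \<open>\<integral> z powr (H - 2) dz\<close> outside this range is
  asymptotically negligible.\<close>

definition cell_low :: "real \<Rightarrow> nat" where
  "cell_low H = nat \<lceil>1 / (1 - H)\<rceil>"

definition cell_high :: "real \<Rightarrow> nat" where
  "cell_high H = cell_low H + nat \<lceil>exp (1 / (1 - H)^2)\<rceil> + 1"

definition weight_sum :: "real \<Rightarrow> real \<Rightarrow> real" where
  "weight_sum T H = (\<Sum>j\<in>{cell_low H..<cell_high H}. (kernel_weight T H j)^2)"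

definition limit_gauss :: "(real \<Rightarrow> 'a \<Rightarrow> real) \<Rightarrow> real \<Rightarrow> real \<Rightarrow> 'a \<Rightarrow> real" where
  "limit_gauss B T H = gauss_sum B (\<lambda>j. kernel_weight T H j / sqrt (weight_sum T H)) (cell_low H) (cell_high H)"

text \<open>With b = 1 - H, the first term is the mass remaining after about 1 / b cells, and it
  tends to 1 because \<open>(1 / b) powr (- b)\<close> does. The second is the mass beyond
  \<open>exp (1 / b^2)\<close>, since \<open>exp (1 / b^2) powr (- b)\<close> equals
  \<open>exp (- 1 / b)\<close>.\<close>

definition weight_bound :: "real \<Rightarrow> real \<Rightarrow> real" where
  "weight_bound T b = (T + 2 + 1 / b) powr (- b) - exp (- 1 / b)"

lemma kernel_weight_pos: "0 \<le> T \<Longrightarrow> 0 < kernel_weight T H j"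
  by (simp add: kernel_weight_def)

lemma kernel_weight_le_1:
  assumes "0 \<le> T" "H < 1"
  shows "kernel_weight T H j \<le> 1"
  unfolding kernel_weight_def using powr_mono2'[of "H / 2 - 1" 1 "T + real j + 1"] assms by simp

lemma cell_low_pos: "H < 1 \<Longrightarrow> 1 \<le> cell_low H"
proof -
  assume "H < 1"
  then have "0 < \<lceil>1 / (1 - H)\<rceil>" by simp
  then show ?thesis unfolding cell_low_def by linarith
qed

lemma cell_low_less_high: "cell_low H < cell_high H"
  by (simp add: cell_high_def)

lemma weight_sum_pos: "0 \<le> T \<Longrightarrow> 0 < weight_sum T H"
  unfolding weight_sum_def using cell_low_less_high[of H] kernel_weight_pos[of T H]
  by (intro sum_pos zero_less_power) auto

lemma powr_diff_le:
  fixes z b :: real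
  assumes "0 < z" "0 < b"
  shows "z powr (- b) - (z + 1) powr (- b) \<le> b * z powr (- b - 1)"
proof -
  have "\<exists>x. z < x \<and> x < z + 1 \<and> (z + 1) powr (- b) - z powr (- b) = (z + 1 - z) * (- b * x powr (- b - 1))"
    by (rule MVT2, simp, rule has_real_derivative_powr) (use assms in linarith)
  then obtain x where x: "z < x" "(z + 1) powr (- b) - z powr (- b) = - (b * x powr (- b - 1))" by auto
  have "b * x powr (- b - 1) \<le> b * z powr (- b - 1)"
    using x assms by (intro mult_left_mono powr_mono2') auto
  then show ?thesis using x(2) by linarith
qed

text \<open>With z = T + j + 1, the squared weight is \<open>z powr (- b - 1)\<close>, and b times
  it dominates the decrease of \<open>z powr (- b)\<close> from z to z + 1; the sum of these
  decreases telescopes.\<close>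

lemma weight_sum_ge:
  assumes T: "0 \<le> T" and H: "H < 1"
  shows "weight_bound T (1 - H) \<le> (1 - H) * weight_sum T H"
proof -
  define b where "b = 1 - H"
  have b: "0 < b" using H by (simp add: b_def)
  let ?r = "cell_low H" and ?n = "cell_high H"
  let ?F = "\<lambda>j. - ((T + real j + 1) powr (- b))"
  have "?F ?n - ?F ?r = (\<Sum>j = ?r..<?n. ?F (Suc j) - ?F j)"
    using sum_Suc_diff'[of ?r ?n ?F] cell_low_less_high[of H] by simp
  also have "\<dots> \<le> (\<Sum>j = ?r..<?n. b * (kernel_weight T H j)^2)"
  proof (rule sum_mono)
    fix j
    have e: "- b - 1 = H / 2 - 1 + (H / 2 - 1)" by (simp add: b_def)
    have "(kernel_weight T H j)^2 = (T + real j + 1) powr (- b - 1)"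
      unfolding kernel_weight_def power2_eq_square e powr_add ..
    then show "?F (Suc j) - ?F j \<le> b * (kernel_weight T H j)^2"
      using powr_diff_le[of "T + real j + 1" b] T b by (simp add: add_ac)
  qed
  also have "\<dots> = b * weight_sum T H"
    by (simp add: weight_sum_def sum_distrib_left)
  finally have 1: "?F ?n - ?F ?r \<le> b * weight_sum T H" .
  have "real ?r \<le> 1 / b + 1"
  proof -
    have "0 < 1 / b" using b by simp
    then show ?thesis unfolding cell_low_def b_def[symmetric] by linarith
  qed
  then have "(T + 2 + 1 / b) powr (- b) \<le> (T + real ?r + 1) powr (- b)"
    using T b by (intro powr_mono2') auto
  moreover have "(T + real ?n + 1) powr (- b) \<le> exp (1 / b^2) powr (- b)"
  proof (intro powr_mono2')
    have "exp (1 / b^2) \<le> real (nat \<lceil>exp (1 / b^2)\<rceil>)" by linarith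
    then show "exp (1 / b^2) \<le> T + real ?n + 1"
      using T unfolding cell_high_def b_def[symmetric] of_nat_add by linarith
  qed (use b in auto)
  moreover have "exp (1 / b^2) powr (- b) = exp (- 1 / b)"
    using b by (simp add: powr_def power2_eq_square)
  ultimately show ?thesis using 1 by (simp add: weight_bound_def b_def)
qed

lemma weight_bound_tendsto: "((\<lambda>H. weight_bound T (1 - H)) \<longlongrightarrow> 1) (at_left 1)"
proof -
  have "(weight_bound T \<longlongrightarrow> 1) (at_right 0)"
    unfolding weight_bound_def by real_asymp
  moreover have "filterlim (\<lambda>H::real. 1 - H) (at_right 0) (at_left 1)"
    by real_asymp
  ultimately show ?thesis by (rule filterlim_compose)
qed

section \<open>Kernels of the exponential integrands\<close>

definition exp_integrand :: "real \<Rightarrow> real \<Rightarrow> real \<Rightarrow> real" where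
  "exp_integrand lam t u = indicator {0..t} u * exp (lam * u)"

definition exp_primitive :: "real \<Rightarrow> real \<Rightarrow> real" where
  "exp_primitive lam t = (exp (lam * t) - 1) / lam"

lemma borel_measurable_exp_integrand [measurable]: "exp_integrand lam t \<in> borel_measurable borel"
  unfolding exp_integrand_def by measurable

lemma has_bochner_integral_exp_integrand:
  assumes "0 < lam" "0 \<le> t"
  shows "has_bochner_integral lborel (exp_integrand lam t) (exp_primitive lam t)"
proof -
  have "has_bochner_integral lborel (\<lambda>u. exp (lam * u) * indicator {0..t} u) (exp (lam * t) / lam - exp (lam * 0) / lam)"
    by (rule has_bochner_integral_FTC_Icc_real)
       (use assms in \<open>auto intro!: derivative_eq_intros\<close>)
  then show ?thesis
    by (simp add: exp_integrand_def[abs_def] exp_primitive_def diff_divide_distrib mult.commute)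
qed

lemma exp_primitive_nonneg: "0 < lam \<Longrightarrow> 0 \<le> t \<Longrightarrow> 0 \<le> exp_primitive lam t"
  by (simp add: exp_primitive_def)

lemma exp_integrand_bounds:
  assumes "0 < lam" "0 \<le> s" "s \<le> t" "t \<le> T"
  shows "0 \<le> exp_integrand lam s u" "exp_integrand lam s u \<le> exp_integrand lam t u"
    "exp_integrand lam t u \<le> exp (lam * T)"
  using assms by (auto simp: exp_integrand_def indicator_def)

lemma J_kernel_exp_lower:
  assumes H: "1/2 < H" "H < 1" and lam: "0 < lam" and t: "0 \<le> t" "t \<le> T"
    and i: "i < cell_high H - cell_low H" "x \<in> unit_cell (cell_high H) i"
    and j: "j < cell_high H - cell_low H" "y \<in> unit_cell (cell_high H) j"
  shows "rosenblatt_const H * exp_primitive lam t *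
      (kernel_weight T H (cell_high H - 1 - i) * kernel_weight T H (cell_high H - 1 - j))
    \<le> J_kernel H (exp_integrand lam t) (x, y)"
proof -
  let ?n = "cell_high H"
  have bounds: "kernel_weight T H (?n - 1 - i) \<le> pos_powr H u x \<and> pos_powr H u x \<le> 1"
    if i: "i < ?n - cell_low H" "x \<in> unit_cell ?n i" and u: "u \<in> {0..t}" for i x u
  proof -
    have e: "real (?n - 1 - i) = real ?n - 1 - real i" using i(1) by (simp add: of_nat_diff)
    have x: "real i - real ?n < x" "x \<le> real i + 1 - real ?n" using i(2) by (auto simp: unit_grid_def)
    have "real i + real (cell_low H) + 1 \<le> real ?n" using i(1) by linarith
    \<comment> \<open>\<open>cell_low H \<ge> 1\<close> keeps the chosen cells at distance at least
      1 from [0, T], away from the singularity; there the factors are at most 1 and the product is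
      integrable.\<close>
    then have "1 \<le> u - x" using x u cell_low_pos[OF H(2)] by simp
    moreover have "u - x \<le> T + real (?n - 1 - i) + 1" using x u t unfolding e by simp
    ultimately show ?thesis
      using H powr_mono2'[of "H / 2 - 1" 1 "u - x"] powr_mono2'[of "H / 2 - 1" "u - x" "T + real (?n - 1 - i) + 1"]
      by (simp add: pos_powr_def kernel_weight_def)
  qed
  let ?f = "exp_integrand lam t"
  have hb: "integrable lborel ?f" "(LINT u|lborel. ?f u) = exp_primitive lam t"
    using has_bochner_integral_exp_integrand[OF lam t(1)] by (auto simp: has_bochner_integral_iff)
  have f0: "0 \<le> ?f u" for u by (simp add: exp_integrand_def)
  have fz: "?f u = 0" if "u \<notin> {0..t}" for u using that by (simp add: exp_integrand_def)
  let ?w = "kernel_weight T H (?n - 1 - i) * kernel_weight T H (?n - 1 - j)"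
  have T: "0 \<le> T" using t by simp
  have w0: "0 < kernel_weight T H k" for k by (rule kernel_weight_pos[OF T])
  have int: "integrable lborel (\<lambda>u. ?f u * (pos_powr H u x * pos_powr H u y))"
  proof (rule Bochner_Integration.integrable_bound[OF hb(1)])
    show "AE u in lborel. norm (?f u * (pos_powr H u x * pos_powr H u y)) \<le> norm (?f u)"
    proof (rule AE_I2)
      fix u
      show "norm (?f u * (pos_powr H u x * pos_powr H u y)) \<le> norm (?f u)"
      proof (cases "u \<in> {0..t}")
        case True
        then have "pos_powr H u x * pos_powr H u y \<le> 1"
          using bounds[OF i True] bounds[OF j True] by (intro mult_le_one) auto
        then show ?thesis using f0[of u] by (simp add: abs_mult mult_left_le)
      qed (simp add: fz)
    qed
  qed simp
  have "(LINT u|lborel. ?f u * ?w) \<le> (LINT u|lborel. ?f u * (pos_powr H u x * pos_powr H u y))"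
  proof (rule integral_mono[OF _ int])
    show "integrable lborel (\<lambda>u. ?f u * ?w)" using hb(1) by simp
    fix u
    show "?f u * ?w \<le> ?f u * (pos_powr H u x * pos_powr H u y)"
    proof (cases "u \<in> {0..t}")
      case True
      then show ?thesis
        using bounds[OF i True] bounds[OF j True] w0 f0 by (intro mult_left_mono mult_mono) (auto simp: less_imp_le)
    qed (simp add: fz)
  qed
  moreover have "(LINT u|lborel. ?f u * ?w) = exp_primitive lam t * ?w"
    using hb by simp
  ultimately have "rosenblatt_const H * (exp_primitive lam t * ?w) \<le>
      rosenblatt_const H * (LINT u|lborel. ?f u * (pos_powr H u x * pos_powr H u y))"
    using H by (intro mult_left_mono rosenblatt_const_nonneg) auto
  then show ?thesis
    by (simp add: J_kernel_def pos_powr_def mult.assoc)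
qed

text \<open>The expanded square \<open>k - 2 * a * (m * (S - 1)) + a^2\<close> of the rank-one
  approximation with a = F / sqrt 2 and m = \<open>rosenblatt_const H * F\<close>, where F is
  \<open>exp_primitive lam t\<close> and S is replaced through \<open>weight_bound\<close>. Its
  terms tend to F^2 / 2, - F^2 and F^2 / 2, so the limit 0 depends on exact leading constants in
  both bounds.\<close>

definition approx_error :: "real \<Rightarrow> real \<Rightarrow> real \<Rightarrow> real \<Rightarrow> real" where
  "approx_error lam T t H =
    (rosenblatt_const H * overlap_const H)^2 * ((1 - 4 * (1 - H)) * (exp_primitive lam t)^2
      + 16 * (1 - H) * (exp (lam * T))^2 * (t * sqrt t))
    - sqrt 2 * (exp_primitive lam t)^2 * (rosenblatt_const H / (1 - H) * weight_bound T (1 - H) - rosenblatt_const H)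
    + (exp_primitive lam t)^2 / 2"

lemma approx_error_tendsto: "(approx_error lam T t \<longlongrightarrow> 0) (at_left 1)"
proof -
  let ?F = "exp_primitive lam t"
  have "(approx_error lam T t \<longlongrightarrow>
      (1 / sqrt 2)^2 * ((1 - 4 * (1 - 1)) * ?F^2 + 16 * (1 - 1) * (exp (lam * T))^2 * (t * sqrt t))
      - sqrt 2 * ?F^2 * (1 / sqrt 2 * 1 - 0) + ?F^2 / 2) (at_left 1)"
    unfolding approx_error_def
    by (intro tendsto_intros rosenblatt_overlap_asymp rosenblatt_const_asymp rosenblatt_const_tendsto_0
        weight_bound_tendsto)
  then show ?thesis by (simp add: power_divide)
qed

definition offdiag_approx :: "real \<Rightarrow> real \<Rightarrow> real \<Rightarrow> nat \<Rightarrow> nat \<Rightarrow> real" where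
  "offdiag_approx T H a = (\<lambda>i j. a *
    (kernel_weight T H (cell_high H - 1 - i) / sqrt (weight_sum T H) *
     (kernel_weight T H (cell_high H - 1 - j) / sqrt (weight_sum T H))))"

lemma kernel_approximation:
  assumes H: "3/4 \<le> H" "H < 1" and lam: "0 < lam" and t: "0 \<le> t" "t \<le> T"
    and meas: "J_kernel H (exp_integrand lam t) \<in> borel_measurable borel"
  shows "(sqnorm lborel (\<lambda>q. offdiag_step (cell_high H - cell_low H) (unit_grid (cell_high H))
      (offdiag_approx T H (exp_primitive lam t / sqrt 2)) q - J_kernel H (exp_integrand lam t) q))
    \<le> ennreal (approx_error lam T t H)"
proof -
  let ?c = "rosenblatt_const H" and ?F = "exp_primitive lam t" and ?b = "1 - H"
  let ?n = "cell_high H" and ?r = "cell_low H"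
  define w where "w i = kernel_weight T H (?n - 1 - i)" for i
  define S where "S = weight_sum T H"
  define k where "k = ?c^2 * ((overlap_const H)^2 * ((1 - 4 * ?b) * ?F^2 + 16 * ?b * (exp (lam * T))^2 * (t * sqrt t)))"
  have T: "0 \<le> T" using t by simp
  have c: "0 \<le> ?c" using H by (intro rosenblatt_const_nonneg) simp
  have F: "0 \<le> ?F" using exp_primitive_nonneg lam t by simp
  have S_eq: "(\<Sum>i<?n - ?r. (w i)^2) = S"
    unfolding S_def weight_sum_def w_def
    by (rule sum.reindex_bij_witness[of _ "\<lambda>j. ?n - 1 - j" "\<lambda>i. ?n - 1 - i"]) auto
  \<comment> \<open>The zero function as second integrand turns the estimate for differences into a
    norm estimate.\<close>
  have J0: "J_kernel H (\<lambda>_. 0) = (\<lambda>_. 0)" by (auto simp: J_kernel_def)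
  have "(sqnorm lborel (\<lambda>q. J_kernel H (exp_integrand lam t) q - J_kernel H (\<lambda>_. 0) q)) \<le>
    ennreal (?c^2) * kernel_energy H (\<lambda>u. exp_integrand lam t u - 0)"
    by (rule J_kernel_diff_bound[OF H t(1), of _ _ "exp (lam * T)"])
       (use exp_integrand_bounds[OF lam, of t t T] t in \<open>auto simp: exp_integrand_def\<close>)
  also have "\<dots> \<le> ennreal (?c^2) * ennreal ((overlap_const H)^2 *
        ((1 - 4 * ?b) * (LINT u|lborel. exp_integrand lam t u)^2 + 16 * ?b * (exp (lam * T))^2 * ((t - 0) * sqrt (t - 0))))"
    unfolding diff_zero[of "exp_integrand lam t _"]
    by (intro mult_left_mono nn_integral_kernel_square_bound[OF H t(1)])
       (use exp_integrand_bounds[OF lam, of t t T] t in \<open>auto simp: exp_integrand_def\<close>)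
  also have "(LINT u|lborel. exp_integrand lam t u) = ?F"
    using has_bochner_integral_exp_integrand[OF lam t(1)] by (simp add: has_bochner_integral_iff)
  finally have K2: "(sqnorm lborel (\<lambda>q. J_kernel H (exp_integrand lam t) q)) \<le> ennreal k"
    by (simp add: J0 k_def ennreal_mult')
  have k: "0 \<le> k" unfolding k_def using H t by (intro mult_nonneg_nonneg add_nonneg_nonneg) auto
  have "(sqnorm lborel (\<lambda>q. offdiag_step (?n - ?r) (unit_grid ?n) (\<lambda>i j. (?F / sqrt 2) *
      (w i / sqrt (\<Sum>i<?n - ?r. (w i)^2) * (w j / sqrt (\<Sum>i<?n - ?r. (w i)^2)))) q - J_kernel H (exp_integrand lam t) q))
    \<le> ennreal (k - 2 * (?F / sqrt 2) * ((?c * ?F) * ((\<Sum>i<?n - ?r. (w i)^2) - 1)) + (?F / sqrt 2)^2)"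
  proof (rule rank_one_approximation[OF meas K2 k])
    show "0 < w i" for i unfolding w_def by (rule kernel_weight_pos[OF T])
    show "w i \<le> 1" for i unfolding w_def by (rule kernel_weight_le_1[OF T H(2)])
    show "?c * ?F * (w i * w j) \<le> J_kernel H (exp_integrand lam t) (x, y)"
      if "i < ?n - ?r" "j < ?n - ?r" "x \<in> unit_cell ?n i" "y \<in> unit_cell ?n j" for i j x y
      unfolding w_def using J_kernel_exp_lower[OF _ H(2) lam t] that H by simp
  qed (use c F cell_low_less_high[of H] in auto)
  also have "\<dots> \<le> ennreal (approx_error lam T t H)"
  proof (rule ennreal_leI)
    have "?c / ?b * weight_bound T ?b \<le> ?c / ?b * (?b * S)"
      unfolding S_def using weight_sum_ge[OF T H(2)] c H by (intro mult_left_mono) auto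
    also have "\<dots> = ?c * S" using H by simp
    finally have "?c / ?b * weight_bound T ?b - ?c \<le> ?c * (S - 1)" by (simp add: algebra_simps)
    then have "sqrt 2 * ?F^2 * (?c / ?b * weight_bound T ?b - ?c) \<le> sqrt 2 * ?F^2 * (?c * (S - 1))"
      by (intro mult_left_mono) auto
    moreover have "2 * (?F / sqrt 2) * ((?c * ?F) * (S - 1)) = sqrt 2 * ?F^2 * (?c * (S - 1))"
    proof -
      have "2 * (?F / sqrt 2) = sqrt 2 * ?F" by (simp add: field_simps)
      then show ?thesis by (simp add: power2_eq_square algebra_simps)
    qed
    ultimately show "k - 2 * (?F / sqrt 2) * ((?c * ?F) * ((\<Sum>i<?n - ?r. (w i)^2) - 1)) + (?F / sqrt 2)^2 \<le> approx_error lam T t H"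
      unfolding S_eq approx_error_def k_def by (simp add: power_mult_distrib power_divide algebra_simps)
  qed
  finally show ?thesis by (simp only: offdiag_approx_def S_eq flip: w_def S_def)
qed

section \<open>The approximating Gaussian and the double integrals\<close>

lemma limit_gauss_distributed:
  assumes W: "wiener_process M B" and T: "0 \<le> T"
  shows "distributed M lborel (limit_gauss B T H) std_normal_density"
  unfolding limit_gauss_def
proof (rule gauss_sum_distributed[OF W cell_low_less_high])
  show "0 < kernel_weight T H j / sqrt (weight_sum T H)" for j
    using kernel_weight_pos[OF T] weight_sum_pos[OF T] by simp
  show "(\<Sum>j = cell_low H..<cell_high H. (kernel_weight T H j / sqrt (weight_sum T H))^2) = 1"
    using weight_sum_pos[OF T, of H] by (simp add: power_divide weight_sum_def flip: sum_divide_distrib)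
qed

lemma limit_gauss_indep:
  assumes "wiener_process M B" "cell_high H \<le> cell_low H'"
  shows "prob_space.indep_var M borel (limit_gauss B T H) borel (limit_gauss B T H')"
  unfolding limit_gauss_def using assms cell_low_less_high[of H'] by (intro gauss_sum_indep) auto

lemma borel_measurable_limit_gauss:
  assumes "wiener_process M B" "0 \<le> T"
  shows "limit_gauss B T H \<in> borel_measurable M"
  using limit_gauss_distributed[OF assms] by (auto simp: distributed_def)

lemma nn_integral_limit_gauss_square:
  assumes W: "wiener_process M B" and T: "0 \<le> T"
  shows "(sqnorm M (\<lambda>w. c * ((limit_gauss B T H w)^2 - 1))) = ennreal (2 * c^2)"
proof -
  have P: "prob_space M" using W by (simp add: wiener_process_def)
  show ?thesis
    using std_normal_square_deviation(1,2)[OF P limit_gauss_distributed[OF W T, of H]]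
    by (simp add: power_mult_distrib nn_integral_eq_integral mult.commute)
qed

text \<open>Two errors are added: the distance of the kernels, with 54 = 3 * 18, and the diagonal
  fluctuation, governed by the largest squared coefficient, at most 1 /
  \<open>weight_sum T H\<close> because the weights are at most 1. The \<open>max 0\<close> mirrors
  the truncation of possibly negative reals by \<open>ennreal\<close>.\<close>

lemma double_integral_approximation:
  assumes W: "wiener_process M B" and H: "3/4 \<le> H" "H < 1" and lam: "0 < lam" and t: "0 \<le> t" "t \<le> T"
    and S: "has_double_wiener_integral M B (J_kernel H (exp_integrand lam t)) S"
  shows "(sqnorm M (\<lambda>w. S w - exp_primitive lam t / sqrt 2 * ((limit_gauss B T H w)^2 - 1)))
    \<le> ennreal (54 * max 0 (approx_error lam T t H) + 3 * (exp_primitive lam t)^2 / weight_sum T H)"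
proof -
  let ?n = "cell_high H" and ?r = "cell_low H" and ?F = "exp_primitive lam t" and ?S = "weight_sum T H"
  let ?X = "limit_gauss B T H"
  have T: "0 \<le> T" using t by simp
  have S0: "0 < ?S" by (rule weight_sum_pos[OF T])
  let ?\<gamma> = "\<lambda>j. kernel_weight T H j / sqrt ?S"
  let ?h = "offdiag_step (?n - ?r) (unit_grid ?n) (offdiag_approx T H (?F / sqrt 2))"
  let ?I = "offdiag_step_integral B (?n - ?r) (unit_grid ?n) (offdiag_approx T H (?F / sqrt 2))"
  have I: "has_double_wiener_integral M B ?h ?I"
    by (rule has_double_wiener_integral_offdiag_step[OF W strict_mono_unit_grid])
  have [measurable]: "S \<in> borel_measurable M" "?I \<in> borel_measurable M" "?X \<in> borel_measurable M"
    using S I borel_measurable_limit_gauss[OF W T] by (auto simp: has_double_wiener_integral_def)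
  have meas: "J_kernel H (exp_integrand lam t) \<in> borel_measurable borel"
    using S by (simp add: has_double_wiener_integral_def)
  have 1: "(sqnorm M (\<lambda>w. ?I w - S w)) \<le> 18 * ennreal (approx_error lam T t H)"
    by (rule order.trans[OF double_wiener_integral_diff_bound[OF W I S]])
       (intro mult_left_mono kernel_approximation[OF H lam t meas], simp)
  have 2: "(sqnorm M (\<lambda>w. ?I w - ?F / sqrt 2 * ((?X w)^2 - 1))) \<le> ennreal (2 * (?F / sqrt 2)^2 * (1 / ?S))"
    unfolding limit_gauss_def offdiag_approx_def
  proof (rule gauss_sum_offdiag_deviation[OF W cell_low_less_high])
    show "(\<Sum>j = ?r..<?n. (?\<gamma> j)^2) = 1"
      using S0 by (simp add: power_divide weight_sum_def flip: sum_divide_distrib)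
    show "(?\<gamma> j)^2 \<le> 1 / ?S" for j
      using S0 kernel_weight_le_1[OF T H(2), of j] kernel_weight_pos[OF T, of H j]
      by (simp add: power_divide divide_right_mono power_le_one)
  qed
  have "(sqnorm M (\<lambda>w. S w - ?F / sqrt 2 * ((?X w)^2 - 1))) =
     (sqnorm M (\<lambda>w. (S w - ?I w) + (?I w - ?F / sqrt 2 * ((?X w)^2 - 1)) + 0))"
    by simp
  also have "\<dots> \<le> 3 * ((sqnorm M (\<lambda>w. S w - ?I w)) +
      (sqnorm M (\<lambda>w. ?I w - ?F / sqrt 2 * ((?X w)^2 - 1))) + (\<integral>\<^sup>+w. ennreal (0^2) \<partial>M))"
    by (rule nn_integral_square_sum3) measurable
  also have "(sqnorm M (\<lambda>w. S w - ?I w)) = (sqnorm M (\<lambda>w. ?I w - S w))"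
    by (simp only: power2_commute)
  also have "3 * ((sqnorm M (\<lambda>w. ?I w - S w)) +
      (sqnorm M (\<lambda>w. ?I w - ?F / sqrt 2 * ((?X w)^2 - 1))) + (\<integral>\<^sup>+w. ennreal (0^2) \<partial>M))
     \<le> 3 * (18 * ennreal (approx_error lam T t H) + ennreal (2 * (?F / sqrt 2)^2 * (1 / ?S)) + 0)"
    by (intro mult_left_mono add_mono 1 2) simp_all
  also have "\<dots> = ennreal (54 * max 0 (approx_error lam T t H) + 3 * ?F^2 / ?S)"
  proof -
    have e: "ennreal (approx_error lam T t H) = ennreal (max 0 (approx_error lam T t H))" by (simp add: max_def ennreal_neg)
    have gen: "3 * (18 * ennreal x + ennreal y + 0) = ennreal (54 * x + 3 * y)" if "0 \<le> x" "0 \<le> y" for x y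
      using that by (simp add: ennreal_plus ennreal_mult distrib_left flip: mult.assoc)
    show ?thesis unfolding e by (subst gen) (use S0 in \<open>simp_all add: power_divide\<close>)
  qed
  finally show ?thesis .
qed

text \<open>The summand with 18 bounds the increment of the double integral, the other that of its
  rank-one approximation, and 3 comes from the three-term square inequality. Here 4 bounds 16 * (1 -
  H) for H \<ge> 3/4, and sqrt T absorbs quadratic increments into the power 3/2.\<close>

definition increment_const :: "real \<Rightarrow> real \<Rightarrow> real" where
  "increment_const lam T = 3 * (18 * ((exp (lam * T))^2 * (sqrt T + 4)) + (exp (lam * T))^2 * sqrt T)"

lemma double_integral_increment:
  assumes W: "wiener_process M B" and H: "3/4 \<le> H" "H < 1" and lam: "0 < lam" and st: "0 \<le> s" "s \<le> t" "t \<le> T"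
    and bounded: "(rosenblatt_const H * overlap_const H)^2 \<le> 1"
    and S: "has_double_wiener_integral M B (J_kernel H (exp_integrand lam t)) S"
    and S': "has_double_wiener_integral M B (J_kernel H (exp_integrand lam s)) S'"
  shows "(sqnorm M (\<lambda>w. (S w - exp_primitive lam t / sqrt 2 * ((limit_gauss B T H w)^2 - 1))
        - (S' w - exp_primitive lam s / sqrt 2 * ((limit_gauss B T H w)^2 - 1))))
    \<le> ennreal (increment_const lam T * ((t - s) * sqrt (t - s)))"
proof -
  let ?g = "\<lambda>u. exp_integrand lam t u - exp_integrand lam s u"
  let ?c = "rosenblatt_const H" and ?F = "exp_primitive lam" and ?b = "1 - H" and ?X = "limit_gauss B T H"
  define m where "m = exp (lam * T)"
  define L where "L = t - s"
  define D where "D = ?F t - ?F s"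
  have m: "0 < m" by (simp add: m_def)
  have L: "0 \<le> L" "L \<le> T" using st by (auto simp: L_def)
  have T: "0 \<le> T" using st by simp
  \<comment> \<open>On a bounded interval the quadratic terms are brought to the common order L *
    sqrt L.\<close>
  have LL: "L^2 \<le> sqrt T * (L * sqrt L)"
  proof -
    have "L^2 = sqrt L * (L * sqrt L)" using L by (simp add: power2_eq_square)
    also have "\<dots> \<le> sqrt T * (L * sqrt L)" using L by (intro mult_right_mono) auto
    finally show ?thesis .
  qed
  have gI: "has_bochner_integral lborel ?g D"
    unfolding D_def using st by (intro has_bochner_integral_diff has_bochner_integral_exp_integrand lam) auto
  have g_zero: "?g u = 0" if "u \<notin> {s..t}" for u
    using that st by (auto simp: exp_integrand_def indicator_def)
  have g_le: "0 \<le> ?g u" "?g u \<le> m" for u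
    using exp_integrand_bounds[OF lam st, of u] by (auto simp: m_def)
  have D: "0 \<le> D" "D \<le> m * L"
  proof -
    have eq: "(LINT u|lborel. ?g u) = D" using gI by (simp add: has_bochner_integral_iff)
    show "0 \<le> D" unfolding eq[symmetric] by (rule integral_nonneg_AE) (use g_le in auto)
    have "integrable lborel (\<lambda>u. m * indicator {s..t} u)"
      using st by (intro integrable_mult_right integrable_real_indicator) auto
    then have "(LINT u|lborel. ?g u) \<le> (LINT u|lborel. m * indicator {s..t} u)"
      by (rule integral_mono[rotated]) (use gI g_le g_zero in \<open>auto simp: has_bochner_integral_iff indicator_def\<close>)
    then show "D \<le> m * L" using st by (simp add: eq L_def)
  qed
  then have D2: "D^2 \<le> m^2 * L^2"
    using power_mono[OF D(2) D(1), of 2] by (simp add: power_mult_distrib)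
  have "(sqnorm lborel (\<lambda>q. J_kernel H (exp_integrand lam t) q - J_kernel H (exp_integrand lam s) q)) \<le>
    ennreal (?c^2) * kernel_energy H (\<lambda>u. ?g u)"
    by (rule J_kernel_diff_bound[OF H order.trans[OF st(1,2)], of _ _ m])
       (use exp_integrand_bounds[OF lam st] in \<open>auto simp: exp_integrand_def m_def\<close>)
  also have "\<dots> \<le> ennreal (?c^2) * ennreal ((overlap_const H)^2 *
      ((1 - 4 * ?b) * (LINT u|lborel. ?g u)^2 + 16 * ?b * m^2 * ((t - s) * sqrt (t - s))))"
    by (intro mult_left_mono nn_integral_kernel_square_bound[OF H st(2)]) (use g_le g_zero in auto)
  also have "\<dots> = ennreal ((?c * overlap_const H)^2 * ((1 - 4 * ?b) * D^2 + 16 * ?b * m^2 * (L * sqrt L)))"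
    using gI by (simp add: has_bochner_integral_iff L_def power_mult_distrib mult.assoc flip: ennreal_mult')
  also have "\<dots> \<le> ennreal (m^2 * (sqrt T + 4) * (L * sqrt L))"
  proof (rule ennreal_leI)
    have "(1 - 4 * ?b) * D^2 \<le> 1 * (m^2 * (sqrt T * (L * sqrt L)))"
      using H order.trans[OF D2 mult_left_mono[OF LL, of "m^2"]] by (intro mult_mono) auto
    moreover have "16 * ?b * m^2 * (L * sqrt L) \<le> 4 * m^2 * (L * sqrt L)"
      using H L by (intro mult_right_mono) auto
    ultimately have "(1 - 4 * ?b) * D^2 + 16 * ?b * m^2 * (L * sqrt L) \<le> m^2 * (sqrt T + 4) * (L * sqrt L)"
      by (simp add: algebra_simps)
    moreover have "0 \<le> (1 - 4 * ?b) * D^2 + 16 * ?b * m^2 * (L * sqrt L)"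
      using H L by (intro add_nonneg_nonneg mult_nonneg_nonneg) auto
    ultimately show "(?c * overlap_const H)^2 * ((1 - 4 * ?b) * D^2 + 16 * ?b * m^2 * (L * sqrt L)) \<le> m^2 * (sqrt T + 4) * (L * sqrt L)"
      using mult_right_mono[OF bounded, of "(1 - 4 * ?b) * D^2 + 16 * ?b * m^2 * (L * sqrt L)"] by simp
  qed
  finally have K: "(sqnorm lborel (\<lambda>q. J_kernel H (exp_integrand lam t) q - J_kernel H (exp_integrand lam s) q)) \<le>
     ennreal (m^2 * (sqrt T + 4) * (L * sqrt L))" .
  have 1: "(sqnorm M (\<lambda>w. S w - S' w)) \<le> 18 * ennreal (m^2 * (sqrt T + 4) * (L * sqrt L))"
    by (rule order.trans[OF double_wiener_integral_diff_bound[OF W S S']]) (intro mult_left_mono K, simp)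
  have "(sqnorm M (\<lambda>w. - (D / sqrt 2) * ((?X w)^2 - 1))) = ennreal (D^2)"
    by (subst nn_integral_limit_gauss_square[OF W T]) (simp add: power_divide)
  also have "\<dots> \<le> ennreal (m^2 * sqrt T * (L * sqrt L))"
    using order.trans[OF D2 mult_left_mono[OF LL, of "m^2"]] by (intro ennreal_leI) (simp add: mult.assoc)
  finally have 2: "(sqnorm M (\<lambda>w. - (D / sqrt 2) * ((?X w)^2 - 1))) \<le> \<dots>" .
  have [measurable]: "S \<in> borel_measurable M" "S' \<in> borel_measurable M" "?X \<in> borel_measurable M"
    using S S' borel_measurable_limit_gauss[OF W T] by (auto simp: has_double_wiener_integral_def)
  have "(sqnorm M (\<lambda>w. (S w - ?F t / sqrt 2 * ((?X w)^2 - 1)) - (S' w - ?F s / sqrt 2 * ((?X w)^2 - 1))))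
     = (sqnorm M (\<lambda>w. (S w - S' w) + (- (D / sqrt 2) * ((?X w)^2 - 1)) + 0))"
    by (intro nn_integral_cong arg_cong[where f="\<lambda>x. ennreal (x^2)"]) (simp add: D_def diff_divide_distrib algebra_simps)
  also have "\<dots> \<le> 3 * ((sqnorm M (\<lambda>w. S w - S' w)) +
      (sqnorm M (\<lambda>w. - (D / sqrt 2) * ((?X w)^2 - 1))) + (\<integral>\<^sup>+w. ennreal (0^2) \<partial>M))"
    by (rule nn_integral_square_sum3) measurable
  also have "\<dots> \<le> 3 * (18 * ennreal (m^2 * (sqrt T + 4) * (L * sqrt L)) + ennreal (m^2 * sqrt T * (L * sqrt L)) + 0)"
    by (intro mult_left_mono add_mono 1 2) simp_all
  also have "\<dots> = ennreal (3 * (18 * (m^2 * (sqrt T + 4) * (L * sqrt L)) + m^2 * sqrt T * (L * sqrt L)))"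
  proof -
    have "3 * (18 * ennreal x + ennreal y + 0) = ennreal (3 * (18 * x + y))" if "0 \<le> x" "0 \<le> y" for x y
      using that by (simp add: ennreal_plus ennreal_mult)
    then show ?thesis using L T by simp
  qed
  also have "3 * (18 * (m^2 * (sqrt T + 4) * (L * sqrt L)) + m^2 * sqrt T * (L * sqrt L)) = increment_const lam T * (L * sqrt L)"
    by (simp add: increment_const_def m_def algebra_simps)
  finally show ?thesis by (simp add: L_def)
qed

lemma inverse_weight_sum_tendsto:
  assumes T: "0 \<le> T"
  shows "((\<lambda>H. 1 / weight_sum T H) \<longlongrightarrow> 0) (at_left 1)"
proof (rule tendsto_sandwich[where f = "\<lambda>_. 0" and h = "\<lambda>H. (1 - H) / weight_bound T (1 - H)"])
  have "((\<lambda>H. (1 - H) / weight_bound T (1 - H)) \<longlongrightarrow> (1 - 1) / 1) (at_left 1)"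
    by (intro tendsto_intros weight_bound_tendsto) simp
  then show "((\<lambda>H. (1 - H) / weight_bound T (1 - H)) \<longlongrightarrow> 0) (at_left 1)" by simp
  have "\<forall>\<^sub>F H in at_left 1. 0 < weight_bound T (1 - H)"
    using order_tendstoD(1)[OF weight_bound_tendsto, of 0] by simp
  moreover have "\<forall>\<^sub>F H in at_left 1. H \<in> {1/2<..<1::real}"
    by (rule eventually_at_left_real) simp
  ultimately show "\<forall>\<^sub>F H in at_left 1. 1 / weight_sum T H \<le> (1 - H) / weight_bound T (1 - H)"
  proof eventually_elim
    case (elim H)
    then show ?case
      using weight_sum_ge[OF T, of H] weight_sum_pos[OF T, of H] by (simp add: field_simps)
  qed
  show "\<forall>\<^sub>F H in at_left 1. 0 \<le> 1 / weight_sum T H"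
    using weight_sum_pos[OF T] by (simp add: less_imp_le)
qed simp

section \<open>Chaining\<close>

text \<open>A dyadic point of level m + 1 is either a point of level m or the right neighbour of
  one, so passing to the next level costs at most one increment. Continuity then reaches t through
  its left dyadic neighbours. It is the size of x that is controlled, starting from the points of
  level n, rather than its modulus of continuity.\<close>

lemma dyadic_bound:
  fixes x :: "real \<Rightarrow> real" and \<eta> :: "nat \<Rightarrow> real"
  assumes T: "0 < T" and cont: "continuous_on {0..T} x"
    and base: "\<And>i. i \<le> 2 ^ n \<Longrightarrow> \<bar>x (T * (real i / 2 ^ n))\<bar> \<le> c"
    and step: "\<And>m i. n \<le> m \<Longrightarrow> i < 2 ^ Suc m \<Longrightarrow>
      \<bar>x (T * (real (Suc i) / 2 ^ Suc m)) - x (T * (real i / 2 ^ Suc m))\<bar> \<le> \<eta> m"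
    and sum: "\<And>N. (\<Sum>m = n..<N. \<eta> m) \<le> e" and t: "t \<in> {0..T}"
  shows "\<bar>x t\<bar> \<le> c + e"
proof -
  have level: "\<bar>x (T * (real i / 2 ^ N))\<bar> \<le> c + (\<Sum>m = n..<N. \<eta> m)" if "n \<le> N" "i \<le> 2 ^ N" for N i
    using that
  proof (induction N arbitrary: i rule: dec_induct)
    case base
    then show ?case using assms(3) by simp
  next
    case (step N)
    have half: "T * (real (2 * j) / 2 ^ Suc N) = T * (real j / 2 ^ N)" for j by simp
    have s: "(\<Sum>m = n..<Suc N. \<eta> m) = (\<Sum>m = n..<N. \<eta> m) + \<eta> N" using step.hyps by simp
    have "0 \<le> \<eta> N" using assms(4)[OF step.hyps(1), of 0] by (simp add: order.trans[OF abs_ge_zero])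
    show ?case
    proof (cases "even i")
      case True
      then obtain j where j: "i = 2 * j" by (elim evenE)
      then show ?thesis using step.IH[of j] step.prems \<open>0 \<le> \<eta> N\<close> unfolding j half s by simp
    next
      case False
      then obtain j where j: "i = Suc (2 * j)" by (elim oddE) simp
      then have "j \<le> 2 ^ N" "2 * j < 2 ^ Suc N" using step.prems by simp_all
      then show ?thesis
        using step.IH[of j] assms(4)[OF step.hyps(1), of "2 * j"] unfolding j half s by linarith
    qed
  qed
  define u where "u N = T * (real (nat \<lfloor>t / T * 2 ^ N\<rfloor>) / 2 ^ N)" for N
  have tT: "0 \<le> t / T" "t / T \<le> 1" using T t by auto
  have u_le: "nat \<lfloor>t / T * 2 ^ N\<rfloor> \<le> 2 ^ N" for N
  proof -
    have "t / T * 2 ^ N \<le> 2 ^ N" using mult_right_mono[OF tT(2), of "2 ^ N"] by simp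
    then have "\<lfloor>t / T * 2 ^ N\<rfloor> \<le> \<lfloor>2 ^ N :: real\<rfloor>" by (rule floor_mono)
    also have "\<lfloor>2 ^ N :: real\<rfloor> = 2 ^ N" by simp
    finally show ?thesis by (simp add: nat_le_iff)
  qed
  have r: "real (nat \<lfloor>t / T * 2 ^ N\<rfloor>) = of_int \<lfloor>t / T * 2 ^ N\<rfloor>" for N
  proof -
    have "0 \<le> t / T * 2 ^ N" using tT(1) by (rule mult_nonneg_nonneg) simp
    then have "0 \<le> \<lfloor>t / T * 2 ^ N\<rfloor>" by (simp only: zero_le_floor)
    then show ?thesis by (rule of_nat_nat)
  qed
  have u_lim: "u \<longlonglongrightarrow> t"
  proof (rule tendsto_sandwich)
    have "(\<lambda>N. t - T * (1/2) ^ N) \<longlonglongrightarrow> t - T * 0"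
      by (intro tendsto_intros LIMSEQ_realpow_zero) auto
    then show "(\<lambda>N. t - T * (1/2) ^ N) \<longlonglongrightarrow> t" by simp
    show "\<forall>\<^sub>F N in sequentially. t - T * (1/2) ^ N \<le> u N"
    proof (rule always_eventually, rule allI)
      fix N
      have "t / T * 2 ^ N - 1 \<le> of_int \<lfloor>t / T * 2 ^ N\<rfloor>" by linarith
      then have "T * ((t / T * 2 ^ N - 1) / 2 ^ N) \<le> u N"
        unfolding u_def r using T by (intro mult_left_mono divide_right_mono) auto
      then show "t - T * (1/2) ^ N \<le> u N" using T by (simp add: diff_divide_distrib power_divide right_diff_distrib)
    qed
    show "\<forall>\<^sub>F N in sequentially. u N \<le> t"
    proof (rule always_eventually, rule allI)
      fix N
      have "u N \<le> T * ((t / T * 2 ^ N) / 2 ^ N)"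
        unfolding u_def r using T by (intro mult_left_mono divide_right_mono) auto
      then show "u N \<le> t" using T by simp
    qed
  qed simp
  have u_in: "u N \<in> {0..T}" for N
  proof -
    have "real (nat \<lfloor>t / T * 2 ^ N\<rfloor>) \<le> 2 ^ N"
      using u_le[of N] by (metis of_nat_le_iff of_nat_numeral of_nat_power)
    then have "real (nat \<lfloor>t / T * 2 ^ N\<rfloor>) / 2 ^ N \<le> 1" by simp
    from mult_left_mono[OF this, of T] show ?thesis
      using T unfolding u_def by (auto intro!: mult_nonneg_nonneg divide_nonneg_nonneg)
  qed
  have "(\<lambda>N. x (u N)) \<longlonglongrightarrow> x t"
    using cont u_lim t u_in by (auto simp: continuous_on_sequentially comp_def)
  then have "(\<lambda>N. \<bar>x (u N)\<bar>) \<longlonglongrightarrow> \<bar>x t\<bar>" by (rule tendsto_rabs)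
  moreover have "\<forall>\<^sub>F N in sequentially. \<bar>x (u N)\<bar> \<le> c + e"
    using eventually_ge_at_top[of n]
  proof eventually_elim
    case (elim N)
    show ?case using level[OF elim u_le[of N]] sum[of N] unfolding u_def by linarith
  qed
  ultimately show ?thesis by (intro tendsto_upperbound) auto
qed

lemma second_moment_tail:
  assumes [measurable]: "f \<in> borel_measurable M" and c: "0 < c"
    and V: "(sqnorm M (\<lambda>w. f w)) \<le> ennreal V" "0 \<le> V"
  shows "emeasure M {w\<in>space M. c < \<bar>f w\<bar>} \<le> ennreal (V / c^2)"
proof -
  have "{w\<in>space M. c < \<bar>f w\<bar>} \<subseteq> {w\<in>space M. 1 \<le> ennreal (1 / c^2) * ennreal ((f w)^2)}"
  proof safe
    fix w assume "c < \<bar>f w\<bar>"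
    then have "c^2 \<le> (f w)^2" using c by (intro abs_le_square_iff[THEN iffD1]) simp
    then have "1 \<le> 1 / c^2 * (f w)^2" using c by simp
    then show "1 \<le> ennreal (1 / c^2) * ennreal ((f w)^2)"
      by (simp add: ennreal_ge_1 flip: ennreal_mult)
  qed
  then have "emeasure M {w\<in>space M. c < \<bar>f w\<bar>} \<le> emeasure M {w\<in>space M. 1 \<le> ennreal (1 / c^2) * ennreal ((f w)^2)}"
    by (rule emeasure_mono) measurable
  also have "\<dots> \<le> ennreal (1 / c^2) * (\<integral>\<^sup>+w. ennreal ((f w)^2) * indicator (space M) w \<partial>M)"
    by (rule order.trans[OF _ nn_integral_Markov_inequality]) (auto intro!: emeasure_mono)
  also have "\<dots> \<le> ennreal (1 / c^2) * ennreal V"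
    by (intro mult_left_mono order.trans[OF _ V(1)] nn_integral_mono) (auto simp: indicator_def)
  also have "\<dots> = ennreal (V / c^2)" using V by (simp flip: ennreal_mult)
  finally show ?thesis .
qed

text \<open>Kolmogorov-Chentsov chaining along the dyadic points. The threshold \<open>(9/10) ^ m\<close> at level
  \<open>m\<close> is summable and still large compared with the increments of order \<open>2 powr (- 3 * m / 4)\<close>
  in mean square, even after summing Chebyshev's bound over the \<open>2 ^ m\<close> increments.\<close>

lemma uniform_convergence_in_probability:
  fixes D :: "'i \<Rightarrow> real \<Rightarrow> 'a \<Rightarrow> real"
  assumes T: "0 < T" and C: "0 \<le> C"
    and meas: "\<forall>\<^sub>F k in F. \<forall>t\<in>{0..T}. D k t \<in> borel_measurable M"
    and cont: "\<forall>\<^sub>F k in F. \<forall>w\<in>space M. continuous_on {0..T} (\<lambda>t. D k t w)"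
    and incr: "\<forall>\<^sub>F k in F. \<forall>s t. 0 \<le> s \<longrightarrow> s \<le> t \<longrightarrow> t \<le> T \<longrightarrow>
      (sqnorm M (\<lambda>w. D k t w - D k s w)) \<le> ennreal (C * ((t - s) * sqrt (t - s)))"
    and lim: "\<And>t. t \<in> {0..T} \<Longrightarrow> ((\<lambda>k. \<integral>\<^sup>+w. ennreal ((D k t w)^2) \<partial>M) \<longlongrightarrow> 0) F"
    and e: "0 < e" and d: "0 < d"
  shows "\<forall>\<^sub>F k in F. \<exists>A\<in>sets M. emeasure M A \<le> ennreal d \<and> (\<forall>w\<in>space M - A. \<forall>t\<in>{0..T}. \<bar>D k t w\<bar> \<le> e)"
proof -
  define K where "K = C * T * sqrt T"
  have K: "0 \<le> K" using T C by (simp add: K_def)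
  let ?q = "9/10 :: real"
  \<comment> \<open>The factor 10 is 1 / (1 - 9/10), the geometric tail both of the thresholds and
    of the exceptional probabilities.\<close>
  have "(\<lambda>n. 10 * ?q ^ n) \<longlonglongrightarrow> 10 * 0" "(\<lambda>n. 10 * K * ?q ^ n) \<longlonglongrightarrow> 10 * K * 0"
    by (intro tendsto_intros LIMSEQ_realpow_zero; simp)+
  then have l: "(\<lambda>n. 10 * ?q ^ n) \<longlonglongrightarrow> 0" "(\<lambda>n. 10 * K * ?q ^ n) \<longlonglongrightarrow> 0"
    by (simp_all only: mult_zero_right)
  have "\<forall>\<^sub>F n in sequentially. 10 * ?q ^ n < e / 2 \<and> 10 * K * ?q ^ n < d / 2"
    by (intro eventually_conj order_tendstoD(2)[OF l(1)] order_tendstoD(2)[OF l(2)]) (use e d in auto)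
  then obtain n where n: "10 * ?q ^ n < e / 2" "10 * K * ?q ^ n < d / 2"
    by (auto simp: eventually_sequentially)
  define p where "p m i = T * (real i / 2 ^ m)" for m i :: nat
  have p_in: "p m i \<in> {0..T}" if "i \<le> 2 ^ m" for m i
  proof -
    have "real i \<le> 2 ^ m" using that by (metis of_nat_le_iff of_nat_numeral of_nat_power)
    then have "real i / 2 ^ m \<le> 1" by simp
    from mult_left_mono[OF this, of T] show ?thesis using T by (simp add: p_def)
  qed
  \<comment> \<open>Chosen so that Chebyshev at threshold e / 2, summed over the 2 ^ n + 1 base
    points, gives exactly d / 2. As n is already fixed, finitely many instances of the pointwise
    convergence suffice.\<close>
  define v where "v = d * e^2 / (8 * (2 ^ n + 1))"
  have v: "0 < v" using e d unfolding v_def by (intro divide_pos_pos mult_pos_pos) (auto simp: add_pos_pos)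
  have "\<forall>\<^sub>F k in F. \<forall>i\<in>{..2 ^ n}. (sqnorm M (\<lambda>w. D k (p n i) w)) < ennreal v"
    using v p_in by (intro eventually_ball_finite ballI order_tendstoD(2)[OF lim]) auto
  with meas cont incr show ?thesis
  proof eventually_elim
    case (elim k)
    define A0 where "A0 i = {w\<in>space M. e / 2 < \<bar>D k (p n i) w\<bar>}" for i
    define A1 where "A1 m i = {w\<in>space M. ?q ^ m < \<bar>D k (p (Suc m) (Suc i)) w - D k (p (Suc m) i) w\<bar>}" for m i
    define A2 where "A2 j = (\<Union>i\<in>{..<2 ^ Suc (n + j)}. A1 (n + j) i)" for j
    define A where "A = (\<Union>i\<in>{..2 ^ n}. A0 i) \<union> (\<Union>j. A2 j)"
    have A0_sets: "A0 i \<in> sets M" if "i \<le> 2 ^ n" for i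
    proof -
      have [measurable]: "D k (p n i) \<in> borel_measurable M" using elim(1) p_in[OF that] by blast
      show ?thesis unfolding A0_def by measurable
    qed
    have Dm: "D k (p (Suc m) i) \<in> borel_measurable M" if "i \<le> 2 ^ Suc m" for m i
      using elim(1) p_in[OF that] by blast
    have A1_sets: "A1 m i \<in> sets M" if "i < 2 ^ Suc m" for m i
    proof -
      have [measurable]: "D k (p (Suc m) (Suc i)) \<in> borel_measurable M" "D k (p (Suc m) i) \<in> borel_measurable M"
        using that by (intro Dm; simp)+
      show ?thesis unfolding A1_def by measurable
    qed
    have A2_sets: "A2 j \<in> sets M" for j
      unfolding A2_def by (intro sets.finite_UN A1_sets) auto
    have A_sets: "A \<in> sets M"
      unfolding A_def by (intro sets.Un sets.finite_UN A0_sets sets.countable_UN') (auto intro: A2_sets)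
    have e0: "emeasure M (A0 i) \<le> ennreal (v / (e / 2)^2)" if "i \<le> 2 ^ n" for i
      unfolding A0_def using elim(4) that v e elim(1) p_in[OF that]
      by (intro second_moment_tail) (auto intro: less_imp_le)
    have "emeasure M (\<Union>i\<in>{..2 ^ n}. A0 i) \<le> (\<Sum>i\<in>{..2 ^ n}. emeasure M (A0 i))"
      by (rule emeasure_subadditive_finite) (use A0_sets in auto)
    also have "\<dots> \<le> (\<Sum>i\<in>{..2 ^ n :: nat}. ennreal (v / (e / 2)^2))"
      by (intro sum_mono e0) simp
    also have "\<dots> = ennreal ((2 ^ n + 1) * (v / (e / 2)^2))"
      using v by (subst sum_ennreal) (simp_all add: add.commute)
    also have "(2 ^ n + 1) * (v / (e / 2)^2) = d / 2"
    proof -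
      have "P * (d * e^2 / (8 * P) / (e / 2)^2) = d / 2" if "P \<noteq> 0" for P :: real
        using that e by (simp add: power_divide)
      moreover have "(2 ^ n + 1 :: real) \<noteq> 0" by (simp add: add_nonneg_eq_0_iff)
      ultimately show ?thesis unfolding v_def by blast
    qed
    finally have B0: "emeasure M (\<Union>i\<in>{..2 ^ n}. A0 i) \<le> ennreal (d / 2)" .
    have e2: "emeasure M (A2 j) \<le> ennreal (K * ?q ^ n * ?q ^ j)" for j
    proof -
      define m where "m = n + j"
      define L where "L = T / 2 ^ Suc m"
      have L: "0 \<le> L" using T by (simp add: L_def)
      have e1: "emeasure M (A1 m i) \<le> ennreal (C * (L * sqrt L) / (?q ^ m)^2)" if i: "i < 2 ^ Suc m" for i
      proof -
        have [measurable]: "D k (p (Suc m) (Suc i)) \<in> borel_measurable M" "D k (p (Suc m) i) \<in> borel_measurable M"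
          using i by (intro Dm; simp)+
        have "p (Suc m) (Suc i) - p (Suc m) i = L"
          by (simp add: p_def L_def field_simps)
        moreover have "0 \<le> p (Suc m) i" "p (Suc m) (Suc i) \<le> T"
          using p_in[of i "Suc m"] p_in[of "Suc i" "Suc m"] i by auto
        ultimately have "(sqnorm M (\<lambda>w. D k (p (Suc m) (Suc i)) w - D k (p (Suc m) i) w)) \<le> ennreal (C * (L * sqrt L))"
          using elim(3)[rule_format, of "p (Suc m) i" "p (Suc m) (Suc i)"] L by simp
        then show ?thesis
          unfolding A1_def using C L by (intro second_moment_tail) auto
      qed
      have "emeasure M (A2 j) \<le> (\<Sum>i\<in>{..<2 ^ Suc m}. emeasure M (A1 m i))"
        unfolding A2_def m_def by (rule emeasure_subadditive_finite) (auto intro: A1_sets)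
      also have "\<dots> \<le> (\<Sum>i\<in>{..<2 ^ Suc m :: nat}. ennreal (C * (L * sqrt L) / (?q ^ m)^2))"
        by (intro sum_mono e1) simp
      also have "\<dots> = ennreal (2 ^ Suc m * (C * (L * sqrt L) / (?q ^ m)^2))"
        using C L by (subst sum_ennreal) simp_all
      also have "\<dots> \<le> ennreal (K * ?q ^ m)"
      proof (rule ennreal_leI)
        have "sqrt L = sqrt T / sqrt 2 ^ Suc m"
          by (simp add: L_def real_sqrt_divide real_sqrt_power real_sqrt_mult)
        also have "\<dots> \<le> sqrt T / sqrt 2 ^ m"
          using T by (intro divide_left_mono power_increasing) auto
        also have "\<dots> = sqrt T * (1 / sqrt 2) ^ m" by (simp add: power_divide)
        \<comment> \<open>This fixes the ratio 9/10. Level m has about 2 ^ m increments with second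
          moments of order 2 powr (-3 * m / 2), so Chebyshev leaves (1 / sqrt 2) ^ m / q ^ (2 * m),
          which is at most q ^ m because 1 / sqrt 2 \<le> (9/10)^3 = 0.729.\<close>
        also have "\<dots> \<le> sqrt T * (?q ^ 2 * ?q) ^ m"
        proof (intro mult_left_mono power_mono)
          show "1 / sqrt 2 \<le> ?q ^ 2 * ?q"
            by (rule power2_le_imp_le) (simp_all add: power_divide power2_eq_square)
        qed (use T in auto)
        also have "\<dots> = sqrt T * ((?q ^ m)^2 * ?q ^ m)"
        proof -
          have "(x^2 * x) ^ m = (x ^ m)^2 * x ^ m" for x :: real
            by (simp add: power_mult_distrib mult.commute flip: power_mult)
          then show ?thesis by (rule arg_cong)
        qed
        finally have s: "sqrt L \<le> sqrt T * ((?q ^ m)^2 * ?q ^ m)" .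
        have "2 ^ Suc m * (C * (L * sqrt L) / (?q ^ m)^2) = C * T * sqrt L / (?q ^ m)^2"
          by (simp add: L_def)
        also have "\<dots> \<le> C * T * (sqrt T * ((?q ^ m)^2 * ?q ^ m)) / (?q ^ m)^2"
          using s C T by (intro divide_right_mono mult_left_mono) auto
        also have "\<dots> = K * ?q ^ m" by (simp add: K_def)
        finally show "2 ^ Suc m * (C * (L * sqrt L) / (?q ^ m)^2) \<le> K * ?q ^ m" .
      qed
      finally show ?thesis by (simp add: m_def power_add mult.assoc)
    qed
    have "emeasure M (\<Union>j. A2 j) \<le> (\<Sum>j. emeasure M (A2 j))"
      by (rule emeasure_subadditive_countably) (use A2_sets in auto)
    also have "\<dots> \<le> (\<Sum>j. ennreal (K * ?q ^ n * ?q ^ j))"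
      by (intro suminf_le e2) auto
    also have "\<dots> = ennreal (K * ?q ^ n * (1 / (1 - ?q)))"
    proof (rule suminf_ennreal_eq)
      show "(\<lambda>j. K * ?q ^ n * ?q ^ j) sums (K * ?q ^ n * (1 / (1 - ?q)))"
        by (intro sums_mult geometric_sums) simp
    qed (use K in simp)
    also have "\<dots> \<le> ennreal (d / 2)" using n(2) by (intro ennreal_leI) simp
    finally have B2: "emeasure M (\<Union>j. A2 j) \<le> ennreal (d / 2)" .
    have "emeasure M A \<le> emeasure M (\<Union>i\<in>{..2 ^ n}. A0 i) + emeasure M (\<Union>j. A2 j)"
      unfolding A_def by (intro emeasure_subadditive sets.finite_UN A0_sets sets.countable_UN') (auto intro: A2_sets)
    also have "\<dots> \<le> ennreal (d / 2) + ennreal (d / 2)" by (intro add_mono B0 B2)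
    also have "\<dots> = ennreal d" using d by (simp flip: ennreal_plus)
    finally have A_small: "emeasure M A \<le> ennreal d" .
    have "\<bar>D k t w\<bar> \<le> e" if w: "w \<in> space M - A" and t: "t \<in> {0..T}" for w t
    proof -
      have "\<bar>D k t w\<bar> \<le> e / 2 + e / 2"
      proof (rule dyadic_bound[OF T _ _ _ _ t])
        show "continuous_on {0..T} (\<lambda>t. D k t w)" using elim(2) w by blast
        show "\<bar>D k (T * (real i / 2 ^ n)) w\<bar> \<le> e / 2" if "i \<le> 2 ^ n" for i
          using w that unfolding A_def A0_def p_def by force
        show "\<bar>D k (T * (real (Suc i) / 2 ^ Suc m)) w - D k (T * (real i / 2 ^ Suc m)) w\<bar> \<le> ?q ^ m"
          if m: "n \<le> m" and i: "i < 2 ^ Suc m" for m i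
        proof (rule ccontr)
          assume "\<not> ?thesis"
          then have "w \<in> A1 m i" using w unfolding A1_def p_def by auto
          then have "w \<in> A2 (m - n)" unfolding A2_def using m i by auto
          then show False using w unfolding A_def by blast
        qed
        show "(\<Sum>m = n..<N. ?q ^ m) \<le> e / 2" for N
        proof (cases "n \<le> N")
          case True
          have "(\<Sum>m = n..<N. ?q ^ m) = 10 * (?q ^ n - ?q ^ N)"
            using True by (induction N rule: dec_induct) (simp_all add: algebra_simps)
          also have "\<dots> \<le> 10 * ?q ^ n" by simp
          finally show ?thesis using n(1) by linarith
        qed (use e in simp)
      qed
      then show ?thesis by simp
    qed
    with A_sets A_small show ?case by blast
  qed
qed

section \<open>Mixing\<close>

context prob_space
begin

lemma integrable_bounded:
  fixes f :: "'a \<Rightarrow> real"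
  assumes "f \<in> borel_measurable M" "\<And>w. \<bar>f w\<bar> \<le> C"
  shows "integrable M f"
  using assms by (intro integrable_const_bound[of _ C]) auto

text \<open>Otherwise arbitrarily long orthogonal subfamilies would violate Bessel's inequality.\<close>

lemma asymptotically_orthogonal_tendsto:
  fixes U :: "'i \<Rightarrow> 'a \<Rightarrow> real" and W :: "'a \<Rightarrow> real"
  assumes mU: "\<And>k. U k \<in> borel_measurable M" and U: "\<And>k w. \<bar>U k w\<bar> \<le> C"
    and mW: "W \<in> borel_measurable M" and W: "\<And>w. \<bar>W w\<bar> \<le> C'"
    and orth: "\<And>i. \<forall>\<^sub>F k in F. expectation (\<lambda>w. U k w * U i w) = 0"
  shows "((\<lambda>k. expectation (\<lambda>w. W w * U k w)) \<longlongrightarrow> 0) F"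
proof (rule ccontr)
  let ?c = "\<lambda>k. expectation (\<lambda>w. W w * U k w)"
  assume "\<not> (?c \<longlongrightarrow> 0) F"
  then obtain e where e: "0 < e" and "\<not> (\<forall>\<^sub>F k in F. dist (?c k) 0 < e)"
    unfolding tendsto_iff by blast
  then have freq: "\<exists>\<^sub>F k in F. e \<le> \<bar>?c k\<bar>"
    by (simp add: frequently_def not_le dist_real_def)
  note [measurable] = mU mW
  have UU: "integrable M (\<lambda>w. U i w * U j w)" for i j
    by (rule integrable_bounded[where C = "C * C"]) (auto simp: abs_mult intro!: mult_mono U order.trans[OF abs_ge_zero U])
  have WU: "integrable M (\<lambda>w. W w * U j w)" for j
    by (rule integrable_bounded[where C = "C' * C"]) (auto simp: abs_mult intro!: mult_mono U W order.trans[OF abs_ge_zero W])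
  have WW: "integrable M (\<lambda>w. (W w)^2)"
  proof (rule integrable_bounded)
    show "\<bar>(W w)^2\<bar> \<le> C'^2" for w using power_mono[OF W abs_ge_zero, of w 2] by simp
  qed simp
  \<comment> \<open>Indices with large correlation occur frequently, whereas orthogonality to
    finitely many chosen ones holds eventually; so the family can always be extended by one.\<close>
  have family: "\<exists>s :: nat \<Rightarrow> 'i. (\<forall>i<J. e \<le> \<bar>?c (s i)\<bar>) \<and> (\<forall>i<J. \<forall>j<i. expectation (\<lambda>w. U (s i) w * U (s j) w) = 0)" for J
  proof (induction J)
    case (Suc J)
    then obtain s :: "nat \<Rightarrow> 'i" where s: "\<forall>i<J. e \<le> \<bar>?c (s i)\<bar>" "\<forall>i<J. \<forall>j<i. expectation (\<lambda>w. U (s i) w * U (s j) w) = 0"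
      by blast
    have "\<forall>\<^sub>F k in F. \<forall>j\<in>{..<J}. expectation (\<lambda>w. U k w * U (s j) w) = 0"
      by (intro eventually_ball_finite ballI orth) simp
    from frequently_eventually_conj[OF freq this]
    obtain k where k: "e \<le> \<bar>?c k\<bar>" "\<forall>j\<in>{..<J}. expectation (\<lambda>w. U k w * U (s j) w) = 0"
      by (auto dest!: frequently_ex)
    show ?case
      by (rule exI[of _ "s(J := k)"]) (use s k in \<open>auto simp: less_Suc_eq\<close>)
  qed auto
  \<comment> \<open>A bound for the second moments of the U k, kept at least 1 so that division by
    it is possible.\<close>
  define A where "A = (max C 1)^2"
  have A: "0 < A" "1 \<le> A" by (simp_all add: A_def)
  obtain J :: nat where J: "A * expectation (\<lambda>w. (W w)^2) / e^2 < real J"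
    using reals_Archimedean2 by blast
  from family[of J] obtain s :: "nat \<Rightarrow> 'i" where s: "\<And>i. i < J \<Longrightarrow> e \<le> \<bar>?c (s i)\<bar>"
    "\<And>i j. i < J \<Longrightarrow> j < i \<Longrightarrow> expectation (\<lambda>w. U (s i) w * U (s j) w) = 0" by blast
  define c where "c i = ?c (s i)" for i
  have diag: "expectation (\<lambda>w. U k w * U k w) \<le> A" for k
  proof -
    have "expectation (\<lambda>w. U k w * U k w) \<le> expectation (\<lambda>w. A)"
    proof (rule integral_mono[OF UU])
      fix w
      have "\<bar>U k w\<bar> \<le> max C 1" using U[of k w] by simp
      then show "U k w * U k w \<le> A"
        unfolding A_def power2_eq_square[symmetric] by (simp add: power2_le_iff_abs_le)
    qed simp
    then show ?thesis by (simp add: prob_space)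
  qed
  have cross: "expectation (\<lambda>w. U (s i) w * U (s j) w) = 0" if "i < J" "j < J" "i \<noteq> j" for i j
    using s(2)[of i j] s(2)[of j i] that by (cases "j < i") (auto simp: mult.commute)
  let ?S = "\<lambda>w. \<Sum>i<J. c i * U (s i) w"
  have WS: "integrable M (\<lambda>w. W w * ?S w)" "expectation (\<lambda>w. W w * ?S w) = (\<Sum>i<J. (c i)^2)"
  proof -
    have eq: "W w * ?S w = (\<Sum>i<J. c i * (W w * U (s i) w))" for w
      by (simp add: sum_distrib_left mult_ac)
    show "integrable M (\<lambda>w. W w * ?S w)" unfolding eq using WU by simp
    show "expectation (\<lambda>w. W w * ?S w) = (\<Sum>i<J. (c i)^2)"
      unfolding eq using WU by (simp add: c_def power2_eq_square)
  qed
  have SS: "integrable M (\<lambda>w. (?S w)^2)" "expectation (\<lambda>w. (?S w)^2) \<le> A * (\<Sum>i<J. (c i)^2)"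
  proof -
    have eq: "(?S w)^2 = (\<Sum>i<J. \<Sum>j<J. c i * c j * (U (s i) w * U (s j) w))" for w
      by (simp add: power2_eq_square sum_product mult_ac)
    show "integrable M (\<lambda>w. (?S w)^2)" unfolding eq using UU by simp
    have "expectation (\<lambda>w. (?S w)^2) = (\<Sum>i<J. \<Sum>j<J. c i * c j * expectation (\<lambda>w. U (s i) w * U (s j) w))"
      unfolding eq using UU by simp
    also have "\<dots> = (\<Sum>i<J. (c i)^2 * expectation (\<lambda>w. U (s i) w * U (s i) w))"
    proof (intro sum.cong refl)
      fix i assume i: "i \<in> {..<J}"
      then have "(\<Sum>j<J. c i * c j * expectation (\<lambda>w. U (s i) w * U (s j) w)) =
          (\<Sum>j\<in>{i}. c i * c j * expectation (\<lambda>w. U (s i) w * U (s j) w))"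
        using cross by (intro sum.mono_neutral_right) auto
      then show "(\<Sum>j<J. c i * c j * expectation (\<lambda>w. U (s i) w * U (s j) w)) = (c i)^2 * expectation (\<lambda>w. U (s i) w * U (s i) w)"
        by (simp add: power2_eq_square)
    qed
    also have "\<dots> \<le> (\<Sum>i<J. (c i)^2 * A)" by (intro sum_mono mult_left_mono diag) simp
    finally show "expectation (\<lambda>w. (?S w)^2) \<le> A * (\<Sum>i<J. (c i)^2)"
      by (simp add: sum_distrib_left mult.commute)
  qed
  \<comment> \<open>Bessel's inequality for an orthogonal family with norms at most sqrt A, obtained
    by expanding the square of W - S / A.\<close>
  have "0 \<le> expectation (\<lambda>w. (W w - 1 / A * ?S w)^2)" by simp
  also have "(\<lambda>w. (W w - 1 / A * ?S w)^2) = (\<lambda>w. (W w)^2 - 2 / A * (W w * ?S w) + (1 / A)^2 * (?S w)^2)"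
    by (auto simp: power2_eq_square algebra_simps)
  also have "expectation \<dots> = expectation (\<lambda>w. (W w)^2) - 2 / A * (\<Sum>i<J. (c i)^2) + (1 / A)^2 * expectation (\<lambda>w. (?S w)^2)"
    using WW WS SS by simp
  also have "\<dots> \<le> expectation (\<lambda>w. (W w)^2) - 2 / A * (\<Sum>i<J. (c i)^2) + (1 / A)^2 * (A * (\<Sum>i<J. (c i)^2))"
    by (intro add_left_mono mult_left_mono SS) simp
  also have "\<dots> = expectation (\<lambda>w. (W w)^2) - 1 / A * (\<Sum>i<J. (c i)^2)"
    using A by (simp add: power2_eq_square)
  finally have "(\<Sum>i<J. (c i)^2) \<le> A * expectation (\<lambda>w. (W w)^2)"
    using A by (simp add: field_simps)
  moreover have "(\<Sum>i<J. e^2) \<le> (\<Sum>i<J. (c i)^2)"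
    using s(1) e by (intro sum_mono) (auto simp: c_def abs_le_square_iff[symmetric])
  ultimately have "real J * e^2 \<le> A * expectation (\<lambda>w. (W w)^2)" by simp
  then show False using J e by (simp add: field_simps)
qed

text \<open>This is Renyi's mixing property: \<open>W\<close> may depend on the \<open>X k\<close>.\<close>

lemma mixing:
  fixes X :: "'i \<Rightarrow> 'a \<Rightarrow> real" and W :: "'a \<Rightarrow> real" and h :: "real \<Rightarrow> real"
  assumes mX: "\<And>k. X k \<in> borel_measurable M"
    and law: "\<And>k. distr M borel (X k) = \<nu>"
    and indep: "\<And>i. \<forall>\<^sub>F k in F. indep_var borel (X i) borel (X k)"
    and mh: "h \<in> borel_measurable borel" and h: "\<And>x. \<bar>h x\<bar> \<le> C"
    and mW: "W \<in> borel_measurable M" and W: "\<And>w. \<bar>W w\<bar> \<le> C'"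
  shows "((\<lambda>k. expectation (\<lambda>w. W w * h (X k w))) \<longlongrightarrow> expectation W * (LINT x|\<nu>. h x)) F"
proof -
  note [measurable] = mX mh mW
  define m where "m = (LINT x|\<nu>. h x)"
  have hX: "integrable M (\<lambda>w. h (X k w))" "expectation (\<lambda>w. h (X k w)) = m" for k
    by (rule integrable_bounded[where C = C]) (auto simp: h m_def integral_distr simp flip: law[of k])
  \<comment> \<open>Centering turns independence into orthogonality.\<close>
  define U where "U k w = h (X k w) - m" for k w
  have U: "\<bar>U k w\<bar> \<le> C + \<bar>m\<bar>" for k w using h[of "X k w"] unfolding U_def by linarith
  have lim: "((\<lambda>k. expectation (\<lambda>w. W w * U k w)) \<longlongrightarrow> 0) F"
  proof (rule asymptotically_orthogonal_tendsto[OF _ U mW W])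
    show "U k \<in> borel_measurable M" for k unfolding U_def by measurable
    fix i
    show "\<forall>\<^sub>F k in F. expectation (\<lambda>w. U k w * U i w) = 0"
      using indep[of i]
    proof eventually_elim
      case (elim k)
      have iU: "integrable M (U k)" "expectation (U k) = 0" for k
        unfolding U_def using hX[of k] by (simp_all add: prob_space)
      have "indep_var borel (U i) borel (U k)"
        using indep_var_compose[OF elim, of "\<lambda>x. h x - m" borel "\<lambda>x. h x - m" borel]
        by (simp add: comp_def U_def[abs_def])
      from indep_var_lebesgue_integral[OF this iU(1) iU(1)] show ?case by (simp add: iU(2) mult.commute)
    qed
  qed
  have WU: "integrable M (\<lambda>w. W w * U k w)" for k
  proof (rule integrable_bounded[where C = "C' * (C + \<bar>m\<bar>)"])
    show "(\<lambda>w. W w * U k w) \<in> borel_measurable M" unfolding U_def by measurable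
  qed (auto simp: abs_mult intro!: mult_mono U W order.trans[OF abs_ge_zero W])
  have iW: "integrable M W" by (rule integrable_bounded[OF mW W])
  have "expectation (\<lambda>w. W w * h (X k w)) = expectation (\<lambda>w. W w * U k w) + expectation W * m" for k
  proof -
    have "W w * h (X k w) = W w * U k w + W w * m" for w by (simp add: U_def algebra_simps)
    then show ?thesis using WU iW by simp
  qed
  with tendsto_add[OF lim tendsto_const[of "expectation W * m"]] show ?thesis by (simp add: m_def)
qed

section \<open>Comparison of expectations outside small sets\<close>

lemma expectation_close_off_set:
  fixes f g :: "'a \<Rightarrow> real"
  assumes mf: "f \<in> borel_measurable M" and mg: "g \<in> borel_measurable M" and A: "A \<in> events"
    and f: "\<And>w. \<bar>f w\<bar> \<le> C" and g: "\<And>w. \<bar>g w\<bar> \<le> C"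
    and close: "\<And>w. w \<in> space M - A \<Longrightarrow> \<bar>f w - g w\<bar> \<le> e" and e: "0 \<le> e"
  shows "\<bar>expectation f - expectation g\<bar> \<le> e + 2 * C * prob A"
proof -
  note int = integrable_bounded[OF mf f] integrable_bounded[OF mg g]
  have iA: "integrable M (\<lambda>w. e + 2 * C * indicator A w)"
    using A by (intro Bochner_Integration.integrable_add integrable_mult_right integrable_const integrable_real_indicator)
      (auto simp: emeasure_eq_measure)
  have "\<bar>expectation f - expectation g\<bar> = \<bar>expectation (\<lambda>w. f w - g w)\<bar>"
    using int by simp
  also have "\<dots> \<le> expectation (\<lambda>w. \<bar>f w - g w\<bar>)"
    using integral_abs_bound[of M "\<lambda>w. f w - g w"] by simp
  also have "\<dots> \<le> expectation (\<lambda>w. e + 2 * C * indicator A w)"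
  proof (rule integral_mono[OF _ iA])
    fix w assume w: "w \<in> space M"
    show "\<bar>f w - g w\<bar> \<le> e + 2 * C * indicator A w"
      using close[of w] f[of w] g[of w] e w by (cases "w \<in> A") auto
  qed (use int in simp)
  also have "\<dots> = e + 2 * C * prob A"
    using A by (simp add: prob_space emeasure_eq_measure Int_absorb2 sets.sets_into_space)
  finally show ?thesis .
qed

text \<open>S collects the failures of an approximation, while the box provides compactness. The
  cost of leaving the box depends on the two marginal laws alone, hence is uniform along a family
  with fixed laws.\<close>

lemma expectation_close_on_box:
  fixes f g A B :: "'a \<Rightarrow> real"
  assumes mA [measurable]: "A \<in> borel_measurable M" and mB [measurable]: "B \<in> borel_measurable M"
    and mf: "f \<in> borel_measurable M" and mg: "g \<in> borel_measurable M" and S: "S \<in> events"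
    and f: "\<And>w. \<bar>f w\<bar> \<le> C" and g: "\<And>w. \<bar>g w\<bar> \<le> C"
    and close: "\<And>w. w \<in> space M - S \<Longrightarrow> \<bar>A w\<bar> \<le> R \<Longrightarrow> \<bar>B w\<bar> \<le> R \<Longrightarrow> \<bar>f w - g w\<bar> \<le> e" and e: "0 \<le> e"
  shows "\<bar>expectation f - expectation g\<bar> \<le>
    e + 2 * C * (prob S + (prob {w\<in>space M. R < \<bar>A w\<bar>} + prob {w\<in>space M. R < \<bar>B w\<bar>}))"
proof -
  let ?SA = "{w\<in>space M. R < \<bar>A w\<bar>}" and ?SB = "{w\<in>space M. R < \<bar>B w\<bar>}"
  have ev: "?SA \<in> events" "?SB \<in> events" by measurable
  have C: "0 \<le> C" using f[of undefined] by linarith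
  have "\<bar>expectation f - expectation g\<bar> \<le> e + 2 * C * prob (S \<union> (?SA \<union> ?SB))"
    using S ev close by (intro expectation_close_off_set[OF mf mg _ f g _ e]) auto
  also have "prob (S \<union> (?SA \<union> ?SB)) \<le> prob S + (prob ?SA + prob ?SB)"
    using S ev by (intro order.trans[OF measure_Un_le] add_left_mono measure_Un_le) auto
  finally show ?thesis using C by (simp add: mult_left_mono)
qed

lemma prob_abs_greater_distr:
  fixes A :: "'a \<Rightarrow> real"
  assumes [measurable]: "A \<in> borel_measurable M"
  shows "prob {w\<in>space M. c < \<bar>A w\<bar>} = measure (distr M borel A) {x. c < \<bar>x\<bar>}"
  by (subst measure_distr) (auto intro!: arg_cong[where f = prob])

lemma prob_abs_greater_tendsto_0:
  fixes A :: "'a \<Rightarrow> real"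
  assumes [measurable]: "A \<in> borel_measurable M"
  shows "(\<lambda>n. prob {w\<in>space M. real n < \<bar>A w\<bar>}) \<longlonglongrightarrow> 0"
proof -
  have "(\<lambda>n. prob {w\<in>space M. real n < \<bar>A w\<bar>}) \<longlonglongrightarrow> prob (\<Inter>n. {w\<in>space M. real n < \<bar>A w\<bar>})"
    by (rule finite_Lim_measure_decseq) (auto simp: decseq_def)
  also have "(\<Inter>n. {w\<in>space M. real n < \<bar>A w\<bar>}) = {}"
  proof -
    have "\<exists>n. \<not> real n < \<bar>A w\<bar>" for w
      using reals_Archimedean2[of "\<bar>A w\<bar>"] by (auto simp: not_less intro: less_imp_le)
    then show ?thesis by auto
  qed
  finally show ?thesis by simp
qed

end

text \<open>Freezing the first variable on a fine grid reduces functions of two variables to finite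
  sums of products.\<close>

lemma product_approximation:
  fixes g :: "real \<Rightarrow> real \<Rightarrow> real" and C e R :: real
  assumes cont: "continuous_on UNIV (\<lambda>p. g (fst p) (snd p))" and g: "\<And>x z. \<bar>g x z\<bar> \<le> C" and e: "0 < e" and R: "0 \<le> R"
  obtains I :: "int set" and N :: nat where "finite I" "0 < N"
    "\<And>x z :: real. \<bar>\<Sum>i\<in>I. indicator {x. \<lfloor>real N * x\<rfloor> = i} x * g (real_of_int i / real N) z\<bar> \<le> C"
    "\<And>x z :: real. \<bar>x\<bar> \<le> R \<Longrightarrow> \<bar>z\<bar> \<le> R \<Longrightarrow> \<bar>g x z - (\<Sum>i\<in>I. indicator {x. \<lfloor>real N * x\<rfloor> = i} x * g (real_of_int i / real N) z)\<bar> \<le> e"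
proof -
  let ?K = "{- R - 1..R + 1} \<times> {- R..R}"
  have "uniformly_continuous_on ?K (\<lambda>p. g (fst p) (snd p))"
    by (rule compact_uniformly_continuous) (auto intro: continuous_on_subset[OF cont] compact_Times)
  then obtain d where d: "0 < d" "\<And>p q. p \<in> ?K \<Longrightarrow> q \<in> ?K \<Longrightarrow> dist q p < d \<Longrightarrow> dist (g (fst q) (snd q)) (g (fst p) (snd p)) < e"
    unfolding uniformly_continuous_on_def using e by metis
  obtain N :: nat where N: "0 < N" "1 / real N < min d 1"
    using reals_Archimedean3[of "min d 1"] d(1) nat_approx_posE[of "min d 1"] by (metis min_less_iff_conj zero_less_Suc zero_less_one)
  define I where "I = {- \<lceil>N * R\<rceil> - 1..\<lceil>N * R\<rceil> + 1}"
  have fin: "finite I" by (simp add: I_def)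
  have sum_eq: "(\<Sum>i\<in>I. indicator {x. \<lfloor>real N * x\<rfloor> = i} x * g (real_of_int i / real N) z) = (if \<lfloor>real N * x\<rfloor> \<in> I then g (\<lfloor>real N * x\<rfloor> / N) z else 0)" for x z
  proof -
    have "(\<Sum>i\<in>I. indicator {x. \<lfloor>real N * x\<rfloor> = i} x * g (real_of_int i / real N) z) = (\<Sum>i\<in>I. if \<lfloor>real N * x\<rfloor> = i then g (real_of_int i / real N) z else 0)"
      by (intro sum.cong) (auto simp: indicator_def)
    then show ?thesis using fin by simp
  qed
  have C: "0 \<le> C" using g[of 0 0] by linarith
  show thesis
  proof (rule that[OF fin N(1)])
    show "\<bar>\<Sum>i\<in>I. indicator {x. \<lfloor>real N * x\<rfloor> = i} x * g (real_of_int i / real N) z\<bar> \<le> C" for x z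
      unfolding sum_eq using g C by simp
    show "\<bar>g x z - (\<Sum>i\<in>I. indicator {x. \<lfloor>real N * x\<rfloor> = i} x * g (real_of_int i / real N) z)\<bar> \<le> e" if x: "\<bar>x\<bar> \<le> R" and z: "\<bar>z\<bar> \<le> R" for x z
    proof -
      define q where "q = \<lfloor>real N * x\<rfloor> / N"
      have "real_of_int \<lfloor>real N * x\<rfloor> \<le> N * x" "N * x < real_of_int \<lfloor>real N * x\<rfloor> + 1" by linarith+
      then have "q \<le> x" "x < q + 1 / N"
        using N(1) by (simp_all add: q_def field_simps)
      then have q: "\<bar>q - x\<bar> < min d 1" using N(2) by linarith
      have xN: "real N * x \<le> N * R" "- (N * R) \<le> real N * x"
        using mult_left_mono[of x R "real N"] mult_left_mono[of "- R" x "real N"] x by auto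
      then have "\<lfloor>real N * x\<rfloor> \<in> I" unfolding I_def atLeastAtMost_iff by linarith
      moreover have "dist (g q z) (g x z) < e"
      proof -
        have "(x, z) \<in> ?K" "(q, z) \<in> ?K" using x z q by (auto simp: abs_le_iff abs_less_iff)
        then show ?thesis using d(2)[of "(x, z)" "(q, z)"] q by (simp add: dist_Pair_Pair dist_real_def)
      qed
      ultimately show ?thesis
        unfolding sum_eq by (simp add: q_def dist_real_def abs_minus_commute)
    qed
  qed
qed

text \<open>For products of a function of \<xi> and a function of X k, mixing makes the expectation
  factorize in the limit, and on N independence does so exactly. Approximation by finite sums of
  products on a large box extends this to g; the tails outside are the same for all k since all X k
  share one law.\<close>

lemma joint_convergence:
  fixes X :: "'i \<Rightarrow> 'a \<Rightarrow> real" and xi :: "'a \<Rightarrow> real" and xi' Z :: "'b \<Rightarrow> real" and g :: "real \<Rightarrow> real \<Rightarrow> real"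
  assumes M: "prob_space M" and N: "prob_space N"
    and mX: "\<And>k. X k \<in> borel_measurable M" and mxi: "xi \<in> borel_measurable M"
    and mxi': "xi' \<in> borel_measurable N" and mZ: "Z \<in> borel_measurable N"
    and lawX: "\<And>k. distr M borel (X k) = distr N borel Z" and law_xi: "distr N borel xi' = distr M borel xi"
    and indepX: "\<And>i. \<forall>\<^sub>F k in F. prob_space.indep_var M borel (X i) borel (X k)"
    and indepZ: "prob_space.indep_var N borel xi' borel Z"
    and cont: "continuous_on UNIV (\<lambda>p. g (fst p) (snd p))" and g: "\<And>x z. \<bar>g x z\<bar> \<le> C"
  shows "((\<lambda>k. LINT w|M. g (xi w) (X k w)) \<longlongrightarrow> (LINT w|N. g (xi' w) (Z w))) F"
proof (rule tendstoI)
  fix e :: real assume e: "0 < e"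
  interpret M: prob_space M by fact
  interpret N: prob_space N by fact
  note [measurable] = mX mxi mxi' mZ
  have C: "0 \<le> C" using g[of 0 0] by linarith
  let ?PA = "\<lambda>n. N.prob {w\<in>space N. real n < \<bar>xi' w\<bar>}" and ?PZ = "\<lambda>n. N.prob {w\<in>space N. real n < \<bar>Z w\<bar>}"
  have PA: "M.prob {w\<in>space M. real n < \<bar>xi w\<bar>} = ?PA n" for n
    by (simp add: M.prob_abs_greater_distr N.prob_abs_greater_distr law_xi)
  have PX: "M.prob {w\<in>space M. real n < \<bar>X k w\<bar>} = ?PZ n" for n k
    by (simp add: M.prob_abs_greater_distr N.prob_abs_greater_distr lawX)
  have "(\<lambda>n. 2 * C * (?PA n + ?PZ n)) \<longlonglongrightarrow> 2 * C * (0 + 0)"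
    by (intro tendsto_intros N.prob_abs_greater_tendsto_0) simp_all
  then have "\<forall>\<^sub>F n in sequentially. 2 * C * (?PA n + ?PZ n) < e / 4"
    using e by (intro order_tendstoD(2)) auto
  then obtain n where n: "2 * C * (?PA n + ?PZ n) < e / 4" by (auto simp: eventually_sequentially)
  have e8: "0 < e / 8" using e by simp
  obtain I :: "int set" and K :: nat where I: "finite I" and K: "0 < K"
    and G: "\<And>x z. \<bar>\<Sum>i\<in>I. indicator {x. \<lfloor>real K * x\<rfloor> = i} x * g (real_of_int i / real K) z\<bar> \<le> C"
    and close: "\<And>x z. \<bar>x\<bar> \<le> real n \<Longrightarrow> \<bar>z\<bar> \<le> real n \<Longrightarrow> \<bar>g x z - (\<Sum>i\<in>I. indicator {x. \<lfloor>real K * x\<rfloor> = i} x * g (real_of_int i / real K) z)\<bar> \<le> e / 8"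
    by (rule product_approximation[OF cont g e8 of_nat_0_le_iff[of n]]) blast
  let ?G = "\<lambda>x z. \<Sum>i\<in>I. indicator {x. \<lfloor>real K * x\<rfloor> = i} x * g (real_of_int i / real K) z"
  have mg: "(\<lambda>p. g (fst p) (snd p)) \<in> borel_measurable (borel \<Otimes>\<^sub>M borel)"
    unfolding borel_prod by (rule borel_measurable_continuous_onI[OF cont])
  have mgi [measurable]: "g x \<in> borel_measurable borel" for x
    using measurable_compose[OF _ mg, of "\<lambda>z. (x, z)" borel] by simp
  have [measurable]: "(\<lambda>p :: real \<times> real. g x (snd p)) \<in> borel_measurable (borel \<Otimes>\<^sub>M borel)" for x
    by (rule measurable_compose[OF measurable_snd mgi])
  have mG: "(\<lambda>p. ?G (fst p) (snd p)) \<in> borel_measurable (borel \<Otimes>\<^sub>M borel)"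
    by measurable
  have pair: "(\<lambda>w. f (U w) (V w)) \<in> borel_measurable P"
    if "(\<lambda>p. f (fst p) (snd p)) \<in> borel_measurable (borel \<Otimes>\<^sub>M borel)"
      "U \<in> borel_measurable P" "V \<in> borel_measurable P"
    for f :: "real \<Rightarrow> real \<Rightarrow> real" and U V :: "'c \<Rightarrow> real" and P
    using measurable_compose[OF _ that(1), of "\<lambda>w. (U w, V w)" P] that(2,3) by simp
  \<comment> \<open>The 3 * e / 8 consists of e / 8 on the box and e / 4 for the tails. Twice this
    and a final e / 8 stay below e.\<close>
  have closeM: "\<bar>(LINT w|M. g (xi w) (X k w)) - (LINT w|M. ?G (xi w) (X k w))\<bar> < 3 * e / 8" for k
    using M.expectation_close_on_box[OF mxi mX[of k] pair[OF mg mxi mX[of k]] pair[OF mG mxi mX[of k]]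
        sets.empty_sets g G, of n "e / 8"] close e8 n unfolding PA PX by simp
  have closeN: "\<bar>(LINT w|N. g (xi' w) (Z w)) - (LINT w|N. ?G (xi' w) (Z w))\<bar> < 3 * e / 8"
    using N.expectation_close_on_box[OF mxi' mZ pair[OF mg mxi' mZ] pair[OF mG mxi' mZ]
        sets.empty_sets g G, of n "e / 8"] close e8 n by simp
  let ?W = "\<lambda>i x. indicator {x. \<lfloor>real K * x\<rfloor> = i} x :: real"
  have W1: "\<bar>?W i x\<bar> \<le> 1" for i x by (simp add: indicator_def)
  have iM: "integrable M (\<lambda>w. ?W i (xi w) * g (real_of_int i / real K) (X k w))" for i k
    by (rule M.integrable_bounded[where C = "1 * C"], measurable) (use mult_mono[OF W1 g] in \<open>simp add: abs_mult\<close>)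
  have iN: "integrable N (\<lambda>w. ?W i (xi' w) * g (real_of_int i / real K) (Z w))" for i
    by (rule N.integrable_bounded[where C = "1 * C"], measurable) (use mult_mono[OF W1 g] in \<open>simp add: abs_mult\<close>)
  have summand: "((\<lambda>k. LINT w|M. ?W i (xi w) * g (real_of_int i / real K) (X k w)) \<longlongrightarrow> (LINT w|N. ?W i (xi' w) * g (real_of_int i / real K) (Z w))) F" for i
  proof -
    have "((\<lambda>k. LINT w|M. ?W i (xi w) * g (real_of_int i / real K) (X k w)) \<longlongrightarrow> (LINT w|M. ?W i (xi w)) * (LINT x|distr N borel Z. g (real_of_int i / real K) x)) F"
      by (rule M.mixing[OF mX lawX indepX _ g _ W1]) measurable
    also have "(LINT w|M. ?W i (xi w)) = (LINT x|distr M borel xi. ?W i x)"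
      by (rule integral_distr[symmetric]) measurable
    also have "\<dots> = (LINT w|N. ?W i (xi' w))"
      unfolding law_xi[symmetric] by (rule integral_distr) measurable
    also have "(LINT x|distr N borel Z. g (real_of_int i / real K) x) = (LINT w|N. g (real_of_int i / real K) (Z w))" by (simp add: integral_distr)
    also have "(LINT w|N. ?W i (xi' w)) * (LINT w|N. g (real_of_int i / real K) (Z w)) = (LINT w|N. ?W i (xi' w) * g (real_of_int i / real K) (Z w))"
    proof (rule N.indep_var_lebesgue_integral[symmetric])
      show "N.indep_var borel (\<lambda>w. ?W i (xi' w)) borel (\<lambda>w. g (real_of_int i / real K) (Z w))"
        using N.indep_var_compose[OF indepZ, of "?W i" borel "g (real_of_int i / real K)" borel] by (simp add: comp_def)
      show "integrable N (\<lambda>w. ?W i (xi' w))" by (rule N.integrable_bounded[OF _ W1]) measurable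
      show "integrable N (\<lambda>w. g (real_of_int i / real K) (Z w))" by (rule N.integrable_bounded[OF _ g]) measurable
    qed
    finally show ?thesis .
  qed
  have "((\<lambda>k. LINT w|M. ?G (xi w) (X k w)) \<longlongrightarrow> (LINT w|N. ?G (xi' w) (Z w))) F"
    using iM iN summand by (simp add: tendsto_sum)
  then have "\<forall>\<^sub>F k in F. dist (LINT w|M. ?G (xi w) (X k w)) (LINT w|N. ?G (xi' w) (Z w)) < e / 8"
    using e8 by (rule tendstoD)
  then show "\<forall>\<^sub>F k in F. dist (LINT w|M. g (xi w) (X k w)) (LINT w|N. g (xi' w) (Z w)) < e"
  proof eventually_elim
    case (elim k)
    then show ?case using closeM[of k] closeN unfolding dist_real_def by linarith
  qed
qed

section \<open>The path space\<close>

text \<open>\<open>C[0,T]\<close> is identified with the bounded continuous functions on the line that are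
  constant outside \<open>[0,T]\<close>, so that the type-class topology becomes available.\<close>

definition stretch :: "real \<Rightarrow> (real \<Rightarrow> real) \<Rightarrow> real \<Rightarrow>\<^sub>C real" where
  "stretch T f = Bcontfun (\<lambda>t. f (max 0 (min t T)))"

definition segment :: "real \<Rightarrow> (real \<Rightarrow>\<^sub>C real) \<Rightarrow> real \<Rightarrow> real" where
  "segment T f = (\<lambda>t\<in>{0..T}. f t)"

lemma apply_stretch:
  assumes T: "0 \<le> T" and f: "continuous_on {0..T} f"
  shows "apply_bcontfun (stretch T f) t = f (max 0 (min t T))"
proof -
  have "(\<lambda>t. f (max 0 (min t T))) \<in> bcontfun"
    unfolding bcontfun_def
  proof (intro CollectI conjI)
    show "continuous_on UNIV (\<lambda>t. f (max 0 (min t T)))"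
      by (rule continuous_on_compose2[OF f]) (use T in \<open>auto intro!: continuous_intros\<close>)
    have "bounded (f ` {0..T})"
      by (intro compact_imp_bounded compact_continuous_image f) simp
    then show "bounded (range (\<lambda>t. f (max 0 (min t T))))"
      by (rule bounded_subset) (use T in auto)
  qed
  then show ?thesis by (simp add: stretch_def Bcontfun_inverse)
qed

lemma segment_stretch:
  assumes "0 \<le> T" "continuous_on {0..T} f"
  shows "segment T (stretch T f) = restrict f {0..T}"
  by (auto simp: segment_def restrict_def apply_stretch[OF assms])

lemma dist_stretch_le:
  assumes T: "0 \<le> T" and f: "continuous_on {0..T} f" and g: "continuous_on {0..T} g"
    and e: "\<And>t. t \<in> {0..T} \<Longrightarrow> \<bar>f t - g t\<bar> \<le> e"
  shows "dist (stretch T f) (stretch T g) \<le> e"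
  by (rule dist_bound) (use e T in \<open>simp add: apply_stretch[OF T f] apply_stretch[OF T g] dist_real_def\<close>)

lemma segment_in_C_space:
  "segment T f \<in> topspace (C_space T)"
proof -
  have "continuous_on {0..T} (segment T f)"
    by (rule continuous_on_eq[of _ "apply_bcontfun f"]) (auto simp: segment_def)
  moreover have "bounded (segment T f ` {0..T})"
    by (rule bounded_subset[OF bounded_apply_bcontfun[of f]]) (auto simp: segment_def)
  ultimately show ?thesis
    unfolding C_space_def by (auto simp: segment_def)
qed

text \<open>Restriction does not increase distances. Its continuity pulls test functionals on
  \<open>C_space T\<close> back to the space of bounded continuous functions and carries Borel
  measurability forward.\<close>

lemma continuous_map_segment:
  "continuous_map euclidean (C_space T) (segment T)"
proof -
  let ?m = "cfunspace (top_of_set {0..T}) (euclidean_metric :: real metric)"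
  interpret Metric_space "mspace ?m" "mdist ?m" by (rule Metric_space_mspace_mdist)
  have in_m: "segment T f \<in> mspace ?m" for f
    using segment_in_C_space[of T f] by (simp only: C_space_def topspace_mtopology_of)
  have "continuous_map euclidean mtopology (segment T)"
    unfolding continuous_map_to_metric
  proof (intro ballI allI impI)
    fix f :: "real \<Rightarrow>\<^sub>C real" and e :: real assume e: "0 < e"
    have "segment T h \<in> mball (segment T f) e" if "h \<in> ball f (e / 2)" for h
    proof -
      have "mdist ?m (segment T f) (segment T h) \<le> e / 2"
      proof (rule mdist_cfunspace_le)
        fix t assume "t \<in> topspace (top_of_set {0..T})"
        then have "dist (segment T f t) (segment T h t) \<le> dist f h"
          by (simp add: segment_def dist_bounded)
        then show "mdist euclidean_metric (segment T f t) (segment T h t) \<le> e / 2"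
          using that by simp
      qed (use e in simp)
      then show ?thesis using e in_m[of f] in_m[of h] by (simp add: in_mball del: mspace_cfunspace)
    qed
    then show "\<exists>U. openin euclidean U \<and> f \<in> U \<and> (\<forall>y\<in>U. segment T y \<in> mball (segment T f) e)"
      using e by (intro exI[of _ "ball f (e / 2)"]) auto
  qed
  then show ?thesis by (simp add: C_space_def mtopology_of_def)
qed

lemma measurable_segment:
  assumes "f \<in> borel_measurable M"
  shows "(\<lambda>w. segment T (f w)) \<in> measurable M (borel_of_topology (C_space T))"
  unfolding borel_of_topology_def
proof (rule measurable_measure_of)
  show "{U. openin (C_space T) U} \<subseteq> Pow (topspace (C_space T))"
    by (auto dest: openin_subset)
  show "(\<lambda>w. segment T (f w)) \<in> space M \<rightarrow> topspace (C_space T)"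
    using segment_in_C_space by blast
  fix U assume "U \<in> {U. openin (C_space T) U}"
  then have "open (segment T -` U)"
    using openin_continuous_map_preimage[OF continuous_map_segment, of T U] by (simp add: vimage_def)
  then have "f -` (segment T -` U) \<inter> space M \<in> sets M"
    using assms by (intro measurable_sets[of f M borel]) auto
  then show "(\<lambda>w. segment T (f w)) -` U \<inter> space M \<in> sets M" by (simp add: vimage_def)
qed

lemma continuous_on_sum_scaleR:
  fixes f :: "'i \<Rightarrow> 'a::topological_space \<Rightarrow> real" and c :: "'i \<Rightarrow> 'b::real_normed_vector"
  assumes "\<And>i. i \<in> I \<Longrightarrow> continuous_on UNIV (f i)"
  shows "continuous_on UNIV (\<lambda>x. \<Sum>i\<in>I. f i x *\<^sub>R c i)"
  by (intro continuous_intros assms)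

text \<open>The space is not known to be second countable here; measurability comes from the
  Bernstein polynomials, which depend continuously on finitely many values of the path.\<close>

lemma borel_measurable_stretch:
  fixes Y :: "real \<Rightarrow> 'a \<Rightarrow> real"
  assumes T: "0 < T" and meas: "\<And>t. t \<in> {0..T} \<Longrightarrow> Y t \<in> borel_measurable M"
    and cont: "\<And>w. w \<in> space M \<Longrightarrow> continuous_on {0..T} (\<lambda>t. Y t w)"
  shows "(\<lambda>w. stretch T (\<lambda>t. Y t w)) \<in> borel_measurable M"
proof -
  \<comment> \<open>The Bernstein basis functions become fixed vectors of the path space, so each
    approximant is a finite linear combination with random real coefficients.\<close>
  define c where "c n k = stretch T (\<lambda>t. Bernstein n k (t / T))" for n k
  have cont_c: "continuous_on {0..T} (\<lambda>t. Bernstein n k (t / T))" for n k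
    unfolding Bernstein_def using T by (intro continuous_intros) auto
  \<comment> \<open>Padding with 0 beyond n makes the sampled values a point of
    \<open>nat \<Rightarrow> real\<close>, where measurability can be checked
    coordinatewise.\<close>
  define y where "y n w k = (if k \<le> n then Y (T * (real k / real n)) w else 0)" for n k :: nat and w
  have T0: "0 \<le> T" using T by simp
  show ?thesis
  proof (rule borel_measurable_LIMSEQ_metric)
    fix n
    have grid: "T * (real k / real n) \<in> {0..T}" if "k \<le> n" for k
    proof -
      have "real k / real n \<le> 1" using that by (cases "n = 0") auto
      from mult_left_mono[OF this, of T] show ?thesis using T by simp
    qed
    have "(\<lambda>w. y n w k) \<in> borel_measurable M" for k
      unfolding y_def using meas[OF grid[of k]] by (cases "k \<le> n") auto
    then have "y n \<in> borel_measurable M" by (rule measurable_coordinatewise_then_product)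
    moreover have "(\<lambda>x :: nat \<Rightarrow> real. \<Sum>k\<le>n. x k *\<^sub>R c n k) \<in> borel_measurable borel"
      by (intro borel_measurable_continuous_onI continuous_on_sum_scaleR continuous_on_product_coordinates)
    ultimately show "(\<lambda>w. \<Sum>k\<le>n. y n w k *\<^sub>R c n k) \<in> borel_measurable M"
      by (rule measurable_compose)
  next
    fix w assume w: "w \<in> space M"
    have sum_apply: "apply_bcontfun (\<Sum>k\<in>I. h k) t = (\<Sum>k\<in>I. apply_bcontfun (h k) t)"
      for I :: "nat set" and h :: "nat \<Rightarrow> real \<Rightarrow>\<^sub>C real" and t
      by (induction I rule: infinite_finite_induct) auto
    have scaled: "continuous_on {0..1} (\<lambda>x. Y (T * x) w)"
    proof (rule continuous_on_compose2[OF cont[OF w]])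
      show "(\<lambda>x. T * x) ` {0..1} \<subseteq> {0..T}"
        using T mult_left_mono[of _ 1 T] by auto
    qed (intro continuous_intros)
    show "(\<lambda>n. \<Sum>k\<le>n. y n w k *\<^sub>R c n k) \<longlonglongrightarrow> stretch T (\<lambda>t. Y t w)"
    proof (rule metric_LIMSEQ_I)
      fix e :: real assume e: "0 < e"
      then obtain N where N: "\<And>n x. N \<le> n \<Longrightarrow> x \<in> {0..1} \<Longrightarrow> \<bar>Y (T * x) w - (\<Sum>k\<le>n. Y (T * (k / n)) w * Bernstein n k x)\<bar> < e / 2"
        using Bernstein_Weierstrass[OF scaled, of "e / 2"] by auto
      have "dist (\<Sum>k\<le>n. y n w k *\<^sub>R c n k) (stretch T (\<lambda>t. Y t w)) < e" if n: "N \<le> n" for n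
      proof -
        have "dist (\<Sum>k\<le>n. y n w k *\<^sub>R c n k) (stretch T (\<lambda>t. Y t w)) \<le> e / 2"
        proof (rule dist_bound)
          fix t
          define x where "x = max 0 (min t T) / T"
          have x: "x \<in> {0..1}" "T * x = max 0 (min t T)" using T by (auto simp: x_def)
          show "dist ((\<Sum>k\<le>n. y n w k *\<^sub>R c n k) t) (stretch T (\<lambda>t. Y t w) t) \<le> e / 2"
            using N[OF n x(1)]
            by (simp add: sum_apply c_def y_def apply_stretch[OF T0 cont_c] apply_stretch[OF T0 cont[OF w]]
                dist_real_def abs_minus_commute x(2) flip: x_def)
        qed
        then show ?thesis using e by simp
      qed
      then show "\<exists>N. \<forall>n\<ge>N. dist (\<Sum>k\<le>n. y n w k *\<^sub>R c n k) (stretch T (\<lambda>t. Y t w)) < e" by blast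
    qed
  qed
qed

text \<open>A continuous functional on the path space need not be uniformly continuous. A Lebesgue
  number for a cover of K gives a uniform modulus when only one of the two points lies in K, as for
  a path close to an approximating one.\<close>

lemma continuous_near_compact:
  fixes \<psi> :: "'c::metric_space \<Rightarrow> real"
  assumes "compact K" "continuous_on UNIV \<psi>" and e: "0 < e"
  obtains d where "0 < d" "\<And>x y. x \<in> K \<Longrightarrow> dist x y < d \<Longrightarrow> \<bar>\<psi> x - \<psi> y\<bar> < e"
proof -
  let ?G = "range (\<lambda>c. \<psi> -` ball c (e / 2))"
  have cover: "K \<subseteq> \<Union>?G" 
  proof (rule subsetI)
    fix x
    have "x \<in> \<psi> -` ball (\<psi> x) (e / 2)" using e by simp
    then show "x \<in> \<Union>?G" by blast
  qed
  have op: "open G" if "G \<in> ?G" for G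
    using that assms(2) by (auto intro: open_vimage)
  obtain d where d: "0 < d" "\<And>x. x \<in> K \<Longrightarrow> \<exists>G\<in>?G. ball x d \<subseteq> G"
    using Heine_Borel_lemma[OF assms(1) cover op] by blast
  show thesis
  proof (rule that[OF d(1)])
    fix x y assume x: "x \<in> K" and xy: "dist x y < d"
    obtain c where c: "ball x d \<subseteq> \<psi> -` ball c (e / 2)" using d(2)[OF x] by blast
    then have "dist c (\<psi> x) < e / 2" "dist c (\<psi> y) < e / 2"
      using d(1) xy by (auto simp: subset_eq)
    then show "\<bar>\<psi> x - \<psi> y\<bar> < e" unfolding dist_real_def by linarith
  qed
qed

section \<open>Weak convergence\<close>

text \<open>The comparison points \<open>\<Phi> (xi w, X k w)\<close> lie with high probability,
  uniformly in k, in the compact image of one large square. Near this image the functional varies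
  uniformly, so closeness in probability suffices although \<psi> is merely continuous and
  bounded.\<close>

lemma expectation_perturbation:
  fixes V :: "'i \<Rightarrow> 'a \<Rightarrow> 'c::metric_space" and \<Phi> :: "real \<times> real \<Rightarrow> 'c" and \<psi> :: "'c \<Rightarrow> real"
    and X :: "'i \<Rightarrow> 'a \<Rightarrow> real" and xi :: "'a \<Rightarrow> real" and Z :: "'b \<Rightarrow> real"
  assumes M: "prob_space M" and N: "prob_space N"
    and mX: "\<And>k. X k \<in> borel_measurable M" and mxi: "xi \<in> borel_measurable M" and mZ: "Z \<in> borel_measurable N"
    and lawX: "\<And>k. distr M borel (X k) = distr N borel Z"
    and cont_\<Phi>: "continuous_on UNIV \<Phi>" and cont_\<psi>: "continuous_on UNIV \<psi>" and \<psi>: "\<And>x. \<bar>\<psi> x\<bar> \<le> C"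
    and mV: "\<forall>\<^sub>F k in F. V k \<in> borel_measurable M"
    and close: "\<And>e d. 0 < e \<Longrightarrow> 0 < d \<Longrightarrow> \<forall>\<^sub>F k in F. \<exists>A\<in>sets M. emeasure M A \<le> ennreal d \<and>
      (\<forall>w\<in>space M - A. dist (V k w) (\<Phi> (xi w, X k w)) \<le> e)"
  shows "((\<lambda>k. (LINT w|M. \<psi> (V k w)) - (LINT w|M. \<psi> (\<Phi> (xi w, X k w)))) \<longlongrightarrow> 0) F"
proof (rule tendstoI)
  fix e :: real assume e: "0 < e"
  interpret M: prob_space M by fact
  interpret N: prob_space N by fact
  note [measurable] = mX mxi mZ
  have C: "0 \<le> C" using \<psi>[of undefined] by linarith
  let ?PA = "\<lambda>n. M.prob {w\<in>space M. real n < \<bar>xi w\<bar>}" and ?PZ = "\<lambda>n. N.prob {w\<in>space N. real n < \<bar>Z w\<bar>}"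
  have PX: "M.prob {w\<in>space M. real n < \<bar>X k w\<bar>} = ?PZ n" for n k
    by (simp add: M.prob_abs_greater_distr N.prob_abs_greater_distr lawX)
  have "(\<lambda>n. 2 * C * (?PA n + ?PZ n)) \<longlonglongrightarrow> 2 * C * (0 + 0)"
    by (intro tendsto_intros N.prob_abs_greater_tendsto_0 M.prob_abs_greater_tendsto_0) simp_all
  then have "\<forall>\<^sub>F n in sequentially. 2 * C * (?PA n + ?PZ n) < e / 4"
    using e by (intro order_tendstoD(2)) auto
  then obtain n where n: "2 * C * (?PA n + ?PZ n) < e / 4" by (auto simp: eventually_sequentially)
  let ?K = "\<Phi> ` ({- real n..real n} \<times> {- real n..real n})"
  have "compact ?K"
    by (intro compact_continuous_image continuous_on_subset[OF cont_\<Phi>] compact_Times compact_Icc) auto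
  then obtain r where r: "0 < r" "\<And>x y. x \<in> ?K \<Longrightarrow> dist x y < r \<Longrightarrow> \<bar>\<psi> x - \<psi> y\<bar> < e / 4"
    using continuous_near_compact[OF _ cont_\<psi>, of ?K "e / 4"] e by auto
  \<comment> \<open>The added 1 avoids division by zero when C = 0, and the 8 yields
    \<open>2 * C * d \<le> e / 4\<close>.\<close>
  define d where "d = e / (8 * (C + 1))"
  have d: "0 < d" "2 * C * d \<le> e / 4" using e C by (auto simp: d_def field_simps)
  have "0 < r / 2" using r(1) by simp
  from close[OF this d(1)] mV
  show "\<forall>\<^sub>F k in F. dist ((LINT w|M. \<psi> (V k w)) - (LINT w|M. \<psi> (\<Phi> (xi w, X k w)))) 0 < e"
  proof eventually_elim
    case (elim k)
    then obtain A where A [measurable]: "A \<in> sets M" and small: "emeasure M A \<le> ennreal d"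
      and near: "\<And>w. w \<in> space M \<Longrightarrow> w \<notin> A \<Longrightarrow> dist (V k w) (\<Phi> (xi w, X k w)) \<le> r / 2" by blast
    have pA: "M.prob A \<le> d" using small d(1) by (simp add: M.emeasure_eq_measure)
    have m\<psi>: "\<psi> \<in> borel_measurable borel" by (rule borel_measurable_continuous_onI[OF cont_\<psi>])
    have mVk: "(\<lambda>w. \<psi> (V k w)) \<in> borel_measurable M"
      using elim(2) m\<psi> by (rule measurable_compose)
    have "(\<lambda>p. \<psi> (\<Phi> p)) \<in> borel_measurable borel"
      by (intro borel_measurable_continuous_onI continuous_on_compose2[OF cont_\<psi> cont_\<Phi>]) simp
    then have m\<Phi>: "(\<lambda>w. \<psi> (\<Phi> (xi w, X k w))) \<in> borel_measurable M"
      by (rule measurable_compose[rotated]) simp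
    have "\<bar>(LINT w|M. \<psi> (V k w)) - (LINT w|M. \<psi> (\<Phi> (xi w, X k w)))\<bar> \<le>
        e / 4 + 2 * C * (M.prob A + (?PA n + M.prob {w\<in>space M. real n < \<bar>X k w\<bar>}))"
    proof (rule M.expectation_close_on_box[OF mxi mX mVk m\<Phi> A \<psi> \<psi>])
      fix w assume w: "w \<in> space M - A" "\<bar>xi w\<bar> \<le> real n" "\<bar>X k w\<bar> \<le> real n"
      then have "\<Phi> (xi w, X k w) \<in> ?K" by (intro imageI) auto
      moreover have "dist (\<Phi> (xi w, X k w)) (V k w) < r"
        using near[of w] w r(1) by (simp add: dist_commute)
      ultimately show "\<bar>\<psi> (V k w) - \<psi> (\<Phi> (xi w, X k w))\<bar> \<le> e / 4"
        using r(2) by (fastforce simp: abs_minus_commute)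
    qed (use e in simp)
    also have "\<dots> = e / 4 + 2 * C * M.prob A + 2 * C * (?PA n + ?PZ n)"
      unfolding PX by (simp add: algebra_simps)
    also have "\<dots> < e" using n d(2) mult_left_mono[OF pA, of "2 * C"] C e by simp
    finally show ?case by (simp add: dist_real_def)
  qed
qed

section \<open>Application to the Rosenblatt Ornstein-Uhlenbeck process\<close>

lemma eventually_cell_low_ge: "\<forall>\<^sub>F H in at_left 1. n \<le> cell_low H"
proof -
  have "filterlim (\<lambda>H::real. 1 / (1 - H)) at_top (at_left 1)" by real_asymp
  then have "\<forall>\<^sub>F H in at_left 1. real n \<le> 1 / (1 - H)"
    by (simp add: filterlim_at_top)
  then show ?thesis
  proof eventually_elim
    case (elim H)
    then show ?case unfolding cell_low_def by linarith
  qed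
qed

lemma distr_std_normal:
  assumes "distributed M lborel X std_normal_density"
  shows "distr M borel X = density lborel std_normal_density"
proof -
  have "distr M borel X = distr M lborel X" by (rule distr_cong) simp_all
  then show ?thesis using distributed_distr_eq_density[OF assms] by simp
qed

lemma rosenblatt_OU_limit_eq:
  assumes lam: "0 < lam" and t: "0 \<le> t"
  shows "rosenblatt_OU_limit lam sig xi Z t w =
    exp (- lam * t) * xi w + sig / sqrt 2 * (exp (- lam * t) * exp_primitive lam t) * ((Z w)^2 - 1)"
proof -
  have "(LINT u:{0..t}|lborel. exp (- lam * (t - u))) = (LINT u|lborel. exp (- lam * t) * exp_integrand lam t u)"
    unfolding set_lebesgue_integral_def exp_integrand_def
    by (intro Bochner_Integration.integral_cong refl) (simp add: algebra_simps flip: exp_add)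
  also have "\<dots> = exp (- lam * t) * exp_primitive lam t"
    using has_bochner_integral_exp_integrand[OF lam t] by (simp add: has_bochner_integral_iff)
  finally show ?thesis unfolding rosenblatt_OU_limit_def by simp
qed

lemma exp_mult_exp_primitive: "exp (- lam * t) * exp_primitive lam t = (1 - exp (- lam * t)) / lam"
  by (simp add: exp_primitive_def right_diff_distrib flip: exp_add)

text \<open>Undoing the exponential factor, the initial value and \<sigma> leaves the stochastic
  integral minus its rank-one approximation. This process inherits continuity from Y, whereas its
  second moments are computed from arbitrary versions of the integral, one null set per time. Since
  \<open>exp (- lam * t) \<le> 1\<close>, the tolerance e / \<sigma> before rescaling gives e
  afterwards.\<close>

lemma rosenblatt_OU_uniform_approximation:
  fixes Y :: "real \<Rightarrow> real \<Rightarrow> 'a \<Rightarrow> real"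
  assumes W: "wiener_process M B" and lam: "0 < lam" and sig: "0 < sig" and T: "0 < T"
    and mxi: "xi \<in> borel_measurable M"
    and OU: "\<And>H. H \<in> {1/2<..<1} \<Longrightarrow> rosenblatt_OU M B lam sig xi T H (Y H)"
    and e: "0 < e" and d: "0 < d"
  shows "\<forall>\<^sub>F H in at_left 1. \<exists>A\<in>sets M. emeasure M A \<le> ennreal d \<and> (\<forall>w\<in>space M - A. \<forall>t\<in>{0..T}.
    \<bar>Y H t w - (exp (- lam * t) * xi w + sig / sqrt 2 * (exp (- lam * t) * exp_primitive lam t) * ((limit_gauss B T H w)^2 - 1))\<bar> \<le> e)"
proof -
  have T0: "0 \<le> T" using T by simp
  let ?X = "limit_gauss B T" and ?F = "exp_primitive lam"
  note [measurable] = borel_measurable_limit_gauss[OF W T0] mxi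
  define D where "D H t w = (exp (lam * t) * Y H t w - xi w) / sig - ?F t / sqrt 2 * ((?X H w)^2 - 1)" for H t w
  have ev: "\<forall>\<^sub>F H in at_left 1. H \<in> {3/4<..<1::real}"
    by (rule eventually_at_left_real) simp
  have version: "\<exists>S. has_double_wiener_integral M B (J_kernel H (exp_integrand lam t)) S \<and>
      (AE w in M. D H t w = S w - ?F t / sqrt 2 * ((?X H w)^2 - 1))"
    if H: "H \<in> {3/4<..<1}" and t: "t \<in> {0..T}" for H t
  proof -
    have "rosenblatt_OU M B lam sig xi T H (Y H)" using OU[of H] H by simp
    then obtain S where S: "has_wiener_rosenblatt_integral M B H (\<lambda>u. indicator {0..t} u * exp (lam * u)) S"
      and Y: "AE w in M. Y H t w = exp (- lam * t) * (xi w + sig * S w)"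
      unfolding rosenblatt_OU_def using t by blast
    have "(\<lambda>u. indicator {0..t} u * exp (lam * u)) = exp_integrand lam t" by (simp add: exp_integrand_def[abs_def])
    with S have "has_double_wiener_integral M B (J_kernel H (exp_integrand lam t)) S"
      by (simp add: has_wiener_rosenblatt_integral_def)
    moreover from Y have "AE w in M. D H t w = S w - ?F t / sqrt 2 * ((?X H w)^2 - 1)"
    proof eventually_elim
      case (elim w)
      have "exp (lam * t) * Y H t w = xi w + sig * S w"
        unfolding elim by (simp add: mult.assoc[symmetric] flip: exp_add)
      then show ?case using sig by (simp add: D_def)
    qed
    ultimately show ?thesis by blast
  qed
  have "\<forall>\<^sub>F H in at_left 1. \<exists>A\<in>sets M. emeasure M A \<le> ennreal d \<and> (\<forall>w\<in>space M - A. \<forall>t\<in>{0..T}. \<bar>D H t w\<bar> \<le> e / sig)"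
  proof (rule uniform_convergence_in_probability[OF T])
    show "0 \<le> increment_const lam T" using T by (simp add: increment_const_def)
    show "0 < e / sig" "0 < d" using e sig d by auto
    show "\<forall>\<^sub>F H in at_left 1. \<forall>t\<in>{0..T}. D H t \<in> borel_measurable M"
      using ev
    proof eventually_elim
      case (elim H)
      have "rosenblatt_OU M B lam sig xi T H (Y H)" using OU[of H] elim by simp
      then have Y: "Y H t \<in> borel_measurable M" if "t \<in> {0..T}" for t
        using that by (simp add: rosenblatt_OU_def)
      show ?case
      proof
        fix t assume "t \<in> {0..T}"
        note [measurable] = Y[OF this]
        show "D H t \<in> borel_measurable M" unfolding D_def by measurable
      qed
    qed
    show "\<forall>\<^sub>F H in at_left 1. \<forall>w\<in>space M. continuous_on {0..T} (\<lambda>t. D H t w)"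
      using ev
    proof eventually_elim
      case (elim H)
      have "rosenblatt_OU M B lam sig xi T H (Y H)" using OU[of H] elim by simp
      then show ?case
        unfolding D_def exp_primitive_def rosenblatt_OU_def using sig lam by (auto intro!: continuous_intros)
    qed
    have "((\<lambda>H. (rosenblatt_const H * overlap_const H)^2) \<longlongrightarrow> (1 / sqrt 2)^2) (at_left 1)"
      by (intro tendsto_intros rosenblatt_overlap_asymp)
    \<comment> \<open>The limit is 1/2, so the uniform increment estimate is available for H near
      1.\<close>
    then have "\<forall>\<^sub>F H in at_left 1. (rosenblatt_const H * overlap_const H)^2 < 1"
      by (intro order_tendstoD(2)) (auto simp: power_divide)
    with ev show "\<forall>\<^sub>F H in at_left 1. \<forall>s t. 0 \<le> s \<longrightarrow> s \<le> t \<longrightarrow> t \<le> T \<longrightarrow>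
      (sqnorm M (\<lambda>w. D H t w - D H s w)) \<le> ennreal (increment_const lam T * ((t - s) * sqrt (t - s)))"
    proof eventually_elim
      case (elim H)
      show ?case
      proof (intro allI impI)
        fix s t assume st: "0 \<le> s" "s \<le> t" "t \<le> T"
        obtain S where S: "has_double_wiener_integral M B (J_kernel H (exp_integrand lam t)) S"
          and DS: "AE w in M. D H t w = S w - ?F t / sqrt 2 * ((?X H w)^2 - 1)"
          using version[OF elim(1), of t] st by auto
        obtain S' where S': "has_double_wiener_integral M B (J_kernel H (exp_integrand lam s)) S'"
          and DS': "AE w in M. D H s w = S' w - ?F s / sqrt 2 * ((?X H w)^2 - 1)"
          using version[OF elim(1), of s] st by auto
        have "(sqnorm M (\<lambda>w. D H t w - D H s w)) =
          (sqnorm M (\<lambda>w. (S w - ?F t / sqrt 2 * ((?X H w)^2 - 1)) - (S' w - ?F s / sqrt 2 * ((?X H w)^2 - 1))))"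
        proof (rule nn_integral_cong_AE)
          from DS DS' show "AE w in M. ennreal ((D H t w - D H s w)^2) =
            ennreal (((S w - ?F t / sqrt 2 * ((?X H w)^2 - 1)) - (S' w - ?F s / sqrt 2 * ((?X H w)^2 - 1)))^2)"
            by eventually_elim simp
        qed
        also have "\<dots> \<le> ennreal (increment_const lam T * ((t - s) * sqrt (t - s)))"
          using elim by (intro double_integral_increment[OF W _ _ lam st _ S S']) auto
        finally show "(sqnorm M (\<lambda>w. D H t w - D H s w)) \<le> ennreal (increment_const lam T * ((t - s) * sqrt (t - s)))" .
      qed
    qed
    fix t assume t: "t \<in> {0..T}"
    let ?b = "\<lambda>H. 54 * max 0 (approx_error lam T t H) + 3 * (?F t)^2 * (1 / weight_sum T H)"
    show "((\<lambda>H. \<integral>\<^sup>+w. ennreal ((D H t w)^2) \<partial>M) \<longlongrightarrow> 0) (at_left 1)"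
    proof (rule tendsto_sandwich[where f = "\<lambda>_. 0" and h = "\<lambda>H. ennreal (?b H)"])
      show "\<forall>\<^sub>F H in at_left 1. (sqnorm M (\<lambda>w. D H t w)) \<le> ennreal (?b H)"
        using ev
      proof eventually_elim
        case (elim H)
        obtain S where S: "has_double_wiener_integral M B (J_kernel H (exp_integrand lam t)) S"
          and DS: "AE w in M. D H t w = S w - ?F t / sqrt 2 * ((?X H w)^2 - 1)"
          using version[OF elim t] by auto
        have "(sqnorm M (\<lambda>w. D H t w)) = (sqnorm M (\<lambda>w. S w - ?F t / sqrt 2 * ((?X H w)^2 - 1)))"
        proof (rule nn_integral_cong_AE)
          from DS show "AE w in M. ennreal ((D H t w)^2) = ennreal ((S w - ?F t / sqrt 2 * ((?X H w)^2 - 1))^2)"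
            by eventually_elim simp
        qed
        also have "\<dots> \<le> ennreal (54 * max 0 (approx_error lam T t H) + 3 * (?F t)^2 / weight_sum T H)"
          using elim t by (intro double_integral_approximation[OF W _ _ lam _ _ S]) auto
        finally show ?case by simp
      qed
      have "(?b \<longlongrightarrow> 54 * max 0 0 + 3 * (?F t)^2 * 0) (at_left 1)"
        by (intro tendsto_intros approx_error_tendsto inverse_weight_sum_tendsto[OF T0])
      then show "((\<lambda>H. ennreal (?b H)) \<longlongrightarrow> 0) (at_left 1)"
        using tendsto_ennrealI by fastforce
    qed simp_all
  qed
  then show ?thesis
  proof eventually_elim
    case (elim H)
    then obtain A where A: "A \<in> sets M" "emeasure M A \<le> ennreal d"
      and small: "\<And>w t. w \<in> space M - A \<Longrightarrow> t \<in> {0..T} \<Longrightarrow> \<bar>D H t w\<bar> \<le> e / sig" by blast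
    have "\<bar>Y H t w - (exp (- lam * t) * xi w + sig / sqrt 2 * (exp (- lam * t) * ?F t) * ((?X H w)^2 - 1))\<bar> \<le> e"
      if w: "w \<in> space M - A" and t: "t \<in> {0..T}" for w t
    proof -
      have inv: "exp (- lam * t) * exp (lam * t) = 1" by (simp flip: exp_add)
      have "sig * exp (- lam * t) * D H t w = exp (- lam * t) * (sig * ((exp (lam * t) * Y H t w - xi w) / sig))
          - sig / sqrt 2 * (exp (- lam * t) * ?F t) * ((?X H w)^2 - 1)"
      proof -
        have "s * u * (y - w / r * q) = u * (s * y) - s / r * (u * w) * q" for s u y w r q :: real
          by (simp add: right_diff_distrib)
        then show ?thesis unfolding D_def by blast
      qed
      also have "exp (- lam * t) * (sig * ((exp (lam * t) * Y H t w - xi w) / sig)) = Y H t w - exp (- lam * t) * xi w"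
      proof -
        have c: "sig * (x / sig) = x" for x using sig by simp
        show ?thesis unfolding c right_diff_distrib mult.assoc[symmetric] inv by simp
      qed
      finally have eq: "sig * exp (- lam * t) * D H t w = Y H t w - exp (- lam * t) * xi w
          - sig / sqrt 2 * (exp (- lam * t) * ?F t) * ((?X H w)^2 - 1)" .
      have "\<bar>Y H t w - (exp (- lam * t) * xi w + sig / sqrt 2 * (exp (- lam * t) * ?F t) * ((?X H w)^2 - 1))\<bar>
          = \<bar>sig * exp (- lam * t) * D H t w\<bar>"
        unfolding eq diff_diff_eq ..
      also have "\<dots> = sig * exp (- lam * t) * \<bar>D H t w\<bar>"
        using sig by (simp add: abs_mult)
      also have "\<dots> \<le> sig * 1 * (e / sig)"
        using small[OF w t] sig lam t by (intro mult_mono) auto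
      finally show ?thesis using sig by simp
    qed
    with A show ?case by blast
  qed
qed

theorem proposition4:
  fixes M :: "'a measure" and B :: "real \<Rightarrow> 'a \<Rightarrow> real"
    and lam sig T :: real and xi :: "'a \<Rightarrow> real"
    and Y :: "real \<Rightarrow> real \<Rightarrow> 'a \<Rightarrow> real"
    and N :: "'b measure" and xi' Z :: "'b \<Rightarrow> real"
  assumes "wiener_process M B"
    and "lam > 0" and "sig > 0" and "T > 0"
    and "xi \<in> borel_measurable M" and "integrable M (\<lambda>\<omega>. (xi \<omega>)\<^sup>2)"
    and "\<And>H. H \<in> {1/2<..<1} \<Longrightarrow> rosenblatt_OU M B lam sig xi T H (Y H)"
    and "prob_space N"
    and "xi' \<in> borel_measurable N" and "distr N borel xi' = distr M borel xi"
    and "distributed N lborel Z std_normal_density"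
    and "prob_space.indep_var N borel xi' borel Z"
  shows "converges_weakly (C_space T) M (\<lambda>H. path_on T (Y H)) N
           (path_on T (rosenblatt_OU_limit lam sig xi' Z)) (at_left 1)
         \<and> (\<forall>t\<in>{0..T}. \<forall>\<omega>. rosenblatt_OU_limit lam sig xi' Z t \<omega> =
              exp (- lam * t) * xi' \<omega>
                + sig / (sqrt 2 * lam) * (1 - exp (- lam * t)) * ((Z \<omega>)\<^sup>2 - 1))"
proof
  note W = assms(1) and lam = assms(2) and sig = assms(3) and T = assms(4) and mxi = assms(5)
    and OU = assms(7) and N = assms(8) and mxi' = assms(9)
  have T0: "0 \<le> T" using T by simp
  have M: "prob_space M" using W by (simp add: wiener_process_def)
  have mZ: "Z \<in> borel_measurable N" using assms(11) by (auto simp: distributed_def)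
  show "\<forall>t\<in>{0..T}. \<forall>\<omega>. rosenblatt_OU_limit lam sig xi' Z t \<omega> =
      exp (- lam * t) * xi' \<omega> + sig / (sqrt 2 * lam) * (1 - exp (- lam * t)) * ((Z \<omega>)\<^sup>2 - 1)"
    by (simp add: rosenblatt_OU_limit_eq[OF lam] exp_mult_exp_primitive[of lam, simplified])
  let ?X = "limit_gauss B T"
  define E where "E x z t = exp (- lam * t) * x + sig / sqrt 2 * (exp (- lam * t) * exp_primitive lam t) * (z\<^sup>2 - 1)" for x z t
  have cont_E: "continuous_on {0..T} (E x z)" for x z
    unfolding E_def exp_primitive_def using lam by (intro continuous_intros) auto
  \<comment> \<open>The limiting path as a function of the initial value and the Gaussian; it is
    fixed, so all dependence on H sits in the Gaussian argument.\<close>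
  define \<Phi> where "\<Phi> p = stretch T (E (fst p) (snd p))" for p
  have cont_\<Phi>: "continuous_on UNIV \<Phi>"
  proof -
    let ?a = "\<lambda>t. exp (- lam * t)" and ?b = "\<lambda>t. sig / sqrt 2 * (exp (- lam * t) * exp_primitive lam t)"
    have ca: "continuous_on {0..T} ?a" by (intro continuous_intros)
    have cb: "continuous_on {0..T} ?b" unfolding exp_primitive_def using lam by (intro continuous_intros) auto
    \<comment> \<open>Linear in x and z^2 - 1 with two fixed paths as coefficients, whence
      continuity into the supremum norm.\<close>
    have "\<Phi> p = fst p *\<^sub>R stretch T ?a + ((snd p)\<^sup>2 - 1) *\<^sub>R stretch T ?b" for p
      by (rule bcontfun_eqI, unfold \<Phi>_def plus_bcontfun.rep_eq scaleR_bcontfun.rep_eq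
          apply_stretch[OF T0 cont_E] apply_stretch[OF T0 ca] apply_stretch[OF T0 cb] E_def)
         (simp add: mult.commute)
    then have "\<Phi> = (\<lambda>p. fst p *\<^sub>R stretch T ?a + ((snd p)\<^sup>2 - 1) *\<^sub>R stretch T ?b)" by blast
    then show ?thesis by (simp only:) (intro continuous_intros)
  qed
  have m\<Phi>: "\<Phi> \<in> borel_measurable borel" by (rule borel_measurable_continuous_onI[OF cont_\<Phi>])
  define V where "V H \<omega> = stretch T (\<lambda>t. Y H t \<omega>)" for H \<omega>
  have ev: "\<forall>\<^sub>F H in at_left 1. H \<in> {1/2<..<1::real}"
    by (rule eventually_at_left_real) simp
  have Y: "continuous_on {0..T} (\<lambda>t. Y H t \<omega>)" if "H \<in> {1/2<..<1}" "\<omega> \<in> space M" for H \<omega>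
    using OU[OF that(1)] that(2) by (simp add: rosenblatt_OU_def)
  have mV: "V H \<in> borel_measurable M" if H: "H \<in> {1/2<..<1}" for H
    unfolding V_def using OU[OF H] by (intro borel_measurable_stretch[OF T]) (auto simp: rosenblatt_OU_def)
  have path_V: "path_on T (Y H) \<omega> = segment T (V H \<omega>)" if "H \<in> {1/2<..<1}" "\<omega> \<in> space M" for H \<omega>
    unfolding V_def path_on_def by (rule segment_stretch[OF T0 Y[OF that], symmetric])
  have path_limit: "path_on T (rosenblatt_OU_limit lam sig xi' Z) \<omega> = segment T (\<Phi> (xi' \<omega>, Z \<omega>))" for \<omega>
    unfolding \<Phi>_def segment_stretch[OF T0 cont_E] path_on_def
    by (auto simp: restrict_def rosenblatt_OU_limit_eq[OF lam] E_def)
  show "converges_weakly (C_space T) M (\<lambda>H. path_on T (Y H)) N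
           (path_on T (rosenblatt_OU_limit lam sig xi' Z)) (at_left 1)"
    unfolding converges_weakly_def
  proof (intro conjI allI impI)
    show "\<forall>\<^sub>F H in at_left 1. path_on T (Y H) \<in> measurable M (borel_of_topology (C_space T))"
      using ev
    proof eventually_elim
      case (elim H)
      then show ?case
        using measurable_segment[OF mV[OF elim], of T] path_V[OF elim] by (subst measurable_cong) auto
    qed
    have "(\<lambda>\<omega>. \<Phi> (xi' \<omega>, Z \<omega>)) \<in> borel_measurable N"
      using mxi' mZ by (intro measurable_compose[OF _ m\<Phi>]) simp
    from measurable_segment[OF this, of T]
    show "path_on T (rosenblatt_OU_limit lam sig xi' Z) \<in> measurable N (borel_of_topology (C_space T))"
      by (subst measurable_cong[OF path_limit])
    fix \<phi> :: "(real \<Rightarrow> real) \<Rightarrow> real"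
    assume \<phi>: "continuous_map (C_space T) euclideanreal \<phi> \<and> bounded (\<phi> ` topspace (C_space T))"
    \<comment> \<open>The test functional is pulled back along the restriction map, to a space where
      type-class continuity applies.\<close>
    define \<psi> where "\<psi> f = \<phi> (segment T f)" for f
    have "continuous_map euclidean euclideanreal (\<phi> \<circ> segment T)"
      using \<phi> by (intro continuous_map_compose[OF continuous_map_segment]) auto
    then have cont_\<psi>: "continuous_on UNIV \<psi>" by (simp add: \<psi>_def[abs_def] comp_def)
    obtain C where "\<And>x. x \<in> topspace (C_space T) \<Longrightarrow> \<bar>\<phi> x\<bar> \<le> C"
      using \<phi> unfolding bounded_iff by auto
    then have \<psi>: "\<bar>\<psi> f\<bar> \<le> C" for f unfolding \<psi>_def using segment_in_C_space by blast
    have mX: "?X H \<in> borel_measurable M" for H by (rule borel_measurable_limit_gauss[OF W T0])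
    have lawX: "distr M borel (?X H) = distr N borel Z" for H
      by (simp add: distr_std_normal[OF limit_gauss_distributed[OF W T0]] distr_std_normal[OF assms(11)])
    have "((\<lambda>H. (LINT \<omega>|M. \<psi> (V H \<omega>)) - (LINT \<omega>|M. \<psi> (\<Phi> (xi \<omega>, ?X H \<omega>)))) \<longlongrightarrow> 0) (at_left 1)"
    proof (rule expectation_perturbation[OF M N mX mxi mZ lawX cont_\<Phi> cont_\<psi> \<psi>])
      show "\<forall>\<^sub>F H in at_left 1. V H \<in> borel_measurable M"
        using ev by eventually_elim (rule mV)
      fix e d :: real assume ed: "0 < e" "0 < d"
      have "\<forall>\<^sub>F H in at_left 1. \<exists>A\<in>sets M. emeasure M A \<le> ennreal d \<and>
          (\<forall>\<omega>\<in>space M - A. \<forall>t\<in>{0..T}. \<bar>Y H t \<omega> - E (xi \<omega>) (?X H \<omega>) t\<bar> \<le> e)"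
        unfolding E_def by (rule rosenblatt_OU_uniform_approximation[OF W lam sig T mxi OU ed])
      then show "\<forall>\<^sub>F H in at_left 1. \<exists>A\<in>sets M. emeasure M A \<le> ennreal d \<and>
          (\<forall>\<omega>\<in>space M - A. dist (V H \<omega>) (\<Phi> (xi \<omega>, ?X H \<omega>)) \<le> e)"
        using ev
      proof eventually_elim
        case (elim H)
        then obtain A where A: "A \<in> sets M" "emeasure M A \<le> ennreal d"
          and small: "\<And>\<omega> t. \<omega> \<in> space M - A \<Longrightarrow> t \<in> {0..T} \<Longrightarrow> \<bar>Y H t \<omega> - E (xi \<omega>) (?X H \<omega>) t\<bar> \<le> e"
          by blast
        have "dist (V H \<omega>) (\<Phi> (xi \<omega>, ?X H \<omega>)) \<le> e" if "\<omega> \<in> space M - A" for \<omega>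
          unfolding V_def \<Phi>_def using dist_stretch_le[OF T0 Y[OF elim(2)] cont_E] small[OF that] that by simp
        with A show ?case by blast
      qed
    qed
    moreover have "((\<lambda>H. LINT \<omega>|M. \<psi> (\<Phi> (xi \<omega>, ?X H \<omega>))) \<longlongrightarrow> (LINT \<omega>|N. \<psi> (\<Phi> (xi' \<omega>, Z \<omega>)))) (at_left 1)"
    \<comment> \<open>The limit pair lives on N with independent coordinates, while on M the initial
      value and the Gaussians may be dependent; only the law of \<xi> is transferred.\<close>
    proof (rule joint_convergence[OF M N mX mxi mxi' mZ lawX assms(10) _ assms(12)])
      show "\<forall>\<^sub>F H in at_left 1. prob_space.indep_var M borel (?X H') borel (?X H)" for H'
        \<comment> \<open>For fixed H', the cells of H eventually start to the left of all cells of
          H'.\<close>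
        using eventually_cell_low_ge[of "cell_high H'"] by eventually_elim (rule limit_gauss_indep[OF W])
      show "continuous_on UNIV (\<lambda>p. \<psi> (\<Phi> (fst p, snd p)))"
        using continuous_on_compose2[OF cont_\<psi> cont_\<Phi>] by simp
    qed (rule \<psi>)
    ultimately have "((\<lambda>H. LINT \<omega>|M. \<psi> (V H \<omega>)) \<longlongrightarrow> (LINT \<omega>|N. \<psi> (\<Phi> (xi' \<omega>, Z \<omega>)))) (at_left 1)"
      using Lim_transform by fastforce
    moreover have "\<forall>\<^sub>F H in at_left 1. (LINT \<omega>|M. \<psi> (V H \<omega>)) = (LINT \<omega>|M. \<phi> (path_on T (Y H) \<omega>))"
      using ev
    proof eventually_elim
      case (elim H)
      then show ?case by (intro Bochner_Integration.integral_cong refl) (simp add: path_V \<psi>_def)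
    qed
    ultimately show "((\<lambda>H. LINT \<omega>|M. \<phi> (path_on T (Y H) \<omega>)) \<longlongrightarrow>
        (LINT \<omega>|N. \<phi> (path_on T (rosenblatt_OU_limit lam sig xi' Z) \<omega>))) (at_left 1)"
      unfolding path_limit \<psi>_def by (rule Lim_transform_eventually)
  qed
qed

end
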